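(* Let $\phi:(\Delta_1,M_1)\to(\Delta_2,M_2)$ be a finite morphism of reflexive pairs of dimension $n$. Then the Calabi-Yau hypersurfaces in $\mathbf{P}_{\Delta_1,M_1}$ are quotients of some Calabi-Yau hypersurfaces in $\mathbf{P}_{\Delta_2,M_2}$ by the action of the finite abelian group dual to $M_2/\phi(M_1)$.
   Context: A reflexive pair $(\Delta,M)$ of dimension $n$ consists of a free abelian group $M$ of rank $n$ and an $n$-dimensional convex polytope $\Delta\subset M_{\mathbf{Q}}=M\otimes\mathbf{Q}$ with vertices in $M$ and $0$ in its interior, such that each affine hyperplane spanned by an $(n-1)$-dimensional face is $\{x:\langle x,l\rangle=c\}$ with $l\in N=\mathrm{Hom}(M,\mathbf{Z})$ primitive and $|c|=1$. A finite morphism $\phi:(\Delta_1,M_1)\to(\Delta_2,M_2)$ of reflexive pairs of equal dimension is a homomorphism of lattices $\phi:M_1\to M_2$ with $\phi(\Delta_1)=\Delta_2$. $\mathbf{P}_{\Delta,M}=\mathrm{Proj}\,S_\Delta$, where $S_\Delta$ has $\mathbf{C}$-basis $1$ and $X_0^{m_0}X^m$ with $m_0\ge1$, $m\in M$, $m/m_0\in\Delta$, graded by $m_0$. It is a compactification of the torus $\mathbf{T}$ with character group $M$ and the disjoint union of $\mathbf{T}$-orbits $\mathbf{T}_\Theta$ indexed by the faces $\Theta\subset\Delta$. The Calabi-Yau hypersurfaces in $\mathbf{P}_{\Delta,M}$ are the $\Delta$-regular hypersurfaces $\overline{Z}_f$: closures of $\{f=0\}\subset\mathbf{T}$, where $f$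 is a Laurent polynomial with Newton polyhedron $\Delta$ such that every $\overline{Z}_f\cap\mathbf{T}_\Theta$ is empty or smooth of codimension $1$ in $\mathbf{T}_\Theta$. The homomorphism $\phi$ induces a surjective homomorphism of tori $\mathbf{T}_{\Delta_2}\to\mathbf{T}_{\Delta_1}$ with kernel the group dual to $M_2/\phi(M_1)$, and a finite surjective toric morphism $\mathbf{P}_{\Delta_2,M_2}\to\mathbf{P}_{\Delta_1,M_1}$; the action of the dual group is through this kernel. *)

theory Defs
  imports
    "HOL-Analysis.Abstract_Topology"
    "HOL-Algebra.Coset"
    "HOL-Library.Poly_Mapping"
    "HOL-Library.Product_Plus"
begin

section \<open>Rational vector spaces, lattices and polytopes\<close>

class rat_vector = ab_group_add +
  fixes scaleQ :: "rat \<Rightarrow> 'a \<Rightarrow> 'a"  (infixr \<open>*\<^sub>Q\<close> 75)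
  assumes scaleQ_add_right: "a *\<^sub>Q (x + y) = a *\<^sub>Q x + a *\<^sub>Q y"
    and scaleQ_add_left: "(a + b) *\<^sub>Q x = a *\<^sub>Q x + b *\<^sub>Q x"
    and scaleQ_scaleQ: "a *\<^sub>Q (b *\<^sub>Q x) = (a * b) *\<^sub>Q x"
    and scaleQ_one: "1 *\<^sub>Q x = x"

global_interpretation ratv: vector_space "scaleQ :: rat \<Rightarrow> 'v::rat_vector \<Rightarrow> 'v"
  by unfold_locales (rule scaleQ_add_right scaleQ_add_left scaleQ_scaleQ scaleQ_one)+

definition Q_basis :: "'v::rat_vector set \<Rightarrow> bool" where
  "Q_basis B \<longleftrightarrow> finite B \<and> \<not> ratv.dependent B \<and> ratv.span B = UNIV"

text \<open>
  A free abelian group \<open>M\<close> of rank \<open>n\<close> together with \<open>M \<otimes> \<rat>\<close> is given as the rational vector space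
  \<open>M \<otimes> \<rat>\<close> (the type \<open>'v\<close>) with \<open>M\<close> the set of integral combinations of one of its \<open>n\<close>-element bases.
\<close>
definition lattice_of_rank :: "nat \<Rightarrow> 'v::rat_vector set \<Rightarrow> bool" where
  "lattice_of_rank n M \<longleftrightarrow>
     (\<exists>B. Q_basis B \<and> card B = n \<and> M = {\<Sum>b\<in>B. of_int (c b) *\<^sub>Q b | c :: 'v \<Rightarrow> int. True})"

definition linear_form :: "('v::rat_vector \<Rightarrow> rat) \<Rightarrow> bool" where
  "linear_form l \<longleftrightarrow> Vector_Spaces.linear scaleQ (*) l"

text \<open>\<open>Hom(M, \<int>)\<close>, each homomorphism being extended linearly to \<open>M \<otimes> \<rat>\<close>.\<close>
definition dual_lattice :: "'v::rat_vector set \<Rightarrow> ('v \<Rightarrow> rat) set" where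
  "dual_lattice M = {l. linear_form l \<and> l ` M \<subseteq> \<int>}"

definition primitive_form :: "'v::rat_vector set \<Rightarrow> ('v \<Rightarrow> rat) \<Rightarrow> bool" where
  "primitive_form M l \<longleftrightarrow> l \<in> dual_lattice M \<and>
     (\<forall>(k::int) l'. l' \<in> dual_lattice M \<and> l = (\<lambda>x. of_int k * l' x) \<longrightarrow> \<bar>k\<bar> = 1)"

definition affine_hullQ :: "'v::rat_vector set \<Rightarrow> 'v set" where
  "affine_hullQ S =
     {\<Sum>a\<in>A. u a *\<^sub>Q a | A u. finite A \<and> A \<subseteq> S \<and> (\<Sum>a\<in>A. u a) = 1}"

definition convex_hullQ :: "'v::rat_vector set \<Rightarrow> 'v set" where
  "convex_hullQ S =
     {\<Sum>a\<in>A. u a *\<^sub>Q a | A u. finite A \<and> A \<subseteq> S \<and> (\<forall>a\<in>A. 0 \<le> u a) \<and> (\<Sum>a\<in>A. u a) = 1}"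

text \<open>For nonempty \<open>S\<close>: the dimension of the linear space parallel to the affine hull of \<open>S\<close>.\<close>
definition aff_dimQ :: "'v::rat_vector set \<Rightarrow> nat" where
  "aff_dimQ S = ratv.dim {x - y | x y. x \<in> S \<and> y \<in> S}"

text \<open>Interior in the topology of \<open>\<rat>\<^sup>n\<close>; this does not depend on the basis giving the coordinates.\<close>
definition interiorQ :: "'v::rat_vector set \<Rightarrow> 'v set" where
  "interiorQ S = {x. \<exists>B. \<exists>\<epsilon>>0. Q_basis B \<and>
     (\<forall>c. (\<forall>b\<in>B. \<bar>c b\<bar> < \<epsilon>) \<longrightarrow> x + (\<Sum>b\<in>B. c b *\<^sub>Q b) \<in> S)}"

text \<open>Nonempty faces, the polytope itself (\<open>l = 0\<close>, \<open>c = 0\<close>) included.\<close>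
definition face_ofQ :: "'v::rat_vector set \<Rightarrow> 'v set \<Rightarrow> bool" where
  "face_ofQ \<Theta> \<Delta> \<longleftrightarrow> \<Theta> \<noteq> {} \<and>
     (\<exists>l c. linear_form l \<and> (\<forall>x\<in>\<Delta>. c \<le> l x) \<and> \<Theta> = {x\<in>\<Delta>. l x = c})"

definition polytopeQ :: "'v::rat_vector set \<Rightarrow> bool" where
  "polytopeQ \<Delta> \<longleftrightarrow> (\<exists>A. finite A \<and> \<Delta> = convex_hullQ A)"

definition reflexive_pair :: "nat \<Rightarrow> 'v::rat_vector set \<Rightarrow> 'v set \<Rightarrow> bool" where
  "reflexive_pair n \<Delta> M \<longleftrightarrow>
     lattice_of_rank n M \<and>
     polytopeQ \<Delta> \<and> aff_dimQ \<Delta> = n \<and>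
     (\<forall>v. face_ofQ {v} \<Delta> \<longrightarrow> v \<in> M) \<and>
     0 \<in> interiorQ \<Delta> \<and>
     (\<forall>\<Theta>. face_ofQ \<Theta> \<Delta> \<and> Suc (aff_dimQ \<Theta>) = n \<longrightarrow>
        (\<exists>l c. primitive_form M l \<and> \<bar>c\<bar> = 1 \<and> affine_hullQ \<Theta> = {x. l x = c}))"

text \<open>A homomorphism \<open>M1 \<rightarrow> M2\<close> is given by its unique linear extension \<open>\<phi>\<close> to \<open>M1 \<otimes> \<rat>\<close>.\<close>
definition finite_morphism ::
  "nat \<Rightarrow> ('v::rat_vector \<Rightarrow> 'w::rat_vector) \<Rightarrow> 'v set \<Rightarrow> 'v set \<Rightarrow> 'w set \<Rightarrow> 'w set \<Rightarrow> bool" where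
  "finite_morphism n \<phi> \<Delta>1 M1 \<Delta>2 M2 \<longleftrightarrow>
     reflexive_pair n \<Delta>1 M1 \<and> reflexive_pair n \<Delta>2 M2 \<and>
     Vector_Spaces.linear scaleQ scaleQ \<phi> \<and> \<phi> ` M1 \<subseteq> M2 \<and> \<phi> ` \<Delta>1 = \<Delta>2"


section \<open>The projective toric variety\<close>

text \<open>
  \<open>'v \<Rightarrow>\<^sub>0 complex\<close> is the monoid algebra of \<open>'v\<close> over the complex numbers. Laurent polynomials are
  its elements with exponents in \<open>M\<close>, and \<open>Poly_Mapping.single (k, m) 1\<close> stands for \<open>X\<^sub>0\<^sup>k X\<^sup>m\<close>.
\<close>
type_synonym 'v graded_poly = "(nat \<times> 'v) \<Rightarrow>\<^sub>0 complex"

text \<open>The points of a projective spectrum are classes of homomorphisms to the complex numbers.\<close>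
type_synonym 'v point = "('v graded_poly \<Rightarrow> complex) set"

definition laurent :: "'v::rat_vector set \<Rightarrow> ('v \<Rightarrow>\<^sub>0 complex) set" where
  "laurent M = {f. Poly_Mapping.keys f \<subseteq> M}"

definition exponents :: "'v::rat_vector set \<Rightarrow> 'v set \<Rightarrow> (nat \<times> 'v) set" where
  "exponents \<Delta> M =
     insert (0, 0) {(k, m) | k m. 1 \<le> k \<and> m \<in> M \<and> inverse (of_nat k) *\<^sub>Q m \<in> \<Delta>}"

definition S_ring :: "'v::rat_vector set \<Rightarrow> 'v set \<Rightarrow> 'v graded_poly set" where
  "S_ring \<Delta> M = {F. Poly_Mapping.keys F \<subseteq> exponents \<Delta> M}"

definition S_part :: "'v::rat_vector set \<Rightarrow> 'v set \<Rightarrow> nat \<Rightarrow> 'v graded_poly set" where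
  "S_part \<Delta> M d = {F \<in> S_ring \<Delta> M. \<forall>a \<in> Poly_Mapping.keys F. fst a = d}"

text \<open>
  Homomorphisms of algebras from \<open>S_ring \<Delta> M\<close> to the complex numbers that do not vanish on the
  irrelevant ideal, extended by \<open>0\<close> outside \<open>S_ring \<Delta> M\<close>.
\<close>
definition cone_points :: "'v::rat_vector set \<Rightarrow> 'v set \<Rightarrow> ('v graded_poly \<Rightarrow> complex) set" where
  "cone_points \<Delta> M = {\<xi>.
     (\<forall>F \<in> S_ring \<Delta> M. \<forall>G \<in> S_ring \<Delta> M. \<xi> (F + G) = \<xi> F + \<xi> G \<and> \<xi> (F * G) = \<xi> F * \<xi> G) \<and>
     (\<forall>c. \<xi> (Poly_Mapping.single 0 c) = c) \<and>
     (\<exists>d\<ge>1. \<exists>F \<in> S_part \<Delta> M d. \<xi> F \<noteq> 0) \<and>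
     (\<forall>F. F \<notin> S_ring \<Delta> M \<longrightarrow> \<xi> F = 0)}"

definition proj_rel ::
  "'v::rat_vector set \<Rightarrow> 'v set \<Rightarrow> (('v graded_poly \<Rightarrow> complex) \<times> ('v graded_poly \<Rightarrow> complex)) set" where
  "proj_rel \<Delta> M = {(\<xi>, \<eta>). \<xi> \<in> cone_points \<Delta> M \<and> \<eta> \<in> cone_points \<Delta> M \<and>
     (\<exists>z. z \<noteq> 0 \<and> (\<forall>d. \<forall>F \<in> S_part \<Delta> M d. \<eta> F = z ^ d * \<xi> F))}"

text \<open>
  Varieties are treated classically. The closed points of \<open>Proj S\<close>, for a finitely generated graded
  algebra \<open>S\<close> over the complex numbers, are the closed points of \<open>Spec S\<close> off the irrelevant locus,
  modulo the action of the multiplicative group given by the grading.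
\<close>
definition toric_variety :: "'v::rat_vector set \<Rightarrow> 'v set \<Rightarrow> 'v point set" where
  "toric_variety \<Delta> M = cone_points \<Delta> M // proj_rel \<Delta> M"

definition zariski :: "'v::rat_vector set \<Rightarrow> 'v set \<Rightarrow> 'v point topology" where
  "zariski \<Delta> M = topology_generated_by
     {{p \<in> toric_variety \<Delta> M. \<forall>\<xi>\<in>p. \<xi> F \<noteq> 0} | F. \<exists>d. F \<in> S_part \<Delta> M d}"

text \<open>
  Regular functions on an open subset \<open>U\<close> of the reduced locally closed subvariety \<open>Z\<close>: locally
  quotients of homogeneous elements of the same degree.
\<close>
definition regular_on ::
  "'v::rat_vector set \<Rightarrow> 'v set \<Rightarrow> 'v point set \<Rightarrow> 'v point set \<Rightarrow> ('v point \<Rightarrow> complex) \<Rightarrow> bool" where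
  "regular_on \<Delta> M Z U h \<longleftrightarrow>
     (\<forall>p\<in>U. \<exists>W d. \<exists>A \<in> S_part \<Delta> M d. \<exists>B \<in> S_part \<Delta> M d.
        openin (subtopology (zariski \<Delta> M) Z) W \<and> p \<in> W \<and> W \<subseteq> U \<and>
        (\<forall>q\<in>W. \<forall>\<xi>\<in>q. \<xi> B \<noteq> 0 \<and> h q = \<xi> A / \<xi> B))"


section \<open>The torus and its orbits\<close>

definition lattice_group :: "'v::rat_vector set \<Rightarrow> 'v monoid" where
  "lattice_group M = \<lparr>carrier = M, mult = (+), one = 0\<rparr>"

definition complex_units :: "complex monoid" where
  "complex_units = \<lparr>carrier = - {0}, mult = (*), one = 1\<rparr>"

text \<open>Elements of the torus with character group \<open>M\<close>; only their values on \<open>M\<close> matter.\<close>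
definition torus :: "'v::rat_vector set \<Rightarrow> ('v \<Rightarrow> complex) set" where
  "torus M = hom (lattice_group M) complex_units"

definition laurent_eval :: "('v \<Rightarrow>\<^sub>0 complex) \<Rightarrow> ('v \<Rightarrow> complex) \<Rightarrow> complex" where
  "laurent_eval f t = (\<Sum>m \<in> Poly_Mapping.keys f. Poly_Mapping.lookup f m * t m)"

text \<open>The open embedding of the torus: \<open>X\<^sub>0\<^sup>k X\<^sup>m\<close> takes the value \<open>t m\<close>.\<close>
definition torus_point :: "'v::rat_vector set \<Rightarrow> 'v set \<Rightarrow> ('v \<Rightarrow> complex) \<Rightarrow> 'v point" where
  "torus_point \<Delta> M t = proj_rel \<Delta> M ``
     {\<lambda>F. if F \<in> S_ring \<Delta> M then laurent_eval F (\<lambda>a. t (snd a)) else 0}"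

text \<open>
  The torus acts on \<open>S_ring \<Delta> M\<close> by multiplying \<open>X\<^sub>0\<^sup>k X\<^sup>m\<close> with \<open>t m\<close>.
\<close>
definition torus_act :: "'v::rat_vector set \<Rightarrow> 'v set \<Rightarrow> ('v \<Rightarrow> complex) \<Rightarrow> 'v point \<Rightarrow> 'v point" where
  "torus_act \<Delta> M t p =
     (\<lambda>\<xi> F. if F \<in> S_ring \<Delta> M then \<xi> (Poly_Mapping.mapp (\<lambda>a c. t (snd a) * c) F) else 0) ` p"

text \<open>The orbit of \<open>\<Theta>\<close>: exactly the monomials with exponents over \<open>\<Theta>\<close> do not vanish.\<close>
definition torus_orbit :: "'v::rat_vector set \<Rightarrow> 'v set \<Rightarrow> 'v set \<Rightarrow> 'v point set" where
  "torus_orbit \<Delta> M \<Theta> = {p \<in> toric_variety \<Delta> M. \<forall>\<xi>\<in>p. \<forall>k\<ge>1. \<forall>m. (k, m) \<in> exponents \<Delta> M \<longrightarrow>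
     (\<xi> (Poly_Mapping.single (k, m) 1) \<noteq> 0 \<longleftrightarrow> inverse (of_nat k) *\<^sub>Q m \<in> \<Theta>)}"


section \<open>Calabi-Yau hypersurfaces\<close>

definition newton_polyhedron :: "('v::rat_vector \<Rightarrow>\<^sub>0 complex) \<Rightarrow> 'v set" where
  "newton_polyhedron f = convex_hullQ (Poly_Mapping.keys f)"

definition closure_hypersurface ::
  "'v::rat_vector set \<Rightarrow> 'v set \<Rightarrow> ('v \<Rightarrow>\<^sub>0 complex) \<Rightarrow> 'v point set" where
  "closure_hypersurface \<Delta> M f =
     zariski \<Delta> M closure_of {torus_point \<Delta> M t | t. t \<in> torus M \<and> laurent_eval f t = 0}"

text \<open>The linear map between monoid algebras sending the monomial \<open>a\<close> to the monomial \<open>h a\<close>.\<close>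
definition monomial_map :: "('a \<Rightarrow> 'b) \<Rightarrow> ('a \<Rightarrow>\<^sub>0 complex) \<Rightarrow> ('b \<Rightarrow>\<^sub>0 complex)" where
  "monomial_map h F =
     (\<Sum>a \<in> Poly_Mapping.keys F. Poly_Mapping.single (h a) (Poly_Mapping.lookup F a))"

text \<open>
  Homogeneous elements of the ideal of the scheme-theoretic closure of the subscheme \<open>f = 0\<close> of the
  torus: \<open>F\<close> of degree \<open>d\<close> belongs to it iff the Laurent polynomial \<open>F / X\<^sub>0\<^sup>d\<close> is a multiple of \<open>f\<close>.
\<close>
definition closure_ideal ::
  "'v::rat_vector set \<Rightarrow> 'v set \<Rightarrow> ('v \<Rightarrow>\<^sub>0 complex) \<Rightarrow> 'v graded_poly set" where
  "closure_ideal \<Delta> M f =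
     {F. (\<exists>d. F \<in> S_part \<Delta> M d) \<and> (\<exists>q \<in> laurent M. monomial_map snd F = f * q)}"

text \<open>
  Infinitesimal action of \<open>\<delta> \<in> Hom(M, \<complex>)\<close>, the Lie algebra of the torus: the derivation
  multiplying \<open>X\<^sub>0\<^sup>k X\<^sup>m\<close> with \<open>\<delta> m\<close>.
\<close>
definition torus_derivation :: "('v \<Rightarrow> complex) \<Rightarrow> 'v graded_poly \<Rightarrow> 'v graded_poly" where
  "torus_derivation \<delta> F = Poly_Mapping.mapp (\<lambda>a c. \<delta> (snd a) * c) F"

text \<open>
  Let \<open>p\<close> be a point of the orbit of \<open>\<Theta>\<close> at which the homogeneous elements of \<open>I\<close> vanish. The
  scheme-theoretic intersection of the zero scheme of \<open>I\<close> with the orbit is smooth of codimension 1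
  at \<open>p\<close> iff near \<open>p\<close> it is cut out in the orbit by one function with nonzero differential at \<open>p\<close>.
  Local functions are written with homogeneous numerators \<open>F\<close>, \<open>G\<close>; the multiplier \<open>A / H\<close> is regular
  at \<open>p\<close> since \<open>H\<close> does not vanish there. The torus acts transitively on the orbit, so the
  derivations above give all tangent vectors of the orbit at \<open>p\<close>; as \<open>G\<close> vanishes at \<open>p\<close>, the
  derivative of \<open>G / B\<close> at \<open>p\<close> is the value of \<open>\<delta>(G) / B\<close>.
\<close>
definition smooth_codim1_at ::
  "'v::rat_vector set \<Rightarrow> 'v set \<Rightarrow> 'v graded_poly set \<Rightarrow> 'v set \<Rightarrow> 'v point \<Rightarrow> bool" where
  "smooth_codim1_at \<Delta> M I \<Theta> p \<longleftrightarrow>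
     (\<exists>d. \<exists>G \<in> I \<inter> S_part \<Delta> M d.
        (\<forall>e. \<forall>F \<in> I \<inter> S_part \<Delta> M e.
           \<exists>i j. \<exists>H \<in> S_part \<Delta> M i. \<exists>A \<in> S_part \<Delta> M j.
             i + e = j + d \<and> (\<forall>\<xi>\<in>p. \<xi> H \<noteq> 0) \<and>
             (\<forall>q \<in> torus_orbit \<Delta> M \<Theta>. \<forall>\<xi>\<in>q. \<xi> H * \<xi> F = \<xi> A * \<xi> G)) \<and>
        (\<exists>\<delta>. (\<forall>x\<in>M. \<forall>y\<in>M. \<delta> (x + y) = \<delta> x + \<delta> y) \<and>
             (\<forall>\<xi>\<in>p. \<xi> (torus_derivation \<delta> G) \<noteq> 0)))"

definition regular_polynomial ::
  "'v::rat_vector set \<Rightarrow> 'v set \<Rightarrow> ('v \<Rightarrow>\<^sub>0 complex) \<Rightarrow> bool" where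
  "regular_polynomial \<Delta> M f \<longleftrightarrow> f \<in> laurent M \<and> newton_polyhedron f = \<Delta> \<and>
     (\<forall>\<Theta>. face_ofQ \<Theta> \<Delta> \<longrightarrow> (\<forall>p \<in> closure_hypersurface \<Delta> M f \<inter> torus_orbit \<Delta> M \<Theta>.
        smooth_codim1_at \<Delta> M (closure_ideal \<Delta> M f) \<Theta> p))"

definition calabi_yau_hypersurfaces :: "'v::rat_vector set \<Rightarrow> 'v set \<Rightarrow> 'v point set set" where
  "calabi_yau_hypersurfaces \<Delta> M = {closure_hypersurface \<Delta> M f | f. regular_polynomial \<Delta> M f}"


section \<open>The induced morphism and quotients\<close>

text \<open>Induced by the homomorphism \<open>X\<^sub>0\<^sup>k X\<^sup>m \<mapsto> X\<^sub>0\<^sup>k X\<^bsup>\<phi> m\<^esup>\<close> of graded algebras.\<close>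
definition toric_morphism ::
  "'v::rat_vector set \<Rightarrow> 'v set \<Rightarrow> ('v \<Rightarrow> 'w::rat_vector) \<Rightarrow> 'w point \<Rightarrow> 'v point" where
  "toric_morphism \<Delta>1 M1 \<phi> p =
     (\<lambda>\<xi> F. if F \<in> S_ring \<Delta>1 M1 then \<xi> (monomial_map (map_prod id \<phi>) F) else 0) ` p"

text \<open>Functions are taken extensional, so that a group element is determined by its values.\<close>
definition character_group :: "'a monoid \<Rightarrow> ('a \<Rightarrow> complex) monoid" where
  "character_group Q =
     \<lparr>carrier = hom Q complex_units \<inter> extensional (carrier Q),
      mult = (\<lambda>\<chi> \<psi>. \<lambda>x \<in> carrier Q. \<chi> x * \<psi> x),
      one = (\<lambda>x \<in> carrier Q. 1)\<rparr>"

text \<open>The group dual to \<open>M2 / L\<close>, for a sublattice \<open>L\<close>.\<close>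
definition dual_group :: "'w::rat_vector set \<Rightarrow> 'w set \<Rightarrow> ('w set \<Rightarrow> complex) monoid" where
  "dual_group M2 L = character_group (lattice_group M2 Mod L)"

text \<open>The dual group acts through its inclusion into the torus, as the characters of \<open>M2\<close> trivial on \<open>L\<close>.\<close>
definition dual_act ::
  "'w::rat_vector set \<Rightarrow> 'w set \<Rightarrow> 'w set \<Rightarrow> ('w set \<Rightarrow> complex) \<Rightarrow> 'w point \<Rightarrow> 'w point" where
  "dual_act \<Delta>2 M2 L \<chi> = torus_act \<Delta>2 M2 (\<lambda>m. \<chi> (L #>\<^bsub>lattice_group M2\<^esub> m))"

text \<open>
  \<open>\<pi>\<close> exhibits \<open>Z1\<close> as the quotient variety of \<open>Z2\<close> by the group \<open>G\<close> acting via \<open>act\<close>: the fibres are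
  the orbits, the topology is the quotient topology (which includes surjectivity), and the regular
  functions on \<open>Z1\<close> are the invariant regular functions on \<open>Z2\<close>. Functions of the form \<open>h \<circ> \<pi>\<close> are
  exactly the invariant ones.
\<close>
definition quotient_by ::
  "'w::rat_vector set \<Rightarrow> 'w set \<Rightarrow> 'w point set \<Rightarrow> 'v::rat_vector set \<Rightarrow> 'v set \<Rightarrow> 'v point set \<Rightarrow>
   'g monoid \<Rightarrow> ('g \<Rightarrow> 'w point \<Rightarrow> 'w point) \<Rightarrow> ('w point \<Rightarrow> 'v point) \<Rightarrow> bool" where
  "quotient_by \<Delta>2 M2 Z2 \<Delta>1 M1 Z1 G act \<pi> \<longleftrightarrow>
     (\<forall>g \<in> carrier G. act g ` Z2 = Z2) \<and>
     (\<forall>p\<in>Z2. \<forall>q\<in>Z2. \<pi> p = \<pi> q \<longleftrightarrow> (\<exists>g \<in> carrier G. q = act g p)) \<and>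
     quotient_map (subtopology (zariski \<Delta>2 M2) Z2) (subtopology (zariski \<Delta>1 M1) Z1) \<pi> \<and>
     (\<forall>U h. openin (subtopology (zariski \<Delta>1 M1) Z1) U \<longrightarrow>
        (regular_on \<Delta>1 M1 Z1 U h \<longleftrightarrow> regular_on \<Delta>2 M2 Z2 {p\<in>Z2. \<pi> p \<in> U} (h \<circ> \<pi>)))"

end

theory Submission
  imports Defs
begin

text \<open>
  A surjection \<open>\<phi>\<close> of lattices of equal rank tensored with the rationals is bijective, so \<open>L = \<phi>(M1)\<close> has
  finite index in \<open>M2\<close> and \<open>S_ring \<Delta>1 M1\<close> is the part of \<open>S_ring \<Delta>2 M2\<close> with exponents over \<open>L\<close>, that
  is, the ring of invariants of the dual group. For a regular \<open>f\<close> take the hypersurface of the image of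
  \<open>f\<close> under \<open>X\<^sup>m \<mapsto> X\<^bsup>\<phi> m\<^esup>\<close>; it is the full preimage of the hypersurface of \<open>f\<close>.

  Points of the toric variety are monoid homomorphisms from the exponents to the complex numbers, up
  to scaling. That the fibres are the orbits, and that points lift, follows by extending characters
  of subgroups, the multiplicative group of the complex numbers being divisible. To bring a section
  \<open>F\<close> with \<open>F(p) \<noteq> 0\<close> down to \<open>L\<close>, choose a monomial \<open>b\<close> of \<open>F\<close> not vanishing at \<open>p\<close> such that the part of
  \<open>F\<close> in the class of \<open>b\<close> modulo \<open>L\<close> does not vanish at \<open>p\<close>, multiply with \<open>b\<^bsup>N-1\<^esup>\<close>, where \<open>N\<close> annihilates
  \<open>M2/L\<close>, and keep the part over \<open>L\<close>, which is an average over the group. The topology, the regular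
  functions and the smoothness conditions are transferred in this way.
\<close>

section \<open>Monoid algebras\<close>

text \<open>Surjectivity of \<open>\<phi>\<close> over the rationals comes from
  \<open>\<Delta>2\<close> being a neighbourhood of 0 and equal to the image of
  \<open>\<Delta>1\<close>; injectivity is then a count of dimensions. The recurring obstacle is
  that local data upstairs are not adapted to \<open>L\<close>. A section may have no exponent over
  \<open>L\<close>, and then its average is 0; an open set on which a fraction represents a function
  need not be stable under the group. The exponent N-1 is dictated by the first problem: (N-1)b
  carries the class of \<open>b\<close> to that of N b, which is trivial, and the factor is
  invertible near the point. The boundary is the second obstacle: there a point is a character only
  on the monomials that do not vanish, so characters are extended from the group these generate, and
  the support of a lifted point has to be fixed separately, through N-fold multiples. Smoothness
  travels upwards, from \<open>f\<close> to its image: a local equation pulls back, and an additive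
  map on \<open>M1\<close> extends to \<open>M2\<close> by division by N, which reflects that an
  isogeny of tori is etale.\<close>

lemma keys_subset_induct [consumes 1, case_names zero single add]:
  fixes F :: "'a \<Rightarrow>\<^sub>0 'b::comm_monoid_add"
  assumes "Poly_Mapping.keys F \<subseteq> S"
    and zero: "P 0"
    and single: "\<And>a c. a \<in> S \<Longrightarrow> P (Poly_Mapping.single a c)"
    and add: "\<And>F G. Poly_Mapping.keys F \<subseteq> S \<Longrightarrow> Poly_Mapping.keys G \<subseteq> S \<Longrightarrow> P F \<Longrightarrow> P G \<Longrightarrow> P (F + G)"
  shows "P F"
proof -
  \<comment> \<open>Partial sums over subsets of the support; keeping their keys inside
    \<open>S\<close> is what the case \<open>add\<close> asks for.\<close>
  let ?s = "\<lambda>A. \<Sum>a\<in>A. Poly_Mapping.single a (Poly_Mapping.lookup F a)"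
  have "Poly_Mapping.keys (?s A) \<subseteq> S \<and> P (?s A)" if "finite A" "A \<subseteq> S" for A
    using that
  proof (induction A rule: finite_induct)
    case (insert x A)
    have "Poly_Mapping.keys (Poly_Mapping.single x (Poly_Mapping.lookup F x)) \<subseteq> S"
      using insert.prems by simp
    moreover have "Poly_Mapping.keys (?s A) \<subseteq> S" "P (?s A)"
      using insert by auto
    ultimately show ?case
      using insert.hyps insert.prems add single
        subset_trans[OF keys_add[of "Poly_Mapping.single x (Poly_Mapping.lookup F x)" "?s A"]]
      by (metis (no_types, lifting) Un_least insert_subset sum.insert)
  qed (simp add: zero)
  moreover have "?s (Poly_Mapping.keys F) = F"
  proof (rule poly_mapping_eqI)
    fix k
    have "Poly_Mapping.lookup (?s (Poly_Mapping.keys F)) k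
        = (\<Sum>a\<in>Poly_Mapping.keys F. if a = k then Poly_Mapping.lookup F k else 0)"
      unfolding lookup_sum by (rule sum.cong) (auto simp: lookup_single when_def)
    then show "Poly_Mapping.lookup (?s (Poly_Mapping.keys F)) k = Poly_Mapping.lookup F k"
      by (auto simp: in_keys_iff)
  qed
  ultimately show ?thesis
    using assms(1) finite_keys by metis
qed

lemma laurent_eval_superset:
  assumes "finite A" "Poly_Mapping.keys f \<subseteq> A"
  shows "laurent_eval f t = (\<Sum>a\<in>A. Poly_Mapping.lookup f a * t a)"
  unfolding laurent_eval_def
  by (rule sum.mono_neutral_left) (use assms in \<open>auto simp: in_keys_iff\<close>)

lemma laurent_eval_zero [simp]: "laurent_eval 0 t = 0"
  by (simp add: laurent_eval_def)

lemma laurent_eval_single [simp]: "laurent_eval (Poly_Mapping.single a c) t = c * t a"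
  by (simp add: laurent_eval_def)

lemma laurent_eval_add: "laurent_eval (f + g) t = laurent_eval f t + laurent_eval g t"
proof -
  let ?A = "Poly_Mapping.keys f \<union> Poly_Mapping.keys g"
  show ?thesis
    by (simp add: laurent_eval_superset[of ?A] keys_add lookup_add sum.distrib distrib_right)
qed

lemma laurent_eval_sum: "laurent_eval (\<Sum>i\<in>I. f i) t = (\<Sum>i\<in>I. laurent_eval (f i) t)"
  by (induction I rule: infinite_finite_induct) (auto simp: laurent_eval_add)

lemma laurent_eval_cong:
  "(\<And>a. a \<in> Poly_Mapping.keys f \<Longrightarrow> s a = t a) \<Longrightarrow> laurent_eval f s = laurent_eval f t"
  by (simp add: laurent_eval_def)

text \<open>Both sides are bilinear, so two nested inductions reduce the claim to a pair of
  monomials. Multiplicativity is asked only on \<open>S\<close> because a point of the toric variety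
  is multiplicative only on exponents.\<close>

lemma laurent_eval_mult:
  fixes f g :: "'a::comm_monoid_add \<Rightarrow>\<^sub>0 complex"
  assumes "Poly_Mapping.keys f \<subseteq> S" "Poly_Mapping.keys g \<subseteq> S"
    and t: "\<And>a b. a \<in> S \<Longrightarrow> b \<in> S \<Longrightarrow> t (a + b) = t a * t b"
  shows "laurent_eval (f * g) t = laurent_eval f t * laurent_eval g t"
  using assms(1)
proof (induction f rule: keys_subset_induct)
  case (single a c)
  from assms(2) show ?case
    by (induction g rule: keys_subset_induct)
       (simp_all add: mult_single t single algebra_simps laurent_eval_add)
qed (simp_all add: laurent_eval_add algebra_simps)

section \<open>Relabelling of exponents\<close>

lemma monomial_map_superset:
  assumes "finite A" "Poly_Mapping.keys f \<subseteq> A"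
  shows "monomial_map h f = (\<Sum>a\<in>A. Poly_Mapping.single (h a) (Poly_Mapping.lookup f a))"
  unfolding monomial_map_def
  by (rule sum.mono_neutral_left) (use assms in \<open>auto simp: in_keys_iff\<close>)

lemma monomial_map_zero [simp]: "monomial_map h 0 = 0"
  by (simp add: monomial_map_def)

lemma monomial_map_single [simp]:
  "monomial_map h (Poly_Mapping.single a c) = Poly_Mapping.single (h a) c"
  by (simp add: monomial_map_def)

lemma monomial_map_add: "monomial_map h (f + g) = monomial_map h f + monomial_map h g"
proof -
  let ?A = "Poly_Mapping.keys f \<union> Poly_Mapping.keys g"
  show ?thesis
    by (simp add: monomial_map_superset[of ?A] keys_add lookup_add sum.distrib single_add)
qed

lemma monomial_map_mult:
  fixes f g :: "'a::comm_monoid_add \<Rightarrow>\<^sub>0 complex" and h :: "'a \<Rightarrow> 'b::comm_monoid_add"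
  assumes h: "\<And>a b. h (a + b) = h a + h b"
  shows "monomial_map h (f * g) = monomial_map h f * monomial_map h g"
  using subset_UNIV[of "Poly_Mapping.keys f"]
proof (induction f rule: keys_subset_induct)
  case (single a c)
  from subset_UNIV[of "Poly_Mapping.keys g"] show ?case
    by (induction g rule: keys_subset_induct)
       (simp_all add: mult_single h algebra_simps monomial_map_add)
qed (simp_all add: monomial_map_add algebra_simps)

lemma monomial_map_comp: "monomial_map g (monomial_map h f) = monomial_map (\<lambda>a. g (h a)) f"
  using subset_UNIV[of "Poly_Mapping.keys f"]
  by (induction f rule: keys_subset_induct) (simp_all add: monomial_map_add)

lemma laurent_eval_monomial_map: "laurent_eval (monomial_map h f) t = laurent_eval f (\<lambda>a. t (h a))"
  using subset_UNIV[of "Poly_Mapping.keys f"]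
  by (induction f rule: keys_subset_induct) (simp_all add: monomial_map_add laurent_eval_add)

lemma keys_monomial_map: "Poly_Mapping.keys (monomial_map h f) \<subseteq> h ` Poly_Mapping.keys f"
proof -
  have "Poly_Mapping.keys (monomial_map h f) \<subseteq> h ` S" if "Poly_Mapping.keys f \<subseteq> S" for S
    using that by (induction f rule: keys_subset_induct)
      (auto simp: monomial_map_add dest!: Set.subsetD[OF keys_add] split: if_splits)
  then show ?thesis by blast
qed

text \<open>This left inverse makes an injective relabelling cancellable in identities between
  polynomials.\<close>

lemma map_key_monomial_map:
  assumes "inj h"
  shows "Poly_Mapping.map_key h (monomial_map h f) = f"
  using subset_UNIV[of "Poly_Mapping.keys f"]
  by (induction f rule: keys_subset_induct)
     (simp_all add: monomial_map_add map_key_plus assms map_key_single)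

lemma monomial_map_map_key:
  assumes "inj h" "Poly_Mapping.keys f \<subseteq> range h"
  shows "monomial_map h (Poly_Mapping.map_key h f) = f"
  using assms(2)
  by (induction f rule: keys_subset_induct)
     (auto simp: monomial_map_add map_key_plus assms map_key_single)

lemma keys_monomial_map_inj:
  assumes "inj h"
  shows "Poly_Mapping.keys (monomial_map h f) = h ` Poly_Mapping.keys f"
proof
  show "h ` Poly_Mapping.keys f \<subseteq> Poly_Mapping.keys (monomial_map h f)"
    using keys_map_key[OF assms, of "monomial_map h f"] map_key_monomial_map[OF assms, of f]
    by auto
qed (rule keys_monomial_map)

lemma laurent_eval_mapp:
  "laurent_eval (Poly_Mapping.mapp (\<lambda>a c. w a * c) f) t = laurent_eval f (\<lambda>a. w a * t a)"
proof -
  have "laurent_eval (Poly_Mapping.mapp (\<lambda>a c. w a * c) f) t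
      = (\<Sum>a\<in>Poly_Mapping.keys f. Poly_Mapping.lookup (Poly_Mapping.mapp (\<lambda>a c. w a * c) f) a * t a)"
    by (rule laurent_eval_superset) (auto simp: keys_mapp_subset)
  then show ?thesis
    by (simp add: laurent_eval_def lookup_mapp algebra_simps)
qed

text \<open>For the exponents over \<open>L\<close> this projection is the Reynolds operator of the
  dual group, as \<open>laurent_eval_average\<close> shows.\<close>

definition restr :: "'a set \<Rightarrow> ('a \<Rightarrow>\<^sub>0 complex) \<Rightarrow> ('a \<Rightarrow>\<^sub>0 complex)" where
  "restr S f = Poly_Mapping.mapp (\<lambda>a c. if a \<in> S then c else 0) f"

lemma lookup_restr: "Poly_Mapping.lookup (restr S f) a = (if a \<in> S then Poly_Mapping.lookup f a else 0)"
  by (auto simp: restr_def lookup_mapp when_def in_keys_iff)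

lemma keys_restr: "Poly_Mapping.keys (restr S f) = Poly_Mapping.keys f \<inter> S"
  by (auto simp: in_keys_iff lookup_restr split: if_splits)

lemma restr_zero [simp]: "restr S 0 = 0"
  by (rule poly_mapping_eqI) (simp add: lookup_restr)

lemma restr_single: "restr S (Poly_Mapping.single a c) = (if a \<in> S then Poly_Mapping.single a c else 0)"
  by (rule poly_mapping_eqI) (auto simp: lookup_restr lookup_single when_def)

lemma restr_add: "restr S (f + g) = restr S f + restr S g"
  by (rule poly_mapping_eqI) (simp add: lookup_restr lookup_add)

text \<open>Multiplication with a monomial translates exponents, so it intertwines the projections
  onto \<open>K\<close> and \<open>K'\<close> as soon as the translation matches these sets. It
  serves twice: with both sets equal to \<open>L\<close> and \<open>f\<close> supported in
  \<open>L\<close>, and with one monomial that moves a class modulo \<open>L\<close> into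
  \<open>L\<close>.\<close>

lemma restr_mult:
  fixes f g :: "'a::comm_monoid_add \<Rightarrow>\<^sub>0 complex"
  assumes "Poly_Mapping.keys f \<subseteq> S" "\<And>a b. a \<in> S \<Longrightarrow> a + b \<in> K' \<longleftrightarrow> b \<in> K"
  shows "restr K' (f * g) = f * restr K g"
  using assms(1)
proof (induction f rule: keys_subset_induct)
  case (single a c)
  from subset_UNIV[of "Poly_Mapping.keys g"] show ?case
    by (induction g rule: keys_subset_induct)
       (simp_all add: mult_single restr_single restr_add assms(2)[OF single] distrib_left)
qed (simp_all add: restr_add distrib_right)

lemma monomial_map_restr: "monomial_map h (restr (h -` K) f) = restr K (monomial_map h f)"
  using subset_UNIV[of "Poly_Mapping.keys f"]
  by (induction f rule: keys_subset_induct)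
     (simp_all add: monomial_map_add restr_add restr_single)

text \<open>For \<open>g = residue\<close> this is the decomposition of a section into isotypic
  parts under the dual group.\<close>

lemma sum_restr_fibres: "f = (\<Sum>c\<in>g ` Poly_Mapping.keys f. restr (g -` {c}) f)"
proof (rule poly_mapping_eqI)
  fix k
  have "Poly_Mapping.lookup (\<Sum>c\<in>g ` Poly_Mapping.keys f. restr (g -` {c}) f) k
      = (\<Sum>c\<in>g ` Poly_Mapping.keys f. if c = g k then Poly_Mapping.lookup f k else 0)"
    unfolding lookup_sum by (rule sum.cong) (auto simp: lookup_restr)
  then show "Poly_Mapping.lookup f k
      = Poly_Mapping.lookup (\<Sum>c\<in>g ` Poly_Mapping.keys f. restr (g -` {c}) f) k"
    by (auto simp: in_keys_iff)
qed

section \<open>Extension of characters\<close>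

text \<open>Divisibility of the multiplicative group, read off from the number of
  \<open>k\<close>-th roots of a nonzero number.\<close>

lemma complex_root_exists:
  assumes "0 < (k::nat)"
  shows "\<exists>w::complex. w ^ k = z"
proof (cases "z = 0")
  case False
  then have "card {w. w ^ k = z} \<noteq> 0"
    using card_nth_roots[of z k] assms by simp
  then show ?thesis
    by (metis (mono_tags, lifting) Collect_empty_eq card.empty)
qed (use assms in auto)

lemma nontrivial_root_of_unity_exists:
  assumes "2 \<le> (k::nat)"
  shows "\<exists>w::complex. w ^ k = 1 \<and> w \<noteq> 1"
proof (rule ccontr)
  assume "\<not> ?thesis"
  then have "{w::complex. w ^ k = 1} \<subseteq> {1}" by auto
  then have "card {w::complex. w ^ k = 1} \<le> 1"
    using card_mono[of "{1::complex}"] by fastforce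
  then show False
    using card_roots_unity_eq[of k] assms by simp
qed

text \<open>A multiple that makes sense for vectors and also for exponents in
  \<open>nat \<times> 'v\<close>, on which no rational scaling acts.\<close>

primrec nsum :: "nat \<Rightarrow> 'a::monoid_add \<Rightarrow> 'a" where
  "nsum 0 a = 0"
| "nsum (Suc k) a = a + nsum k a"

text \<open>
  A partially defined character is given by its graph; being single-valued then amounts to the
  last condition.
\<close>
definition character_graph :: "('a::ab_group_add \<times> complex) set \<Rightarrow> bool" where
  "character_graph R \<longleftrightarrow> (0, 1) \<in> R \<and>
     (\<forall>x u y v. (x, u) \<in> R \<longrightarrow> (y, v) \<in> R \<longrightarrow> (x + y, u * v) \<in> R) \<and>
     (\<forall>x u. (x, u) \<in> R \<longrightarrow> (- x, inverse u) \<in> R) \<and>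
     (\<forall>x. (x, 0) \<notin> R) \<and> (\<forall>u. (0, u) \<in> R \<longrightarrow> u = 1)"

lemma character_graphD:
  assumes "character_graph R"
  shows "(0, 1) \<in> R" "(x, u) \<in> R \<Longrightarrow> (y, v) \<in> R \<Longrightarrow> (x + y, u * v) \<in> R"
    "(x, u) \<in> R \<Longrightarrow> (- x, inverse u) \<in> R" "(x, u) \<in> R \<Longrightarrow> u \<noteq> 0" "(0, u) \<in> R \<Longrightarrow> u = 1"
  using assms unfolding character_graph_def by blast+

lemma character_graph_functional:
  assumes R: "character_graph R" and "(x, u) \<in> R" "(x, v) \<in> R"
  shows "u = v"
proof -
  have "(x + - x, u * inverse v) \<in> R"
    using character_graphD(2,3)[OF R] assms(2,3) by blast
  then have "u * inverse v = 1"
    using character_graphD(5)[OF R] by simp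
  then show ?thesis
    using character_graphD(4)[OF R assms(3)] by (simp add: field_simps)
qed

lemma nsum_add: "nsum (i + j) a = nsum i a + nsum j (a::'a::comm_monoid_add)"
  by (induction i) (simp_all add: algebra_simps)

lemma nsum_plus: "nsum k (a + b) = nsum k a + nsum k (b::'a::comm_monoid_add)"
  by (induction k) (simp_all add: algebra_simps)

text \<open>The value \<open>w\<close> at \<open>b\<close> is constrained only by the multiples of
  \<open>b\<close> already in the domain. These are governed by the least positive one,
  \<open>nsum k b\<close>: a \<open>k\<close>-th root of its value is compatible with all the
  others, by repeated subtraction of \<open>k\<close>.\<close>

lemma character_graph_extend:
  assumes R: "character_graph R"
  obtains R' u where "character_graph R'" "R \<subseteq> R'" "(b, u) \<in> R'"
proof -
  note D = character_graphD[OF R]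
  define K where "K k \<longleftrightarrow> 1 \<le> k \<and> (\<exists>v. (nsum k b, v) \<in> R)" for k
  obtain w where w0: "w \<noteq> 0" and w: "\<And>i u. (nsum i b, u) \<in> R \<Longrightarrow> w ^ i = u"
  proof (cases "\<exists>k. K k")
    case True
    define k where "k = (LEAST k. K k)"
    have k: "K k" "\<And>i. i < k \<Longrightarrow> \<not> K i"
      using True LeastI_ex not_less_Least unfolding k_def by blast+
    then obtain v where v: "(nsum k b, v) \<in> R" and k1: "1 \<le> k"
      unfolding K_def by blast
    obtain w where wk: "w ^ k = v"
      using complex_root_exists[of k v] k1 by auto
    have "w ^ i = u" if "(nsum i b, u) \<in> R" for i u
      using that
    proof (induction i arbitrary: u rule: less_induct)
      case (less i)
      show ?case
      proof (cases "i < k")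
        case True
        then have "i = 0"
          using k(2)[OF True] less.prems unfolding K_def by force
        then show ?thesis
          using D(5) less.prems by simp
      next
        case False
        then have i: "i = (i - k) + k" by simp
        then have "nsum i b = nsum (i - k) b + nsum k b"
          by (metis nsum_add)
        then have "(nsum (i - k) b, u * inverse v) \<in> R"
          using D(2)[OF less.prems D(3)[OF v]] by simp
        then have "w ^ (i - k) = u * inverse v"
          using less.IH k1 False by simp
        then have "w ^ (i - k) * w ^ k = u"
          using D(4)[OF v] wk by simp
        then show ?thesis
          using i by (metis power_add)
      qed
    qed
    moreover have "w \<noteq> 0"
      using wk D(4)[OF v] k1 by (auto simp: power_0_left)
    ultimately show ?thesis
      using that by blast
  next
    case False
    \<comment> \<open>No positive multiple of \<open>b\<close> lies in the domain, so the value at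
      \<open>b\<close> is free; 1 is taken.\<close>
    have "1 ^ i = u" if "(nsum i b, u) \<in> R" for i and u :: complex
    proof (cases i)
      case 0
      then show ?thesis using that D(5) by simp
    next
      case (Suc k)
      then have "K i" using that unfolding K_def by auto
      then show ?thesis using False by blast
    qed
    then show ?thesis
      using that[of 1] by simp
  qed
  \<comment> \<open>The graph over the group generated by the domain and \<open>b\<close>; an
    integer multiple of \<open>b\<close> is written as a difference of two natural ones.\<close>
  define R' where
    "R' = {(x + nsum i b - nsum j b, u * w ^ i * inverse (w ^ j)) | x u i j. (x, u) \<in> R}"
  have R'I: "(y, v) \<in> R'" if "(x, u) \<in> R" "y = x + nsum i b - nsum j b" "v = u * w ^ i * inverse (w ^ j)"
    for x u i j y v
    using that unfolding R'_def by blast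
  have "character_graph R'"
    unfolding character_graph_def
  proof (intro conjI allI impI)
    show "(0, 1) \<in> R'"
      by (rule R'I[OF D(1), of _ 0 0]) simp_all
  next
    fix x u y v
    assume "(x, u) \<in> R'" "(y, v) \<in> R'"
    then obtain x' u' i j y' v' k l where
      x: "(x', u') \<in> R" "x = x' + nsum i b - nsum j b" "u = u' * w ^ i * inverse (w ^ j)"
      and y: "(y', v') \<in> R" "y = y' + nsum k b - nsum l b" "v = v' * w ^ k * inverse (w ^ l)"
      unfolding R'_def by blast
    have "x + y = x' + y' + nsum (i + k) b - nsum (j + l) b"
      unfolding x(2) y(2) nsum_add by (simp add: algebra_simps)
    moreover have "u * v = u' * v' * w ^ (i + k) * inverse (w ^ (j + l))"
      unfolding x(3) y(3) power_add by (simp add: algebra_simps)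
    ultimately show "(x + y, u * v) \<in> R'"
      by (rule R'I[OF D(2)[OF x(1) y(1)]])
  next
    fix x u
    assume "(x, u) \<in> R'"
    then obtain x' u' i j where
      "(x', u') \<in> R" "x = x' + nsum i b - nsum j b" "u = u' * w ^ i * inverse (w ^ j)"
      unfolding R'_def by blast
    then show "(- x, inverse u) \<in> R'"
      by (intro R'I[OF D(3), of x' u' _ j i]) (simp_all add: algebra_simps)
  next
    fix x
    show "(x, 0) \<notin> R'"
      using D(4) w0 unfolding R'_def by fastforce
  next
    fix u
    assume "(0, u) \<in> R'"
    then obtain x u' i j where x: "(x, u') \<in> R" "0 = x + nsum i b - nsum j b"
      and u: "u = u' * w ^ i * inverse (w ^ j)"
      unfolding R'_def by blast
    show "u = 1"
    \<comment> \<open>According to which of \<open>i\<close> and \<open>j\<close> is larger,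
      \<open>x\<close> or \<open>- x\<close> is a natural multiple of \<open>b\<close>, and on those
      \<open>w\<close> agrees with \<open>R\<close>.\<close>
    proof (cases "i \<le> j")
      case True
      then have j: "j = (j - i) + i" by simp
      then have "nsum j b = nsum (j - i) b + nsum i b" by (metis nsum_add)
      then have "x = nsum (j - i) b"
        using x(2) by (simp add: algebra_simps)
      then have "w ^ (j - i) = u'" using w x(1) by blast
      then have "w ^ j = u' * w ^ i" using j by (metis power_add)
      then show ?thesis using u w0 by (metis power_not_zero right_inverse)
    next
      case False
      then have i: "i = (i - j) + j" by simp
      then have "nsum i b = nsum (i - j) b + nsum j b" by (metis nsum_add)
      then have "- x = nsum (i - j) b"
        using x(2) by (simp add: algebra_simps add_eq_0_iff)
      then have "w ^ (i - j) = inverse u'" using w D(3)[OF x(1)] by metis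
      then have "w ^ i = inverse u' * w ^ j" using i by (metis power_add)
      then show ?thesis using u w0 D(4)[OF x(1)] by (simp add: field_simps)
    qed
  qed
  moreover have "R \<subseteq> R'"
  proof
    fix p
    assume "p \<in> R"
    then show "p \<in> R'"
      using R'I[of "fst p" "snd p" "fst p" 0 0 "snd p"] by simp
  qed
  moreover have "(b, w) \<in> R'"
    by (rule R'I[OF D(1), of _ 1 0]) simp_all
  ultimately show ?thesis
    using that by blast
qed

text \<open>Divisible abelian groups are injective: Zorn's lemma applied to the one-step extension.
  The character is extended to the whole type, so later uses need no carrier for it.\<close>

lemma character_graph_total_extension:
  assumes R: "character_graph R"
  obtains \<chi> where "\<And>x y. \<chi> (x + y) = \<chi> x * \<chi> y" "\<And>x. \<chi> x \<noteq> 0" "\<And>x u. (x, u) \<in> R \<Longrightarrow> \<chi> x = u"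
proof -
  let ?A = "{R'. character_graph R' \<and> R \<subseteq> R'}"
  have "\<exists>M\<in>?A. \<forall>X\<in>?A. M \<subseteq> X \<longrightarrow> X = M"
  proof (rule subset_Zorn_nonempty)
    show "?A \<noteq> {}" using R by blast
    fix C assume C: "C \<noteq> {}" "subset.chain ?A C"
    have mem: "character_graph X" "R \<subseteq> X" if "X \<in> C" for X
      using that C(2) unfolding subset.chain_def by auto
    have "character_graph (\<Union>C)"
      unfolding character_graph_def
    proof (intro conjI allI impI)
      show "(0, 1) \<in> \<Union>C"
        using C(1) mem(1) character_graphD(1) by blast
    next
      fix x u y v
      assume "(x, u) \<in> \<Union>C" "(y, v) \<in> \<Union>C"
      then obtain X Y where XY: "X \<in> C" "(x, u) \<in> X" "Y \<in> C" "(y, v) \<in> Y" by blast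
      \<comment> \<open>Both pairs lie in the larger of two comparable members of the chain.\<close>
      moreover have "X \<subseteq> Y \<or> Y \<subseteq> X"
        using C(2) XY unfolding subset.chain_def by blast
      ultimately show "(x + y, u * v) \<in> \<Union>C"
        using character_graphD(2)[OF mem(1)] by blast
    next
      fix x u assume "(x, u) \<in> \<Union>C"
      then show "(- x, inverse u) \<in> \<Union>C"
        using character_graphD(3)[OF mem(1)] by blast
    qed (use character_graphD(4,5)[OF mem(1)] in blast)+
    then show "\<Union>C \<in> ?A"
      using C(1) mem(2) by blast
  qed
  then obtain M where MA: "M \<in> ?A" and "\<forall>X\<in>?A. M \<subseteq> X \<longrightarrow> X = M" ..
  then have M: "character_graph M" "R \<subseteq> M"
    and max: "\<And>X. character_graph X \<Longrightarrow> M \<subseteq> X \<Longrightarrow> X = M"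
    by auto
  \<comment> \<open>A one-step extension at \<open>x\<close> is absorbed by the maximal graph, which
    therefore already has a value there.\<close>
  have tot: "\<exists>u. (x, u) \<in> M" for x
    by (rule character_graph_extend[OF M(1), of x]) (use max in blast)
  define \<chi> where "\<chi> x = (SOME u. (x, u) \<in> M)" for x
  have \<chi>: "(x, \<chi> x) \<in> M" for x
    unfolding \<chi>_def using tot[of x] by (rule someI_ex)
  have eq: "\<chi> x = u" if "(x, u) \<in> M" for x u
    using character_graph_functional[OF M(1) \<chi> that] .
  show ?thesis
  proof
    show "\<chi> (x + y) = \<chi> x * \<chi> y" for x y
      using eq character_graphD(2)[OF M(1) \<chi> \<chi>] by blast
    show "\<chi> x \<noteq> 0" for x
      using character_graphD(4)[OF M(1) \<chi>] .
    show "\<chi> x = u" if "(x, u) \<in> R" for x u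
      using eq that M(2) by blast
  qed
qed

section \<open>Points of the toric variety\<close>

lemma S_partD:
  assumes "F \<in> S_part \<Delta> M d"
  shows "F \<in> S_ring \<Delta> M" "Poly_Mapping.keys F \<subseteq> exponents \<Delta> M" "a \<in> Poly_Mapping.keys F \<Longrightarrow> fst a = d"
  using assms by (auto simp: S_part_def S_ring_def)

lemma S_partI:
  "(\<And>a. a \<in> Poly_Mapping.keys F \<Longrightarrow> a \<in> exponents \<Delta> M \<and> fst a = d) \<Longrightarrow> F \<in> S_part \<Delta> M d"
  by (auto simp: S_part_def S_ring_def)

lemma S_part_zero: "0 \<in> S_part \<Delta> M d"
  by (rule S_partI) simp

lemma S_part_single:
  "a \<in> exponents \<Delta> M \<Longrightarrow> fst a = d \<Longrightarrow> Poly_Mapping.single a c \<in> S_part \<Delta> M d"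
  by (rule S_partI) (auto split: if_splits)

lemma S_part_add:
  assumes "F \<in> S_part \<Delta> M d" "G \<in> S_part \<Delta> M d"
  shows "F + G \<in> S_part \<Delta> M d"
  using S_partD[OF assms(1)] S_partD[OF assms(2)] keys_add[of F G] by (blast intro: S_partI)

lemma S_part_restr: "F \<in> S_part \<Delta> M d \<Longrightarrow> restr K F \<in> S_part \<Delta> M d"
  by (rule S_partI) (auto simp: keys_restr dest: S_partD)

text \<open>The last clause keeps the point off the irrelevant locus, tested on monomials. Values
  outside the exponents are arbitrary, so points are compared on exponents or through
  \<open>rep_point\<close>.\<close>

definition monomial_points :: "'v::rat_vector set \<Rightarrow> 'v set \<Rightarrow> (nat \<times> 'v \<Rightarrow> complex) set" where
  "monomial_points \<Delta> M = {\<mu>. \<mu> 0 = 1 \<and>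
     (\<forall>a\<in>exponents \<Delta> M. \<forall>b\<in>exponents \<Delta> M. \<mu> (a + b) = \<mu> a * \<mu> b) \<and>
     (\<exists>a\<in>exponents \<Delta> M. 1 \<le> fst a \<and> \<mu> a \<noteq> 0)}"

lemma monomial_pointsD:
  assumes "\<mu> \<in> monomial_points \<Delta> M"
  shows "\<mu> 0 = 1"
    "a \<in> exponents \<Delta> M \<Longrightarrow> b \<in> exponents \<Delta> M \<Longrightarrow> \<mu> (a + b) = \<mu> a * \<mu> b"
    "\<exists>a\<in>exponents \<Delta> M. 1 \<le> fst a \<and> \<mu> a \<noteq> 0"
  using assms by (auto simp: monomial_points_def)

text \<open>The default 0 follows the convention of \<open>cone_points\<close>, so that functionals
  are equal once they agree on the ring.\<close>

definition point_eval ::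
  "'v::rat_vector set \<Rightarrow> 'v set \<Rightarrow> (nat \<times> 'v \<Rightarrow> complex) \<Rightarrow> 'v graded_poly \<Rightarrow> complex" where
  "point_eval \<Delta> M \<mu> F = (if F \<in> S_ring \<Delta> M then laurent_eval F \<mu> else 0)"

definition rep_point :: "'v::rat_vector set \<Rightarrow> 'v set \<Rightarrow> (nat \<times> 'v \<Rightarrow> complex) \<Rightarrow> 'v point" where
  "rep_point \<Delta> M \<mu> = proj_rel \<Delta> M `` {point_eval \<Delta> M \<mu>}"

definition basic_open :: "'v::rat_vector set \<Rightarrow> 'v set \<Rightarrow> 'v graded_poly \<Rightarrow> 'v point set" where
  "basic_open \<Delta> M F = {p \<in> toric_variety \<Delta> M. \<forall>\<xi>\<in>p. \<xi> F \<noteq> 0}"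

lemma point_eval_cong:
  assumes "\<And>a. a \<in> exponents \<Delta> M \<Longrightarrow> \<mu> a = \<nu> a"
  shows "point_eval \<Delta> M \<mu> = point_eval \<Delta> M \<nu>"
proof
  show "point_eval \<Delta> M \<mu> F = point_eval \<Delta> M \<nu> F" for F
    using assms by (auto simp: point_eval_def S_ring_def intro!: laurent_eval_cong)
qed

lemma rep_point_cong:
  assumes "\<And>a. a \<in> exponents \<Delta> M \<Longrightarrow> \<mu> a = \<nu> a"
  shows "rep_point \<Delta> M \<mu> = rep_point \<Delta> M \<nu>"
  using point_eval_cong[of \<Delta> M \<mu> \<nu>] assms by (simp add: rep_point_def)

lemma laurent_eval_scale:
  assumes "F \<in> S_part \<Delta> M d"
  shows "laurent_eval F (\<lambda>a. z ^ fst a * \<mu> a) = z ^ d * laurent_eval F \<mu>"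
  unfolding laurent_eval_def sum_distrib_left
  by (rule sum.cong) (use S_partD(3)[OF assms] in auto)

lemma point_eval_S_part [simp]: "F \<in> S_part \<Delta> M d \<Longrightarrow> point_eval \<Delta> M \<mu> F = laurent_eval F \<mu>"
  by (simp add: point_eval_def S_partD)

text \<open>The properties of a reflexive pair on which the description of Proj rests: convexity
  makes the exponents a monoid, and 0 in \<open>\<Delta>\<close> supplies the exponent (1,
  0).\<close>

locale polarized_lattice =
  fixes \<Delta> M :: "'v::rat_vector set"
  assumes zero_M: "0 \<in> M"
    and add_M: "x \<in> M \<Longrightarrow> y \<in> M \<Longrightarrow> x + y \<in> M"
    and uminus_M: "x \<in> M \<Longrightarrow> - x \<in> M"
    and zero_\<Delta>: "0 \<in> \<Delta>"
    and convex_\<Delta>: "x \<in> \<Delta> \<Longrightarrow> y \<in> \<Delta> \<Longrightarrow> 0 \<le> u \<Longrightarrow> 0 \<le> v \<Longrightarrow> u + v = 1 \<Longrightarrow> u *\<^sub>Q x + v *\<^sub>Q y \<in> \<Delta>"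
begin

abbreviation "E \<equiv> exponents \<Delta> M"

lemma nsum_M: "x \<in> M \<Longrightarrow> nsum k x \<in> M"
  by (induction k) (auto simp: zero_M add_M)

lemma zero_exponents: "0 \<in> E"
  by (simp add: exponents_def zero_prod_def)

lemma one_exponents: "(1, 0) \<in> E"
  by (simp add: exponents_def zero_M zero_\<Delta>)

lemma snd_exponents: "a \<in> E \<Longrightarrow> snd a \<in> M"
  by (auto simp: exponents_def zero_M)

lemma add_exponents:
  assumes "a \<in> E" "b \<in> E"
  shows "a + b \<in> E"
proof (cases "a = 0 \<or> b = 0")
  case False
  obtain k x l y where ab: "a = (k, x)" "b = (l, y)" by fastforce
  have kx: "1 \<le> k" "x \<in> M" "inverse (of_nat k) *\<^sub>Q x \<in> \<Delta>"
    and ly: "1 \<le> l" "y \<in> M" "inverse (of_nat l) *\<^sub>Q y \<in> \<Delta>"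
    using assms False unfolding ab exponents_def zero_prod_def by auto
  \<comment> \<open>The vector (x + y) / (k + l) is the convex combination of x / k and y / l with
    these weights. Exponent 0 was split off because no division by its degree is possible.\<close>
  let ?u = "of_nat k / of_nat (k + l) :: rat" and ?v = "of_nat l / of_nat (k + l) :: rat"
  have "?u + ?v = 1"
    using kx(1) by (simp add: add_divide_distrib[symmetric])
  then have "?u *\<^sub>Q inverse (of_nat k) *\<^sub>Q x + ?v *\<^sub>Q inverse (of_nat l) *\<^sub>Q y \<in> \<Delta>"
    by (intro convex_\<Delta> kx ly) auto
  moreover have "?u * inverse (of_nat k) = inverse (of_nat (k + l))"
    "?v * inverse (of_nat l) = inverse (of_nat (k + l))"
    using kx(1) ly(1) by (simp_all add: field_simps)
  ultimately have "inverse (of_nat (k + l)) *\<^sub>Q (x + y) \<in> \<Delta>"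
    by (simp add: scaleQ_scaleQ scaleQ_add_right)
  then show ?thesis
    using kx ly by (simp add: ab exponents_def add_M)
qed (use assms in auto)

lemma nsum_exponents: "a \<in> E \<Longrightarrow> nsum k a \<in> E"
  by (induction k) (auto simp: zero_exponents add_exponents)

lemma monomial_points_nsum:
  assumes "\<mu> \<in> monomial_points \<Delta> M" "a \<in> E"
  shows "\<mu> (nsum k a) = \<mu> a ^ k"
  by (induction k)
     (simp_all add: monomial_pointsD(1)[OF assms(1)]
        monomial_pointsD(2)[OF assms(1) assms(2) nsum_exponents[OF assms(2)]])

lemma S_ring_induct [consumes 1, case_names zero single add]:
  assumes "F \<in> S_ring \<Delta> M" "P 0" "\<And>a c. a \<in> E \<Longrightarrow> P (Poly_Mapping.single a c)"
    "\<And>F G. F \<in> S_ring \<Delta> M \<Longrightarrow> G \<in> S_ring \<Delta> M \<Longrightarrow> P F \<Longrightarrow> P G \<Longrightarrow> P (F + G)"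
  shows "P F"
  using assms keys_subset_induct[of F E P] by (simp add: S_ring_def)

lemma S_ring_add: "F \<in> S_ring \<Delta> M \<Longrightarrow> G \<in> S_ring \<Delta> M \<Longrightarrow> F + G \<in> S_ring \<Delta> M"
  using keys_add[of F G] by (auto simp: S_ring_def)

lemma S_ring_mult: "F \<in> S_ring \<Delta> M \<Longrightarrow> G \<in> S_ring \<Delta> M \<Longrightarrow> F * G \<in> S_ring \<Delta> M"
  using keys_mult[of F G] add_exponents unfolding S_ring_def by blast

lemma S_part_mult:
  assumes "F \<in> S_part \<Delta> M d" "G \<in> S_part \<Delta> M e"
  shows "F * G \<in> S_part \<Delta> M (d + e)"
proof (rule S_partI)
  fix a assume "a \<in> Poly_Mapping.keys (F * G)"
  then obtain b c where "a = b + c" "b \<in> Poly_Mapping.keys F" "c \<in> Poly_Mapping.keys G"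
    using keys_mult[of F G] by blast
  then show "a \<in> E \<and> fst a = d + e"
    using S_partD(2,3)[OF assms(1)] S_partD(2,3)[OF assms(2)] add_exponents[of b c] by auto
qed

lemma monomial_points_mult:
  assumes "\<mu> \<in> monomial_points \<Delta> M" "F \<in> S_ring \<Delta> M" "G \<in> S_ring \<Delta> M"
  shows "laurent_eval (F * G) \<mu> = laurent_eval F \<mu> * laurent_eval G \<mu>"
  using assms monomial_pointsD(2)[OF assms(1)] unfolding S_ring_def
  by (intro laurent_eval_mult[of _ E]) auto

lemma monomial_points_S_part_mult:
  assumes "\<mu> \<in> monomial_points \<Delta> M" "F \<in> S_part \<Delta> M d" "G \<in> S_part \<Delta> M e"
  shows "laurent_eval (F * G) \<mu> = laurent_eval F \<mu> * laurent_eval G \<mu>"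
  using monomial_points_mult[OF assms(1)] S_partD(1) assms(2,3) by blast

lemma point_eval_cone_points:
  assumes "\<mu> \<in> monomial_points \<Delta> M"
  shows "point_eval \<Delta> M \<mu> \<in> cone_points \<Delta> M"
proof -
  obtain a where a: "a \<in> E" "1 \<le> fst a" "\<mu> a \<noteq> 0"
    using monomial_pointsD(3)[OF assms] by blast
  then have "Poly_Mapping.single a 1 \<in> S_part \<Delta> M (fst a)"
    by (simp add: S_part_single)
  then have "\<exists>d\<ge>1. \<exists>F\<in>S_part \<Delta> M d. point_eval \<Delta> M \<mu> F \<noteq> 0"
    using a by (intro exI[of _ "fst a"]) (auto intro!: bexI[of _ "Poly_Mapping.single a 1"])
  moreover have "point_eval \<Delta> M \<mu> (Poly_Mapping.single 0 c) = c" for c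
    using monomial_pointsD(1)[OF assms] zero_exponents
    by (auto simp: point_eval_def S_ring_def)
  ultimately show ?thesis
    by (auto simp: cone_points_def point_eval_def S_ring_add S_ring_mult laurent_eval_add
        monomial_points_mult[OF assms])
qed

text \<open>An algebra homomorphism is determined by its values on monomials, and these values form
  a multiplicative function on exponents.\<close>

lemma cone_points_point_eval:
  assumes "\<xi> \<in> cone_points \<Delta> M"
  obtains \<mu> where "\<mu> \<in> monomial_points \<Delta> M" "\<xi> = point_eval \<Delta> M \<mu>"
proof -
  from assms have \<xi>_add: "\<And>F G. F \<in> S_ring \<Delta> M \<Longrightarrow> G \<in> S_ring \<Delta> M \<Longrightarrow> \<xi> (F + G) = \<xi> F + \<xi> G"
    and mult: "\<And>F G. F \<in> S_ring \<Delta> M \<Longrightarrow> G \<in> S_ring \<Delta> M \<Longrightarrow> \<xi> (F * G) = \<xi> F * \<xi> G"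
    and const: "\<And>c. \<xi> (Poly_Mapping.single 0 c) = c"
    and out: "\<And>F. F \<notin> S_ring \<Delta> M \<Longrightarrow> \<xi> F = 0"
    and irr: "\<exists>d\<ge>1. \<exists>F\<in>S_part \<Delta> M d. \<xi> F \<noteq> 0"
    by (auto simp: cone_points_def)
  have sing: "Poly_Mapping.single a c \<in> S_ring \<Delta> M" if "a \<in> E" for a and c :: complex
    using that by (auto simp: S_ring_def)
  define \<mu> where "\<mu> a = \<xi> (Poly_Mapping.single a 1)" for a
  have eval: "\<xi> F = laurent_eval F \<mu>" if "F \<in> S_ring \<Delta> M" for F
    using that
  proof (induction F rule: S_ring_induct)
    case zero
    then show ?case using const[of 0] by simp
  next
    case (single a c)
    \<comment> \<open>Scalars act as multiplication with constants, so linearity over the complex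
      numbers follows from multiplicativity.\<close>
    have "\<xi> (Poly_Mapping.single 0 c * Poly_Mapping.single a 1) = c * \<mu> a"
      using mult[OF sing[OF zero_exponents] sing[OF single]] const \<mu>_def by simp
    then show ?case by (simp add: mult_single)
  next
    case (add F G)
    then show ?case using \<xi>_add by (simp add: laurent_eval_add)
  qed
  have "\<mu> \<in> monomial_points \<Delta> M"
    unfolding monomial_points_def
  proof (intro CollectI conjI ballI)
    show "\<mu> 0 = 1" unfolding \<mu>_def by (rule const)
    show "\<mu> (a + b) = \<mu> a * \<mu> b" if "a \<in> E" "b \<in> E" for a b
      using mult[OF sing[OF that(1), of 1] sing[OF that(2), of 1]] by (simp add: \<mu>_def mult_single)
    obtain d F where F: "1 \<le> d" "F \<in> S_part \<Delta> M d" "\<xi> F \<noteq> 0"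
      using irr by blast
    \<comment> \<open>A form of positive degree with nonzero value contains a monomial with nonzero
      value.\<close>
    then have "(\<Sum>a\<in>Poly_Mapping.keys F. Poly_Mapping.lookup F a * \<mu> a) \<noteq> 0"
      using eval[OF S_partD(1)[OF F(2)]] by (simp add: laurent_eval_def)
    then obtain a where "a \<in> Poly_Mapping.keys F" "Poly_Mapping.lookup F a * \<mu> a \<noteq> 0"
      by (rule sum.not_neutral_contains_not_neutral)
    then have "a \<in> Poly_Mapping.keys F" "\<mu> a \<noteq> 0" by auto
    then show "\<exists>a\<in>E. 1 \<le> fst a \<and> \<mu> a \<noteq> 0"
      using S_partD[OF F(2)] F(1) by blast
  qed
  moreover have "\<xi> = point_eval \<Delta> M \<mu>"
    by (rule ext) (simp add: point_eval_def eval out)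
  ultimately show ?thesis using that by blast
qed

lemma monomial_points_scale:
  assumes "\<mu> \<in> monomial_points \<Delta> M" "z \<noteq> 0"
  shows "(\<lambda>a. z ^ fst a * \<mu> a) \<in> monomial_points \<Delta> M"
  using assms by (auto simp: monomial_points_def power_add)

text \<open>The relation defining Proj compares values on homogeneous elements; tested on monomials
  it already determines the functional, so a class is exactly one orbit of scaling by
  degree.\<close>

lemma rep_point_eq:
  assumes "\<mu> \<in> monomial_points \<Delta> M"
  shows "rep_point \<Delta> M \<mu> = {point_eval \<Delta> M (\<lambda>a. z ^ fst a * \<mu> a) | z. z \<noteq> 0}" (is "_ = ?R")
proof
  show "rep_point \<Delta> M \<mu> \<subseteq> ?R"
  proof
    fix \<eta> assume "\<eta> \<in> rep_point \<Delta> M \<mu>"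
    then obtain z where \<eta>: "\<eta> \<in> cone_points \<Delta> M" "z \<noteq> 0"
      "\<And>d F. F \<in> S_part \<Delta> M d \<Longrightarrow> \<eta> F = z ^ d * point_eval \<Delta> M \<mu> F"
      by (auto simp: rep_point_def proj_rel_def)
    obtain \<nu> where \<nu>: "\<nu> \<in> monomial_points \<Delta> M" "\<eta> = point_eval \<Delta> M \<nu>"
      using cone_points_point_eval[OF \<eta>(1)] .
    have "\<nu> a = z ^ fst a * \<mu> a" if "a \<in> E" for a
      using \<eta>(3)[OF S_part_single[OF that refl, of 1]] S_part_single[OF that refl, of 1] \<nu>(2)
      by simp
    then have "\<eta> = point_eval \<Delta> M (\<lambda>a. z ^ fst a * \<mu> a)"
      unfolding \<nu>(2) by (rule point_eval_cong)
    then show "\<eta> \<in> ?R"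
      using \<eta>(2) by blast
  qed
  show "?R \<subseteq> rep_point \<Delta> M \<mu>"
    using point_eval_cone_points monomial_points_scale assms
    by (fastforce simp: rep_point_def proj_rel_def laurent_eval_scale)
qed

lemma rep_point_self: "\<mu> \<in> monomial_points \<Delta> M \<Longrightarrow> point_eval \<Delta> M \<mu> \<in> rep_point \<Delta> M \<mu>"
  unfolding rep_point_eq by (rule CollectI, rule exI[of _ 1]) simp

lemma rep_point_eval:
  assumes "\<mu> \<in> monomial_points \<Delta> M" "\<xi> \<in> rep_point \<Delta> M \<mu>"
  obtains z where "z \<noteq> 0" "\<And>d F. F \<in> S_part \<Delta> M d \<Longrightarrow> \<xi> F = z ^ d * laurent_eval F \<mu>"
proof -
  obtain z where z: "z \<noteq> 0" "\<xi> = point_eval \<Delta> M (\<lambda>a. z ^ fst a * \<mu> a)"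
    using assms(2) unfolding rep_point_eq[OF assms(1)] by blast
  show ?thesis
    by (rule that[OF z(1)]) (simp add: z(2) laurent_eval_scale)
qed

lemma rep_point_eval_nz:
  assumes "\<mu> \<in> monomial_points \<Delta> M" "\<xi> \<in> rep_point \<Delta> M \<mu>" "F \<in> S_part \<Delta> M d"
  shows "\<xi> F = 0 \<longleftrightarrow> laurent_eval F \<mu> = 0"
  using rep_point_eval[OF assms(1,2)] assms(3) by (metis mult_eq_0_iff power_not_zero)

lemma rep_point_eq_iff:
  assumes "\<mu> \<in> monomial_points \<Delta> M" "\<nu> \<in> monomial_points \<Delta> M"
  shows "rep_point \<Delta> M \<mu> = rep_point \<Delta> M \<nu> \<longleftrightarrow> (\<exists>z. z \<noteq> 0 \<and> (\<forall>a\<in>E. \<nu> a = z ^ fst a * \<mu> a))"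
proof
  assume "rep_point \<Delta> M \<mu> = rep_point \<Delta> M \<nu>"
  then have "point_eval \<Delta> M \<nu> \<in> rep_point \<Delta> M \<mu>"
    using rep_point_self assms(2) by blast
  then obtain z where z: "z \<noteq> 0" "point_eval \<Delta> M \<nu> = point_eval \<Delta> M (\<lambda>a. z ^ fst a * \<mu> a)"
    unfolding rep_point_eq[OF assms(1)] by blast
  have "\<nu> a = z ^ fst a * \<mu> a" if "a \<in> E" for a
    using fun_cong[OF z(2), of "Poly_Mapping.single a 1"] S_part_single[OF that refl, of 1]
    by simp
  with z(1) show "\<exists>z. z \<noteq> 0 \<and> (\<forall>a\<in>E. \<nu> a = z ^ fst a * \<mu> a)" by blast
next
  assume "\<exists>z. z \<noteq> 0 \<and> (\<forall>a\<in>E. \<nu> a = z ^ fst a * \<mu> a)"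
  then obtain z where z: "z \<noteq> 0" "\<And>a. a \<in> E \<Longrightarrow> \<nu> a = z ^ fst a * \<mu> a" by blast
  have eq: "rep_point \<Delta> M \<nu> = rep_point \<Delta> M (\<lambda>a. z ^ fst a * \<mu> a)"
    by (rule rep_point_cong) (rule z(2))
  \<comment> \<open>The two orbits are reparametrised into each other, by y / z in one direction and
    y z in the other.\<close>
  have "point_eval \<Delta> M (\<lambda>a. y ^ fst a * \<mu> a)
      = point_eval \<Delta> M (\<lambda>a. (y / z) ^ fst a * (z ^ fst a * \<mu> a))" for y
    using z(1) by (simp add: power_divide)
  moreover have "y / z \<noteq> 0" if "y \<noteq> 0" for y
    using z(1) that by simp
  moreover have "point_eval \<Delta> M (\<lambda>a. y ^ fst a * (z ^ fst a * \<mu> a))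
      = point_eval \<Delta> M (\<lambda>a. (y * z) ^ fst a * \<mu> a)" for y
    by (simp add: power_mult_distrib mult.assoc)
  moreover have "y * z \<noteq> 0" if "y \<noteq> 0" for y
    using z(1) that by simp
  ultimately show "rep_point \<Delta> M \<mu> = rep_point \<Delta> M \<nu>"
    unfolding eq rep_point_eq[OF assms(1)] rep_point_eq[OF monomial_points_scale[OF assms(1) z(1)]]
    by blast
qed

lemma toric_variety_eq: "toric_variety \<Delta> M = rep_point \<Delta> M ` monomial_points \<Delta> M"
proof
  show "toric_variety \<Delta> M \<subseteq> rep_point \<Delta> M ` monomial_points \<Delta> M"
    using cone_points_point_eval
    by (auto simp: toric_variety_def quotient_def rep_point_def image_iff)
  show "rep_point \<Delta> M ` monomial_points \<Delta> M \<subseteq> toric_variety \<Delta> M"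
    using point_eval_cone_points by (auto simp: toric_variety_def quotient_def rep_point_def)
qed

lemma rep_point_toric_variety: "\<mu> \<in> monomial_points \<Delta> M \<Longrightarrow> rep_point \<Delta> M \<mu> \<in> toric_variety \<Delta> M"
  by (simp add: toric_variety_eq)

section \<open>The Zariski topology\<close>

lemma rep_point_basic_open:
  assumes "\<mu> \<in> monomial_points \<Delta> M" "F \<in> S_part \<Delta> M d"
  shows "rep_point \<Delta> M \<mu> \<in> basic_open \<Delta> M F \<longleftrightarrow> laurent_eval F \<mu> \<noteq> 0"
  using rep_point_eval_nz[OF assms(1) _ assms(2)] rep_point_self[OF assms(1)]
    rep_point_toric_variety[OF assms(1)] by (auto simp: basic_open_def)

lemma basic_open_mult:
  assumes "F \<in> S_part \<Delta> M d" "G \<in> S_part \<Delta> M e"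
  shows "basic_open \<Delta> M (F * G) = basic_open \<Delta> M F \<inter> basic_open \<Delta> M G"
proof -
  have "p \<in> basic_open \<Delta> M (F * G) \<longleftrightarrow> p \<in> basic_open \<Delta> M F \<inter> basic_open \<Delta> M G"
    if "p \<in> toric_variety \<Delta> M" for p
    using that assms S_part_mult[OF assms] monomial_points_S_part_mult[OF _ assms]
    by (auto simp: toric_variety_eq rep_point_basic_open)
  then show ?thesis by (auto simp: basic_open_def)
qed

text \<open>The generating sets form a basis and not merely a subbasis, since the product of two
  forms cuts out the intersection of their basic open sets.\<close>

lemma openin_zariski_iff:
  "openin (zariski \<Delta> M) U \<longleftrightarrow> U \<subseteq> toric_variety \<Delta> M \<and>
     (\<forall>p\<in>U. \<exists>d. \<exists>F\<in>S_part \<Delta> M d. p \<in> basic_open \<Delta> M F \<and> basic_open \<Delta> M F \<subseteq> U)"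
    (is "_ \<longleftrightarrow> ?P U")
proof -
  let ?B = "{basic_open \<Delta> M F | F. \<exists>d. F \<in> S_part \<Delta> M d}"
  have zar: "zariski \<Delta> M = topology_generated_by ?B"
    by (simp add: zariski_def basic_open_def)
  have "generate_topology_on ?B U \<longleftrightarrow> ?P U"
  proof
    assume "generate_topology_on ?B U"
    then show "?P U"
    proof induction
      case (Int a b)
      show ?case
      proof (intro conjI ballI)
        fix p assume p: "p \<in> a \<inter> b"
        obtain d F e G where
          "F \<in> S_part \<Delta> M d" "p \<in> basic_open \<Delta> M F" "basic_open \<Delta> M F \<subseteq> a"
          "G \<in> S_part \<Delta> M e" "p \<in> basic_open \<Delta> M G" "basic_open \<Delta> M G \<subseteq> b"
          using Int.IH p by (metis IntE)
        then show "\<exists>d. \<exists>F\<in>S_part \<Delta> M d. p \<in> basic_open \<Delta> M F \<and> basic_open \<Delta> M F \<subseteq> a \<inter> b"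
          by (intro exI[of _ "d + e"] bexI[of _ "F * G"]) (auto simp: basic_open_mult S_part_mult)
      qed (use Int.IH in blast)
    next
      case (UN K)
      show ?case
      proof (intro conjI ballI)
        fix p assume "p \<in> \<Union>K"
        then obtain k where k: "k \<in> K" "p \<in> k" by blast
        with UN.IH[OF k(1)]
        show "\<exists>d. \<exists>F\<in>S_part \<Delta> M d. p \<in> basic_open \<Delta> M F \<and> basic_open \<Delta> M F \<subseteq> \<Union>K"
          by (meson Union_upper subset_trans)
      qed (use UN.IH in blast)
    next
      case (Basis s)
      then show ?case by (auto simp: basic_open_def)
    qed simp
  next
    assume U: "?P U"
    let ?K = "{basic_open \<Delta> M F | F. (\<exists>d. F \<in> S_part \<Delta> M d) \<and> basic_open \<Delta> M F \<subseteq> U}"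
    have "generate_topology_on ?B (\<Union>?K)"
      by (rule generate_topology_on.UN, rule generate_topology_on.Basis) blast
    moreover have "\<Union>?K = U"
    proof
      show "U \<subseteq> \<Union>?K"
      proof
        fix p assume "p \<in> U"
        then obtain d F where "F \<in> S_part \<Delta> M d" "p \<in> basic_open \<Delta> M F" "basic_open \<Delta> M F \<subseteq> U"
          using U by meson
        then show "p \<in> \<Union>?K" by blast
      qed
    qed blast
    ultimately show "generate_topology_on ?B U" by simp
  qed
  then show ?thesis
    unfolding zar openin_topology_generated_by_iff .
qed

lemma basic_open_openin: "F \<in> S_part \<Delta> M d \<Longrightarrow> openin (zariski \<Delta> M) (basic_open \<Delta> M F)"
  unfolding openin_zariski_iff by (auto simp: basic_open_def)

lemma topspace_zariski: "topspace (zariski \<Delta> M) = toric_variety \<Delta> M"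
proof
  show "topspace (zariski \<Delta> M) \<subseteq> toric_variety \<Delta> M"
    using openin_zariski_iff openin_topspace by blast
  \<comment> \<open>The constant 1, a form of degree 0, vanishes nowhere, so a single basic open set
    covers the variety.\<close>
  have one: "Poly_Mapping.single 0 1 \<in> S_part \<Delta> M 0"
    by (rule S_part_single) (simp_all add: zero_exponents)
  have "p \<in> basic_open \<Delta> M (Poly_Mapping.single 0 1)" if p: "p \<in> toric_variety \<Delta> M" for p
  proof -
    obtain \<mu> where "p = rep_point \<Delta> M \<mu>" "\<mu> \<in> monomial_points \<Delta> M"
      using p by (auto simp: toric_variety_eq)
    then show ?thesis
      using rep_point_basic_open[OF _ one] monomial_pointsD(1)[of \<mu> \<Delta> M]
      by (simp del: single_one)
  qed
  then have "toric_variety \<Delta> M \<subseteq> basic_open \<Delta> M (Poly_Mapping.single 0 1)" by blast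
  then show "toric_variety \<Delta> M \<subseteq> topspace (zariski \<Delta> M)"
    using openin_subset[OF basic_open_openin[OF one]] by blast
qed

lemma openin_subtopology_zariski_iff:
  assumes "Z \<subseteq> toric_variety \<Delta> M"
  shows "openin (subtopology (zariski \<Delta> M) Z) U \<longleftrightarrow> U \<subseteq> Z \<and>
     (\<forall>p\<in>U. \<exists>d. \<exists>F\<in>S_part \<Delta> M d. p \<in> basic_open \<Delta> M F \<and> basic_open \<Delta> M F \<inter> Z \<subseteq> U)"
    (is "_ \<longleftrightarrow> ?R")
proof
  assume "openin (subtopology (zariski \<Delta> M) Z) U"
  then obtain T where "openin (zariski \<Delta> M) T" "U = T \<inter> Z"
    by (auto simp: openin_subtopology)
  then show ?R
    unfolding openin_zariski_iff by (meson IntD1 Int_lower2 Int_mono order_refl)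
next
  assume R: ?R
  let ?K = "{basic_open \<Delta> M F | F. (\<exists>d. F \<in> S_part \<Delta> M d) \<and> basic_open \<Delta> M F \<inter> Z \<subseteq> U}"
  have "openin (zariski \<Delta> M) (\<Union>?K)"
    by (rule openin_Union) (auto intro: basic_open_openin)
  moreover have "U = \<Union>?K \<inter> Z"
  proof
    show "U \<subseteq> \<Union>?K \<inter> Z"
    proof
      fix p assume "p \<in> U"
      then obtain d F where
        "F \<in> S_part \<Delta> M d" "p \<in> basic_open \<Delta> M F" "basic_open \<Delta> M F \<inter> Z \<subseteq> U" "p \<in> Z"
        using R by (meson subsetD)
      then show "p \<in> \<Union>?K \<inter> Z" by blast
    qed
  qed blast
  ultimately show "openin (subtopology (zariski \<Delta> M) Z) U"
    by (auto simp: openin_subtopology)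
qed

lemma in_closure_zariski_iff:
  assumes "p \<in> toric_variety \<Delta> M"
  shows "p \<in> zariski \<Delta> M closure_of A \<longleftrightarrow>
     (\<forall>d. \<forall>F\<in>S_part \<Delta> M d. p \<in> basic_open \<Delta> M F \<longrightarrow> (\<exists>q\<in>A. q \<in> basic_open \<Delta> M F))"
proof
  assume "p \<in> zariski \<Delta> M closure_of A"
  then show "\<forall>d. \<forall>F\<in>S_part \<Delta> M d. p \<in> basic_open \<Delta> M F \<longrightarrow> (\<exists>q\<in>A. q \<in> basic_open \<Delta> M F)"
    by (auto simp: in_closure_of dest: basic_open_openin)
next
  assume R: "\<forall>d. \<forall>F\<in>S_part \<Delta> M d. p \<in> basic_open \<Delta> M F \<longrightarrow> (\<exists>q\<in>A. q \<in> basic_open \<Delta> M F)"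
  show "p \<in> zariski \<Delta> M closure_of A"
    unfolding in_closure_of topspace_zariski
  proof (intro conjI allI impI assms)
    fix T assume "p \<in> T \<and> openin (zariski \<Delta> M) T"
    then obtain d F where "F \<in> S_part \<Delta> M d" "p \<in> basic_open \<Delta> M F" "basic_open \<Delta> M F \<subseteq> T"
      unfolding openin_zariski_iff by meson
    then show "\<exists>y. y \<in> A \<and> y \<in> T" using R by (meson subsetD)
  qed
qed

section \<open>The torus, closures of hypersurfaces, and orbits\<close>

lemma torus_iff:
  "t \<in> torus M \<longleftrightarrow> (\<forall>x\<in>M. t x \<noteq> 0) \<and> (\<forall>x\<in>M. \<forall>y\<in>M. t (x + y) = t x * t y)"
  by (auto simp: torus_def hom_def lattice_group_def complex_units_def)

lemma torusD:
  assumes "t \<in> torus M"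
  shows "x \<in> M \<Longrightarrow> t x \<noteq> 0" "x \<in> M \<Longrightarrow> y \<in> M \<Longrightarrow> t (x + y) = t x * t y" "t 0 = 1"
  using assms zero_M unfolding torus_iff by (auto, metis add_0 mult_cancel_right1)

lemma torus_twist:
  assumes "\<mu> \<in> monomial_points \<Delta> M" "t \<in> torus M"
  shows "(\<lambda>a. t (snd a) * \<mu> a) \<in> monomial_points \<Delta> M"
  using assms torusD[OF assms(2)] snd_exponents
  unfolding monomial_points_def by (auto simp: zero_prod_def)

lemma torus_monomial_points:
  assumes "t \<in> torus M"
  shows "(\<lambda>a. t (snd a)) \<in> monomial_points \<Delta> M"
proof -
  have "(\<lambda>a. 1) \<in> monomial_points \<Delta> M"
    using one_exponents by (auto simp: monomial_points_def intro!: bexI[of _ "(1, 0)"])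
  from torus_twist[OF this assms] show ?thesis by simp
qed

lemma torus_point_eq: "torus_point \<Delta> M t = rep_point \<Delta> M (\<lambda>a. t (snd a))"
  by (simp add: torus_point_def rep_point_def point_eval_def[abs_def])

lemma torus_act_rep_point:
  assumes "\<mu> \<in> monomial_points \<Delta> M" "t \<in> torus M"
  shows "torus_act \<Delta> M t (rep_point \<Delta> M \<mu>) = rep_point \<Delta> M (\<lambda>a. t (snd a) * \<mu> a)"
proof -
  have S: "Poly_Mapping.mapp (\<lambda>a c. t (snd a) * c) F \<in> S_ring \<Delta> M" if "F \<in> S_ring \<Delta> M" for F
    using that keys_mapp_subset[of "\<lambda>a c. t (snd a) * c" F] by (auto simp: S_ring_def)
  \<comment> \<open>The torus action commutes with scaling by degree, so the representatives of a
    point correspond one scalar at a time.\<close>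
  have *: "(\<lambda>F. if F \<in> S_ring \<Delta> M
          then point_eval \<Delta> M (\<lambda>a. z ^ fst a * \<mu> a) (Poly_Mapping.mapp (\<lambda>a c. t (snd a) * c) F) else 0)
      = point_eval \<Delta> M (\<lambda>a. z ^ fst a * (t (snd a) * \<mu> a))" for z
    by (rule ext) (auto simp: point_eval_def S laurent_eval_mapp algebra_simps)
  show ?thesis
    unfolding rep_point_eq[OF assms(1)] rep_point_eq[OF torus_twist[OF assms]] torus_act_def
      setcompr_eq_image image_image by (simp only: *)
qed

lemma closure_hypersurface_subset: "closure_hypersurface \<Delta> M f \<subseteq> toric_variety \<Delta> M"
  unfolding closure_hypersurface_def topspace_zariski[symmetric] by (rule closure_of_subset_topspace)

text \<open>Closure is tested on basic open sets. In this form, with values of forms in place of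
  points, it can be transferred between the two lattices.\<close>

lemma rep_point_closure_hypersurface:
  assumes "\<mu> \<in> monomial_points \<Delta> M"
  shows "rep_point \<Delta> M \<mu> \<in> closure_hypersurface \<Delta> M f \<longleftrightarrow>
     (\<forall>d. \<forall>F\<in>S_part \<Delta> M d. laurent_eval F \<mu> \<noteq> 0 \<longrightarrow>
        (\<exists>t\<in>torus M. laurent_eval f t = 0 \<and> laurent_eval F (\<lambda>a. t (snd a)) \<noteq> 0))"
proof -
  have "(\<exists>q\<in>{torus_point \<Delta> M t | t. t \<in> torus M \<and> laurent_eval f t = 0}. q \<in> basic_open \<Delta> M F) \<longleftrightarrow>
      (\<exists>t\<in>torus M. laurent_eval f t = 0 \<and> laurent_eval F (\<lambda>a. t (snd a)) \<noteq> 0)"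
    if F: "F \<in> S_part \<Delta> M d" for d F
  proof -
    have "torus_point \<Delta> M t \<in> basic_open \<Delta> M F \<longleftrightarrow> laurent_eval F (\<lambda>a. t (snd a)) \<noteq> 0"
      if "t \<in> torus M" for t
      unfolding torus_point_eq by (rule rep_point_basic_open[OF torus_monomial_points[OF that] F])
    then show ?thesis by blast
  qed
  then show ?thesis
    unfolding closure_hypersurface_def in_closure_zariski_iff[OF rep_point_toric_variety[OF assms]]
    by (simp add: rep_point_basic_open[OF assms] cong: ball_cong)
qed

lemma rep_point_torus_orbit:
  assumes "\<mu> \<in> monomial_points \<Delta> M"
  shows "rep_point \<Delta> M \<mu> \<in> torus_orbit \<Delta> M \<Theta> \<longleftrightarrow>
     (\<forall>k\<ge>1. \<forall>m. (k, m) \<in> E \<longrightarrow> (\<mu> (k, m) \<noteq> 0 \<longleftrightarrow> inverse (of_nat k) *\<^sub>Q m \<in> \<Theta>))"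
proof -
  have "\<xi> (Poly_Mapping.single (k, m) 1) \<noteq> 0 \<longleftrightarrow> \<mu> (k, m) \<noteq> 0"
    if "\<xi> \<in> rep_point \<Delta> M \<mu>" "(k, m) \<in> E" for \<xi> k m
    using rep_point_eval_nz[OF assms that(1) S_part_single[OF that(2) refl, of 1]] by simp
  then show ?thesis
    using rep_point_toric_variety[OF assms] rep_point_self[OF assms]
    by (auto simp: torus_orbit_def)
qed

text \<open>The orbit prescribes the support of a point in positive degree; in degree 0 the only
  exponent is 0, where the value is 1.\<close>

lemma orbit_monomial_nz:
  assumes "\<mu> \<in> monomial_points \<Delta> M" "rep_point \<Delta> M \<mu> \<in> torus_orbit \<Delta> M \<Theta>"
    and "\<nu> \<in> monomial_points \<Delta> M" "rep_point \<Delta> M \<nu> \<in> torus_orbit \<Delta> M \<Theta>"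
    and "a \<in> E"
  shows "\<mu> a \<noteq> 0 \<longleftrightarrow> \<nu> a \<noteq> 0"
proof (cases "a = 0")
  case True
  then show ?thesis
    using assms(1,3) by (simp add: monomial_pointsD(1))
next
  case False
  then have "1 \<le> fst a"
    using assms(5) by (auto simp: exponents_def zero_prod_def)
  then show ?thesis
    using assms(2,4,5) unfolding rep_point_torus_orbit[OF assms(1)] rep_point_torus_orbit[OF assms(3)]
    by (metis prod.collapse)
qed

section \<open>Smoothness along an orbit\<close>

text \<open>
  In the notation of the definition of \<open>smooth_codim1_at\<close>: on the orbit of \<open>\<Theta>\<close> and near the point
  given by \<open>\<mu>\<close>, the section \<open>F\<close> of degree \<open>e\<close> is a multiple of \<open>G\<close>.
\<close>
definition orbit_multiple :: "'v set \<Rightarrow> (nat \<times> 'v \<Rightarrow> complex) \<Rightarrow> nat \<Rightarrow> 'v graded_poly \<Rightarrow>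
    nat \<Rightarrow> 'v graded_poly \<Rightarrow> bool" where
  "orbit_multiple \<Theta> \<mu> d G e F \<longleftrightarrow>
     (\<exists>i k. \<exists>H \<in> S_part \<Delta> M i. \<exists>A \<in> S_part \<Delta> M k. i + e = k + d \<and> laurent_eval H \<mu> \<noteq> 0 \<and>
        (\<forall>\<nu>\<in>monomial_points \<Delta> M. rep_point \<Delta> M \<nu> \<in> torus_orbit \<Delta> M \<Theta> \<longrightarrow>
           laurent_eval H \<nu> * laurent_eval F \<nu> = laurent_eval A \<nu> * laurent_eval G \<nu>))"

lemma torus_derivation_S_part: "F \<in> S_part \<Delta> M d \<Longrightarrow> torus_derivation \<delta> F \<in> S_part \<Delta> M d"
  using keys_mapp_subset[of "\<lambda>a c. \<delta> (snd a) * c" F]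
  by (auto simp: torus_derivation_def S_part_def S_ring_def)

text \<open>The two sides of the relation between \<open>F\<close> and \<open>G\<close> have the
  same degree, so a change of representative multiplies both by the same power of a scalar, and one
  representative per point is enough.\<close>

lemma smooth_codim1_at_iff:
  assumes "\<mu> \<in> monomial_points \<Delta> M"
  shows "smooth_codim1_at \<Delta> M I \<Theta> (rep_point \<Delta> M \<mu>) \<longleftrightarrow>
     (\<exists>d. \<exists>G \<in> I \<inter> S_part \<Delta> M d.
        (\<forall>e. \<forall>F \<in> I \<inter> S_part \<Delta> M e. orbit_multiple \<Theta> \<mu> d G e F) \<and>
        (\<exists>\<delta>. (\<forall>x\<in>M. \<forall>y\<in>M. \<delta> (x + y) = \<delta> x + \<delta> y) \<and>
             laurent_eval (torus_derivation \<delta> G) \<mu> \<noteq> 0))"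
proof -
  have nz: "(\<forall>\<xi>\<in>rep_point \<Delta> M \<mu>. \<xi> F \<noteq> 0) \<longleftrightarrow> laurent_eval F \<mu> \<noteq> 0" if "F \<in> S_part \<Delta> M d" for F d
    using rep_point_eval_nz[OF assms _ that] rep_point_self[OF assms] by blast
  have mult: "(\<forall>q\<in>torus_orbit \<Delta> M \<Theta>. \<forall>\<xi>\<in>q. \<xi> H * \<xi> F = \<xi> A * \<xi> G) \<longleftrightarrow>
      (\<forall>\<nu>\<in>monomial_points \<Delta> M. rep_point \<Delta> M \<nu> \<in> torus_orbit \<Delta> M \<Theta> \<longrightarrow>
         laurent_eval H \<nu> * laurent_eval F \<nu> = laurent_eval A \<nu> * laurent_eval G \<nu>)"
    (is "?l = ?r")
    if S: "H \<in> S_part \<Delta> M i" "F \<in> S_part \<Delta> M e" "A \<in> S_part \<Delta> M k" "G \<in> S_part \<Delta> M d"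
      and deg: "i + e = k + d" for H i F e A k G d
  proof
    assume l: ?l
    show ?r
    proof (intro ballI impI)
      fix \<nu> assume \<nu>: "\<nu> \<in> monomial_points \<Delta> M" "rep_point \<Delta> M \<nu> \<in> torus_orbit \<Delta> M \<Theta>"
      have "point_eval \<Delta> M \<nu> H * point_eval \<Delta> M \<nu> F = point_eval \<Delta> M \<nu> A * point_eval \<Delta> M \<nu> G"
        using l \<nu>(2) rep_point_self[OF \<nu>(1)] by blast
      then show "laurent_eval H \<nu> * laurent_eval F \<nu> = laurent_eval A \<nu> * laurent_eval G \<nu>"
        using S by simp
    qed
  next
    assume r: ?r
    show ?l
    proof (intro ballI)
      fix q \<xi> assume q: "q \<in> torus_orbit \<Delta> M \<Theta>" and \<xi>: "\<xi> \<in> q"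
      then have "q \<in> toric_variety \<Delta> M" by (simp add: torus_orbit_def)
      then obtain \<nu> where \<nu>: "\<nu> \<in> monomial_points \<Delta> M" "q = rep_point \<Delta> M \<nu>"
        by (auto simp: toric_variety_eq)
      obtain z where z: "\<And>d F. F \<in> S_part \<Delta> M d \<Longrightarrow> \<xi> F = z ^ d * laurent_eval F \<nu>"
        using rep_point_eval[OF \<nu>(1)] \<xi> \<nu>(2) by metis
      have "\<xi> H * \<xi> F = z ^ (i + e) * (laurent_eval H \<nu> * laurent_eval F \<nu>)"
        using z[OF S(1)] z[OF S(2)] by (simp add: power_add)
      also have "\<dots> = z ^ (k + d) * (laurent_eval A \<nu> * laurent_eval G \<nu>)"
        using r \<nu> q deg by simp
      also have "\<dots> = \<xi> A * \<xi> G"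
        using z[OF S(3)] z[OF S(4)] by (simp add: power_add)
      finally show "\<xi> H * \<xi> F = \<xi> A * \<xi> G" .
    qed
  qed
  show ?thesis
    unfolding smooth_codim1_at_def orbit_multiple_def
    by (intro arg_cong[where f = Ex] ext bex_cong refl conj_cong
          arg_cong[where f = All] ball_cong; (elim IntE)?;
        (rule mult nz; (assumption | rule torus_derivation_S_part)+))
qed

text \<open>Two fractions are added over the common denominator \<open>H * H'\<close>, which is
  still nonzero at \<open>\<mu>\<close>.\<close>

lemma orbit_multiple_add:
  assumes F: "orbit_multiple \<Theta> \<mu> d G e F" "orbit_multiple \<Theta> \<mu> d G e F'"
    and \<mu>: "\<mu> \<in> monomial_points \<Delta> M"
  shows "orbit_multiple \<Theta> \<mu> d G e (F + F')"
proof -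
  obtain i k H A where 1: "H \<in> S_part \<Delta> M i" "A \<in> S_part \<Delta> M k" "i + e = k + d" "laurent_eval H \<mu> \<noteq> 0"
    "\<And>\<nu>. \<nu> \<in> monomial_points \<Delta> M \<Longrightarrow> rep_point \<Delta> M \<nu> \<in> torus_orbit \<Delta> M \<Theta> \<Longrightarrow>
       laurent_eval H \<nu> * laurent_eval F \<nu> = laurent_eval A \<nu> * laurent_eval G \<nu>"
    using F(1) unfolding orbit_multiple_def by auto
  obtain i' k' H' A' where 2: "H' \<in> S_part \<Delta> M i'" "A' \<in> S_part \<Delta> M k'" "i' + e = k' + d"
    "laurent_eval H' \<mu> \<noteq> 0"
    "\<And>\<nu>. \<nu> \<in> monomial_points \<Delta> M \<Longrightarrow> rep_point \<Delta> M \<nu> \<in> torus_orbit \<Delta> M \<Theta> \<Longrightarrow>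
       laurent_eval H' \<nu> * laurent_eval F' \<nu> = laurent_eval A' \<nu> * laurent_eval G \<nu>"
    using F(2) unfolding orbit_multiple_def by auto
  \<comment> \<open>The two summands of the new numerator have the same degree, so their sum is
    homogeneous.\<close>
  have deg: "k' + i = k + i'" using 1(3) 2(3) by linarith
  show ?thesis
    unfolding orbit_multiple_def
  proof (rule exI[of _ "i + i'"], rule exI[of _ "k + i'"], rule bexI[of _ "H * H'"],
      rule bexI[of _ "A * H' + A' * H"], intro conjI ballI impI)
    show "H * H' \<in> S_part \<Delta> M (i + i')" by (rule S_part_mult[OF 1(1) 2(1)])
    show "A * H' + A' * H \<in> S_part \<Delta> M (k + i')"
      using S_part_mult[OF 1(2) 2(1)] S_part_mult[OF 2(2) 1(1)] by (simp add: deg S_part_add)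
    show "i + i' + e = k + i' + d" using 1(3) by simp
    show "laurent_eval (H * H') \<mu> \<noteq> 0"
      using 1(4) 2(4) monomial_points_S_part_mult[OF \<mu> 1(1) 2(1)] by simp
    fix \<nu> assume \<nu>: "\<nu> \<in> monomial_points \<Delta> M" "rep_point \<Delta> M \<nu> \<in> torus_orbit \<Delta> M \<Theta>"
    have "laurent_eval (H * H') \<nu> * laurent_eval (F + F') \<nu>
        = laurent_eval H' \<nu> * (laurent_eval H \<nu> * laurent_eval F \<nu>)
        + laurent_eval H \<nu> * (laurent_eval H' \<nu> * laurent_eval F' \<nu>)"
      using monomial_points_S_part_mult[OF \<nu>(1) 1(1) 2(1)]
      by (simp add: laurent_eval_add algebra_simps)
    also have "\<dots> = laurent_eval (A * H' + A' * H) \<nu> * laurent_eval G \<nu>"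
      using monomial_points_S_part_mult[OF \<nu>(1) 1(2) 2(1)]
        monomial_points_S_part_mult[OF \<nu>(1) 2(2) 1(1)]
      unfolding 1(5)[OF \<nu>] 2(5)[OF \<nu>] by (simp add: laurent_eval_add algebra_simps)
    finally show "laurent_eval (H * H') \<nu> * laurent_eval (F + F') \<nu>
        = laurent_eval (A * H' + A' * H) \<nu> * laurent_eval G \<nu>" .
  qed
qed

text \<open>The multiplier 0 works, but its degree must be a natural number, which forces a
  denominator of large degree. The \<open>d\<close>-fold multiple of an exponent of positive degree
  that does not vanish at \<open>\<mu>\<close> provides one of degree at least
  \<open>d\<close>.\<close>

lemma orbit_multiple_vanishing:
  assumes F: "\<And>\<nu>. \<nu> \<in> monomial_points \<Delta> M \<Longrightarrow> rep_point \<Delta> M \<nu> \<in> torus_orbit \<Delta> M \<Theta> \<Longrightarrow> laurent_eval F \<nu> = 0"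
    and \<mu>: "\<mu> \<in> monomial_points \<Delta> M"
  shows "orbit_multiple \<Theta> \<mu> d G e F"
proof -
  obtain a where a: "a \<in> E" "1 \<le> fst a" "\<mu> a \<noteq> 0"
    using monomial_pointsD(3)[OF \<mu>] by blast
  have deg: "d \<le> d * fst a" using mult_le_mono2[OF a(2), of d] by simp
  show ?thesis
    unfolding orbit_multiple_def
  proof (rule exI[of _ "d * fst a"], rule exI[of _ "d * fst a + e - d"],
      rule bexI[of _ "Poly_Mapping.single (nsum d a) 1"], rule bexI[of _ 0], intro conjI ballI impI)
    show "Poly_Mapping.single (nsum d a) 1 \<in> S_part \<Delta> M (d * fst a)"
      by (rule S_part_single[OF nsum_exponents[OF a(1)]]) (induction d, simp_all)
    show "0 \<in> S_part \<Delta> M (d * fst a + e - d)" by (rule S_part_zero)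
    show "d * fst a + e = d * fst a + e - d + d"
      using le_add_diff_inverse2[of d "d * fst a + e"] deg by linarith
    show "laurent_eval (Poly_Mapping.single (nsum d a) 1) \<mu> \<noteq> 0"
      using a(1,3) monomial_points_nsum[OF \<mu>] by simp
  qed (simp add: F)
qed

lemma orbit_multiple_sum:
  assumes "finite J" "\<And>c. c \<in> J \<Longrightarrow> orbit_multiple \<Theta> \<mu> d G e (F c)" "\<mu> \<in> monomial_points \<Delta> M"
  shows "orbit_multiple \<Theta> \<mu> d G e (\<Sum>c\<in>J. F c)"
  using assms(1,2)
proof (induction J rule: finite_induct)
  case empty
  then show ?case
    using orbit_multiple_vanishing[OF _ assms(3), of \<Theta> 0] by simp
next
  case (insert c J)
  then show ?case
    using orbit_multiple_add[OF _ _ assms(3), of \<Theta> d G e "F c" "sum F J"] by simp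
qed

end

section \<open>Finite morphisms\<close>

lemma fst_nsum: "fst (nsum k a) = k * fst a" for a :: "nat \<times> 'a::comm_monoid_add"
  by (induction k) simp_all

lemma snd_nsum: "snd (nsum k a) = nsum k (snd a)"
  by (induction k) simp_all

text \<open>\<open>N\<close> kills the quotient \<open>M2 / L\<close>, and
  \<open>finite_index\<close> bounds the number of its classes, which makes the dual group finite
  and averaging possible. \<open>bij_\<phi>\<close> concerns the rational spaces; on the lattices
  \<open>\<phi>\<close> is only injective.\<close>

locale lattice_isogeny =
  src: polarized_lattice \<Delta>1 M1 + tgt: polarized_lattice \<Delta>2 M2
  for \<Delta>1 M1 :: "'v::rat_vector set" and \<Delta>2 M2 :: "'w::rat_vector set" +
  fixes \<phi> :: "'v \<Rightarrow> 'w" and N :: nat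
  assumes linear_\<phi>: "Vector_Spaces.linear scaleQ scaleQ \<phi>"
    and bij_\<phi>: "bij \<phi>"
    and \<phi>_M: "\<phi> ` M1 \<subseteq> M2"
    and \<phi>_\<Delta>: "\<phi> ` \<Delta>1 = \<Delta>2"
    and N_pos: "1 \<le> N"
    and N_M2: "m \<in> M2 \<Longrightarrow> nsum N m \<in> \<phi> ` M1"
    and finite_index: "\<exists>D. finite D \<and> (\<forall>m\<in>M2. \<exists>d\<in>D. m - d \<in> \<phi> ` M1)"
begin

abbreviation "L \<equiv> \<phi> ` M1"
definition j :: "nat \<times> 'v \<Rightarrow> nat \<times> 'w" where "j = map_prod id \<phi>"
abbreviation "LE \<equiv> snd -` L :: (nat \<times> 'w) set"

lemma \<phi>_add: "\<phi> (x + y) = \<phi> x + \<phi> y"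
  and \<phi>_scale: "\<phi> (c *\<^sub>Q x) = c *\<^sub>Q \<phi> x"
  using linear_\<phi> by (simp_all add: module_hom.add module_hom.scale linear_iff_module_hom)

lemma \<phi>_zero [simp]: "\<phi> 0 = 0"
  using \<phi>_add[of 0 0] by simp

lemma \<phi>_uminus: "\<phi> (- x) = - \<phi> x"
  using \<phi>_add[of x "- x"] by (simp add: add_eq_0_iff2)

lemma inj_\<phi>: "inj \<phi>"
  using bij_\<phi> by (rule bij_is_inj)

lemma j_simps [simp]: "fst (j a) = fst a" "snd (j a) = \<phi> (snd a)" "j (k, m) = (k, \<phi> m)"
  by (simp_all add: j_def)

lemma inj_j: "inj j"
  unfolding j_def using inj_\<phi> by (simp add: prod.inj_map)

lemma j_add: "j (a + b) = j a + j b"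
  by (simp add: prod_eq_iff \<phi>_add)

lemma j_zero [simp]: "j 0 = 0"
  by (simp add: prod_eq_iff)

lemma j_nsum: "j (nsum k a) = nsum k (j a)"
  by (induction k) (simp_all add: j_add)

lemma mem_L_iff [simp]: "\<phi> x \<in> L \<longleftrightarrow> x \<in> M1"
  using inj_\<phi> by (simp add: inj_image_mem_iff)

lemma zero_L: "0 \<in> L"
  using src.zero_M \<phi>_zero by (metis imageI)

lemma add_L: "x \<in> L \<Longrightarrow> y \<in> L \<Longrightarrow> x + y \<in> L"
  using src.add_M \<phi>_add by (metis (no_types, lifting) imageE imageI)

lemma uminus_L: "x \<in> L \<Longrightarrow> - x \<in> L"
  using src.uminus_M \<phi>_uminus by (metis (no_types, lifting) imageE imageI)

lemma diff_L: "x \<in> L \<Longrightarrow> y \<in> L \<Longrightarrow> x - y \<in> L"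
  using add_L[of x "- y"] uminus_L by simp

lemma add_L_iff: "x \<in> L \<Longrightarrow> x + y \<in> L \<longleftrightarrow> y \<in> L"
  using add_L diff_L[of "x + y" x] by auto

lemma L_subset: "x \<in> L \<Longrightarrow> x \<in> M2"
  using \<phi>_M by blast

lemma mem_\<Delta>_iff [simp]: "\<phi> x \<in> \<Delta>2 \<longleftrightarrow> x \<in> \<Delta>1"
  using inj_\<phi> \<phi>_\<Delta> by (metis inj_image_mem_iff)

text \<open>\<open>\<phi>\<close> commutes with scaling and \<open>\<Delta>2\<close> is the image of
  \<open>\<Delta>1\<close>, so the polytope conditions agree on both sides and only the lattice
  condition distinguishes them. This identifies the smaller ring with the part over
  \<open>L\<close>.\<close>

lemma j_exponents_iff: "j a \<in> tgt.E \<and> snd (j a) \<in> L \<longleftrightarrow> a \<in> src.E"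
  using \<phi>_M \<phi>_zero inj_\<phi> src.zero_M
  by (cases a) (auto simp: exponents_def \<phi>_scale[symmetric] inj_eq dest: injD[of \<phi> _ 0])

lemma j_exponents: "a \<in> src.E \<Longrightarrow> j a \<in> tgt.E"
  using j_exponents_iff by blast

lemma exponents_over_L:
  assumes "a \<in> tgt.E" "snd a \<in> L"
  obtains b where "b \<in> src.E" "a = j b"
proof -
  obtain x where "snd a = \<phi> x" using assms(2) by blast
  then have "a = j (fst a, x)" by (cases a) simp
  then show ?thesis using that assms j_exponents_iff by metis
qed

lemma nsum_exponents_over_L:
  assumes "a \<in> tgt.E"
  obtains b where "b \<in> src.E" "nsum N a = j b"
  using exponents_over_L[OF tgt.nsum_exponents[OF assms]] N_M2[OF tgt.snd_exponents[OF assms]]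
  by (metis snd_nsum)

lemma nsum_N: "nsum N x = x + nsum (N - 1) x"
  using N_pos by (cases N) simp_all

text \<open>A monomial of positive degree that does not vanish may lie outside \<open>L\<close>, but
  its N-th power lies over \<open>L\<close>. Hence the pulled back point avoids the irrelevant locus
  and the toric morphism is defined everywhere.\<close>

lemma pullback_monomial_points:
  assumes "\<mu> \<in> monomial_points \<Delta>2 M2"
  shows "(\<lambda>a. \<mu> (j a)) \<in> monomial_points \<Delta>1 M1"
proof -
  obtain a where a: "a \<in> tgt.E" "1 \<le> fst a" "\<mu> a \<noteq> 0"
    using monomial_pointsD(3)[OF assms] by blast
  obtain b where b: "b \<in> src.E" "nsum N a = j b"
    using nsum_exponents_over_L[OF a(1)] .
  have "\<mu> (j b) = \<mu> a ^ N"
    using tgt.monomial_points_nsum[OF assms a(1), of N] b(2) by simp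
  moreover have "fst b = N * fst a"
    using b(2) fst_nsum[of N a] by (metis j_simps(1))
  ultimately have "1 \<le> fst b \<and> \<mu> (j b) \<noteq> 0"
    using a(2,3) N_pos by simp
  then have "\<exists>b\<in>src.E. 1 \<le> fst b \<and> \<mu> (j b) \<noteq> 0"
    using b(1) by blast
  then show ?thesis
    using monomial_pointsD(1,2)[OF assms] j_exponents
    by (simp add: monomial_points_def j_add)
qed

lemma monomial_map_S_ring:
  assumes "F \<in> S_ring \<Delta>1 M1"
  shows "monomial_map j F \<in> S_ring \<Delta>2 M2"
proof -
  have "j ` Poly_Mapping.keys F \<subseteq> tgt.E"
    using assms j_exponents by (auto simp: S_ring_def)
  then show ?thesis
    using subset_trans[OF keys_monomial_map] unfolding S_ring_def by blast
qed

lemma monomial_map_S_part: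
  assumes "F \<in> S_part \<Delta>1 M1 d"
  shows "monomial_map j F \<in> S_part \<Delta>2 M2 d"
proof (rule S_partI)
  fix a assume "a \<in> Poly_Mapping.keys (monomial_map j F)"
  then obtain b where "b \<in> Poly_Mapping.keys F" "a = j b"
    using keys_monomial_map[of j F] by blast
  then show "a \<in> tgt.E \<and> fst a = d"
    using S_partD(2)[OF assms] S_partD(3)[OF assms, of b] j_exponents[of b] by auto
qed

lemma toric_morphism_rep_point:
  assumes "\<mu> \<in> monomial_points \<Delta>2 M2"
  shows "toric_morphism \<Delta>1 M1 \<phi> (rep_point \<Delta>2 M2 \<mu>) = rep_point \<Delta>1 M1 (\<lambda>a. \<mu> (j a))"
proof -
  have *: "(\<lambda>F. if F \<in> S_ring \<Delta>1 M1
          then point_eval \<Delta>2 M2 (\<lambda>a. z ^ fst a * \<mu> a) (monomial_map j F) else 0)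
      = point_eval \<Delta>1 M1 (\<lambda>a. z ^ fst a * \<mu> (j a))" for z
    by (rule ext) (auto simp: point_eval_def monomial_map_S_ring laurent_eval_monomial_map)
  show ?thesis
    unfolding tgt.rep_point_eq[OF assms] src.rep_point_eq[OF pullback_monomial_points[OF assms]]
      toric_morphism_def j_def[symmetric] setcompr_eq_image image_image by (simp only: *)
qed

text \<open>The Reynolds operator followed by the identification of exponents over \<open>L\<close>
  with those of the smaller lattice.\<close>

definition descend :: "'w graded_poly \<Rightarrow> 'v graded_poly" where
  "descend F = Poly_Mapping.map_key j (restr LE F)"

lemma monomial_map_descend:
  assumes "F \<in> S_ring \<Delta>2 M2"
  shows "monomial_map j (descend F) = restr LE F"
  unfolding descend_def
proof (rule monomial_map_map_key[OF inj_j])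
  show "Poly_Mapping.keys (restr LE F) \<subseteq> range j"
  proof
    fix a assume "a \<in> Poly_Mapping.keys (restr LE F)"
    then have "a \<in> tgt.E" "snd a \<in> L"
      using assms by (auto simp: S_ring_def keys_restr)
    then show "a \<in> range j"
      using exponents_over_L by blast
  qed
qed

lemma descend_S_part:
  assumes "F \<in> S_part \<Delta>2 M2 d"
  shows "descend F \<in> S_part \<Delta>1 M1 d"
proof (rule S_partI)
  fix a assume "a \<in> Poly_Mapping.keys (descend F)"
  then have "j a \<in> Poly_Mapping.keys F" "snd (j a) \<in> L"
    by (auto simp: descend_def keys_map_key[OF inj_j] keys_restr)
  then show "a \<in> src.E \<and> fst a = d"
    using S_partD(2)[OF assms] S_partD(3)[OF assms, of "j a"] j_exponents_iff[of a] by auto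
qed

lemma laurent_eval_descend:
  assumes "F \<in> S_ring \<Delta>2 M2"
  shows "laurent_eval (descend F) (\<lambda>a. \<mu> (j a)) = laurent_eval (restr LE F) \<mu>"
  using monomial_map_descend[OF assms] laurent_eval_monomial_map[of j "descend F" \<mu>] by simp

text \<open>The kernel of the homomorphism of tori, that is, the dual group inside the torus. Values
  outside \<open>M2\<close> are arbitrary, so one group element has many representatives
  here.\<close>

definition annihilator :: "('w \<Rightarrow> complex) set" where
  "annihilator = {t \<in> torus M2. (\<forall>x\<in>L. t x = 1)}"

lemma annihilatorD:
  assumes "t \<in> annihilator"
  shows "t \<in> torus M2" "x \<in> L \<Longrightarrow> t x = 1"
  using assms by (auto simp: annihilator_def)

lemma annihilator_cong:
  assumes "t \<in> annihilator" "x \<in> M2" "y \<in> M2" "x - y \<in> L"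
  shows "t x = t y"
proof -
  have "t (x - y + y) = t (x - y) * t y"
    using tgt.torusD(2)[OF annihilatorD(1)[OF assms(1)] L_subset[OF assms(4)] assms(3)] .
  then show ?thesis
    using annihilatorD(2)[OF assms(1,4)] by simp
qed

lemma annihilator_mult:
  "s \<in> annihilator \<Longrightarrow> t \<in> annihilator \<Longrightarrow> (\<lambda>x. s x * t x) \<in> annihilator"
  by (auto simp: annihilator_def tgt.torus_iff)

lemma annihilator_inverse: "t \<in> annihilator \<Longrightarrow> (\<lambda>x. inverse (t x)) \<in> annihilator"
  by (auto simp: annihilator_def tgt.torus_iff)

lemma annihilator_root_of_unity:
  assumes "t \<in> annihilator" "x \<in> M2"
  shows "t x ^ N = 1"
proof -
  have "t (nsum k x) = t x ^ k" for k
    using tgt.torusD[OF annihilatorD(1)[OF assms(1)]] assms(2) tgt.nsum_M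
    by (induction k) simp_all
  then show ?thesis
    using annihilatorD(2)[OF assms(1) N_M2[OF assms(2)]] by simp
qed

text \<open>If \<open>k\<close> is the order of \<open>m\<close> modulo \<open>L\<close>, then k >
  1, and sending \<open>m\<close> to a nontrivial \<open>k\<close>-th root of unity and
  \<open>L\<close> to 1 is consistent on the group generated by \<open>L\<close> and
  \<open>m\<close>; this character extends.\<close>

lemma annihilator_separates:
  assumes "m \<in> M2" "m \<notin> L"
  shows "\<exists>t\<in>annihilator. t m \<noteq> 1"
proof -
  define k where "k = (LEAST k. 1 \<le> k \<and> nsum k m \<in> L)"
  have k: "1 \<le> k" "nsum k m \<in> L"
    using LeastI[of "\<lambda>k. 1 \<le> k \<and> nsum k m \<in> L" N] N_pos N_M2[OF assms(1)] unfolding k_def by auto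
  have min: "i = 0" if "i < k" "nsum i m \<in> L" for i
    using not_less_Least[of i "\<lambda>k. 1 \<le> k \<and> nsum k m \<in> L"] that unfolding k_def by auto
  have "k \<noteq> 1" using k(2) assms(2) by auto
  then obtain w :: complex where w: "w ^ k = 1" "w \<noteq> 1"
    using nontrivial_root_of_unity_exists[of k] k(1) by auto
  have wi: "w ^ i = 1" if "nsum i m \<in> L" for i
    using that
  proof (induction i rule: less_induct)
    case (less i)
    show ?case
    proof (cases "i < k")
      case True
      then show ?thesis using min less.prems by fastforce
    next
      case False
      then have i: "i = k + (i - k)" by simp
      then have "nsum i m = nsum k m + nsum (i - k) m" by (metis nsum_add)
      then have "nsum (i - k) m \<in> L" using less.prems add_L_iff[OF k(2)] by simp
      then have "w ^ (i - k) = 1" using less.IH[of "i - k"] k(1) False by simp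
      then show ?thesis using i w(1) by (metis mult_1 power_add)
    qed
  qed
  have w0: "w \<noteq> 0" using w(1) k(1) by (auto simp: power_0_left)
  define R where "R = {(x + nsum i m, w ^ i) | x i. x \<in> L}"
  have RI: "(y, v) \<in> R" if "x \<in> L" "y = x + nsum i m" "v = w ^ i" for x i y v
    using that unfolding R_def by blast
  have "character_graph R"
    unfolding character_graph_def
  proof (intro conjI allI impI)
    show "(0, 1) \<in> R" by (rule RI[OF zero_L, of _ 0]) simp_all
  next
    fix x u y v assume "(x, u) \<in> R" "(y, v) \<in> R"
    then obtain x' i y' l where
      "x' \<in> L" "x = x' + nsum i m" "u = w ^ i" "y' \<in> L" "y = y' + nsum l m" "v = w ^ l"
      unfolding R_def by blast
    then show "(x + y, u * v) \<in> R"
      by (intro RI[OF add_L, of x' y' _ "i + l"]) (simp_all add: nsum_add power_add algebra_simps)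
  next
    fix x u assume "(x, u) \<in> R"
    then obtain x' i where x: "x' \<in> L" "x = x' + nsum i m" "u = w ^ i"
      unfolding R_def by blast
    \<comment> \<open>The graph uses natural multiples of \<open>m\<close> only. Modulo
      \<open>L\<close> the negative of i m is (N-1) i m, because N i m lies in
      \<open>L\<close>.\<close>
    have NL: "nsum N (nsum i m) \<in> L"
      by (rule N_M2) (rule tgt.nsum_M[OF assms(1)])
    have mult: "nsum l (nsum i m) = nsum (l * i) m" for l
      by (induction l) (simp_all add: nsum_add)
    have "w ^ i * w ^ ((N - 1) * i) = w ^ (N * i)"
      using N_pos by (cases N) (simp_all add: power_add)
    also have "w ^ (N * i) = 1" using wi NL mult by metis
    finally have "inverse u = w ^ ((N - 1) * i)"
      using x(3) by (metis inverse_unique)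
    moreover have "- x' - nsum N (nsum i m) \<in> L"
      using x(1) NL diff_L uminus_L by blast
    moreover have "- x = - x' - nsum N (nsum i m) + nsum ((N - 1) * i) m"
      unfolding x(2) nsum_N mult[symmetric] by simp
    ultimately show "(- x, inverse u) \<in> R"
      using RI by blast
  next
    fix x show "(x, 0) \<notin> R" using w0 unfolding R_def by auto
  next
    fix u assume "(0, u) \<in> R"
    then obtain x i where x: "x \<in> L" "0 = x + nsum i m" "u = w ^ i"
      unfolding R_def by blast
    then have "nsum i m = - x" by (metis add_eq_0_iff)
    then show "u = 1" using wi x uminus_L by metis
  qed
  then obtain \<chi> where \<chi>: "\<And>x y. \<chi> (x + y) = \<chi> x * \<chi> y" "\<And>x. \<chi> x \<noteq> 0" "\<And>x u. (x, u) \<in> R \<Longrightarrow> \<chi> x = u"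
    using character_graph_total_extension by blast
  have "\<chi> x = 1" if "x \<in> L" for x
    by (rule \<chi>(3), rule RI[OF that, of _ 0]) simp_all
  moreover have "\<chi> m = w"
    by (rule \<chi>(3), rule RI[OF zero_L, of _ 1]) simp_all
  ultimately have "\<chi> \<in> annihilator" "\<chi> m \<noteq> 1"
    using \<chi>(1,2) w(2) by (auto simp: annihilator_def tgt.torus_iff)
  then show ?thesis by blast
qed

section \<open>Cosets of \<open>L\<close> and the dual group\<close>

abbreviation "C \<equiv> \<lambda>x. L #>\<^bsub>lattice_group M2\<^esub> x"

lemma coset_eq: "C x = (\<lambda>h. h + x) ` L"
  by (auto simp: r_coset_def lattice_group_def)

lemma coset_self: "x \<in> C x"
  using zero_L by (auto simp: coset_eq image_iff)

lemma coset_eq_iff: "C x = C y \<longleftrightarrow> x - y \<in> L"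
proof
  assume "C x = C y"
  then have "x \<in> C y" using coset_self by blast
  then show "x - y \<in> L" by (auto simp: coset_eq)
next
  assume xy: "x - y \<in> L"
  show "C x = C y"
  proof
    show "C x \<subseteq> C y"
      unfolding coset_eq
    proof
      fix z assume "z \<in> (\<lambda>h. h + x) ` L"
      then have "z - y \<in> L" using add_L[OF _ xy] by (auto simp: algebra_simps)
      then show "z \<in> (\<lambda>h. h + y) ` L" by (intro image_eqI[of _ _ "z - y"]) simp_all
    qed
    show "C y \<subseteq> C x"
      unfolding coset_eq
    proof
      fix z assume "z \<in> (\<lambda>h. h + y) ` L"
      then have "z - x \<in> L" using diff_L[OF _ xy] by (auto simp: algebra_simps)
      then show "z \<in> (\<lambda>h. h + x) ` L" by (intro image_eqI[of _ _ "z - x"]) simp_all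
    qed
  qed
qed

lemma coset_mult: "C x <#>\<^bsub>lattice_group M2\<^esub> C y = C (x + y)"
proof -
  have "\<exists>h\<in>L. a + x + (b + y) = h + (x + y)" if "a \<in> L" "b \<in> L" for a b
    using that by (intro bexI[of _ "a + b"]) (auto simp: algebra_simps intro: add_L)
  moreover have "\<exists>a\<in>L. \<exists>b\<in>L. h + (x + y) = a + x + (b + y)" if "h \<in> L" for h
    using that zero_L by (intro bexI[of _ h] bexI[of _ 0]) (auto simp: algebra_simps)
  ultimately show ?thesis
    unfolding coset_eq set_mult_def by (fastforce simp: lattice_group_def)
qed

lemma carrier_quotient: "carrier (lattice_group M2 Mod L) = C ` M2"
  by (auto simp: FactGroup_def RCOSETS_def lattice_group_def)

lemma mult_quotient: "x \<otimes>\<^bsub>lattice_group M2 Mod L\<^esub> y = x <#>\<^bsub>lattice_group M2\<^esub> y"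
  by (simp add: FactGroup_def)

lemma dual_group_annihilator:
  assumes "g \<in> carrier (dual_group M2 L)"
  shows "(\<lambda>m. g (C m)) \<in> annihilator"
proof -
  have hom: "g \<in> hom (lattice_group M2 Mod L) complex_units"
    using assms by (simp add: dual_group_def character_group_def)
  have nz: "g (C x) \<noteq> 0" if "x \<in> M2" for x
    using hom that carrier_quotient by (auto simp: hom_def complex_units_def)
  have mult: "g (C (x + y)) = g (C x) * g (C y)" if "x \<in> M2" "y \<in> M2" for x y
    using hom_mult[OF hom, of "C x" "C y"] that carrier_quotient
    by (simp add: mult_quotient coset_mult complex_units_def)
  have "g (C x) = 1" if "x \<in> L" for x
  proof -
    have "C x = C 0" using that by (simp add: coset_eq_iff)
    moreover have "g (C 0) = 1"
      using mult[of 0 0] nz[of 0] tgt.zero_M by simp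
    ultimately show ?thesis by simp
  qed
  then show ?thesis
    using nz mult by (simp add: annihilator_def tgt.torus_iff)
qed

lemma annihilator_dual_group:
  assumes "t \<in> annihilator"
  obtains g where "g \<in> carrier (dual_group M2 L)" "\<And>m. m \<in> M2 \<Longrightarrow> g (C m) = t m"
proof -
  \<comment> \<open>A coset takes the value of \<open>t\<close> at a chosen representative, on which
    it does not depend by \<open>annihilator_cong\<close>; the restriction makes \<open>g\<close>
    extensional.\<close>
  define g where "g = (\<lambda>c\<in>carrier (lattice_group M2 Mod L). t (SOME x. x \<in> M2 \<and> c = C x))"
  have g: "g (C m) = t m" if m: "m \<in> M2" for m
  proof -
    have "(SOME x. x \<in> M2 \<and> C m = C x) \<in> M2 \<and> C m = C (SOME x. x \<in> M2 \<and> C m = C x)"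
      by (rule someI[of _ m]) (simp add: m)
    then have "t m = t (SOME x. x \<in> M2 \<and> C m = C x)"
      using annihilator_cong[OF assms m] coset_eq_iff by blast
    then show ?thesis
      using m by (simp add: g_def carrier_quotient)
  qed
  have "g \<in> hom (lattice_group M2 Mod L) complex_units"
  proof (rule homI)
    fix c assume "c \<in> carrier (lattice_group M2 Mod L)"
    then show "g c \<in> carrier complex_units"
      using g tgt.torusD(1)[OF annihilatorD(1)[OF assms]]
      by (auto simp: carrier_quotient complex_units_def)
  next
    fix c d assume "c \<in> carrier (lattice_group M2 Mod L)" "d \<in> carrier (lattice_group M2 Mod L)"
    then obtain x y where "x \<in> M2" "c = C x" "y \<in> M2" "d = C y"
      by (auto simp: carrier_quotient)
    then show "g (c \<otimes>\<^bsub>lattice_group M2 Mod L\<^esub> d) = g c \<otimes>\<^bsub>complex_units\<^esub> g d"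
      using tgt.torusD(2)[OF annihilatorD(1)[OF assms]]
      by (simp add: mult_quotient coset_mult complex_units_def g tgt.add_M)
  qed
  moreover have "g \<in> extensional (carrier (lattice_group M2 Mod L))"
    by (simp add: g_def)
  ultimately show ?thesis
    using that g by (simp add: dual_group_def character_group_def)
qed

text \<open>Characters take \<open>N\<close>-th roots of unity as values on finitely many cosets,
  and being extensional they lie in a finite product.\<close>

lemma finite_dual_group: "finite (carrier (dual_group M2 L))"
proof -
  obtain D where D: "finite D" "\<And>m. m \<in> M2 \<Longrightarrow> \<exists>d\<in>D. m - d \<in> L"
    using finite_index by blast
  have "carrier (lattice_group M2 Mod L) \<subseteq> C ` D"
    using D(2) by (auto simp: carrier_quotient image_iff coset_eq_iff)
  then have "finite (carrier (lattice_group M2 Mod L))"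
    using D(1) finite_subset by blast
  moreover have "finite {z::complex. z ^ N = 1}"
    using N_pos by (intro finite_nth_roots) simp
  ultimately have "finite (PiE (carrier (lattice_group M2 Mod L)) (\<lambda>_. {z::complex. z ^ N = 1}))"
    by (rule finite_PiE)
  moreover have "carrier (dual_group M2 L)
      \<subseteq> PiE (carrier (lattice_group M2 Mod L)) (\<lambda>_. {z. z ^ N = 1})"
  proof
    fix g assume g: "g \<in> carrier (dual_group M2 L)"
    then have "g \<in> extensional (carrier (lattice_group M2 Mod L))"
      by (simp add: dual_group_def character_group_def)
    moreover have "g (C m) ^ N = 1" if "m \<in> M2" for m
      using annihilator_root_of_unity[OF dual_group_annihilator[OF g] that] .
    ultimately show "g \<in> PiE (carrier (lattice_group M2 Mod L)) (\<lambda>_. {z. z ^ N = 1})"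
      by (auto simp: PiE_def carrier_quotient)
  qed
  ultimately show ?thesis
    by (rule finite_subset[rotated])
qed

text \<open>Normalising to 0 outside \<open>M2\<close> leaves one representative of each element of
  the dual group, so that sums over the group make sense.\<close>

definition annihilator\<^sub>0 :: "('w \<Rightarrow> complex) set" where
  "annihilator\<^sub>0 = {t \<in> annihilator. \<forall>x. x \<notin> M2 \<longrightarrow> t x = 0}"

lemma finite_annihilator\<^sub>0: "finite annihilator\<^sub>0"
proof -
  have "annihilator\<^sub>0 \<subseteq> (\<lambda>g m. if m \<in> M2 then g (C m) else 0) ` carrier (dual_group M2 L)"
  proof
    fix t assume "t \<in> annihilator\<^sub>0"
    then have t: "t \<in> annihilator" "\<And>x. x \<notin> M2 \<Longrightarrow> t x = 0"
      by (auto simp: annihilator\<^sub>0_def)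
    obtain g where "g \<in> carrier (dual_group M2 L)" "\<And>m. m \<in> M2 \<Longrightarrow> g (C m) = t m"
      using annihilator_dual_group[OF t(1)] by blast
    then show "t \<in> (\<lambda>g m. if m \<in> M2 then g (C m) else 0) ` carrier (dual_group M2 L)"
      using t(2) by (intro image_eqI[of _ _ g] ext) auto
  qed
  then show ?thesis
    using finite_dual_group finite_surj by blast
qed

lemma annihilator\<^sub>0_restrict:
  "t \<in> annihilator \<Longrightarrow> (\<lambda>x. if x \<in> M2 then t x else 0) \<in> annihilator\<^sub>0"
  using L_subset by (auto simp: annihilator\<^sub>0_def annihilator_def tgt.torus_iff tgt.add_M)

lemma card_annihilator\<^sub>0: "card annihilator\<^sub>0 \<noteq> 0"
proof -
  have "(\<lambda>x. 1) \<in> annihilator"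
    by (simp add: annihilator_def tgt.torus_iff)
  then show ?thesis
    using annihilator\<^sub>0_restrict[of "\<lambda>x. 1"] finite_annihilator\<^sub>0 card_0_eq by blast
qed

text \<open>Orthogonality of characters: for \<open>m\<close> outside \<open>L\<close>,
  multiplication with some \<open>s\<close> such that \<open>s m\<close> differs from 1 permutes the
  group, so the sum equals \<open>s m\<close> times itself.\<close>

lemma sum_annihilator\<^sub>0:
  assumes "m \<in> M2"
  shows "(\<Sum>t\<in>annihilator\<^sub>0. t m) = (if m \<in> L then of_nat (card annihilator\<^sub>0) else 0)"
proof (cases "m \<in> L")
  case True
  then have "(\<Sum>t\<in>annihilator\<^sub>0. t m) = (\<Sum>t\<in>annihilator\<^sub>0. 1)"
    by (intro sum.cong) (auto simp: annihilator\<^sub>0_def annihilatorD)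
  then show ?thesis using True by simp
next
  case False
  then obtain s where s: "s \<in> annihilator" "s m \<noteq> 1"
    using annihilator_separates assms by blast
  let ?h = "\<lambda>t x. s x * t x"
  have "?h ` annihilator\<^sub>0 \<subseteq> annihilator\<^sub>0"
    using annihilator_mult[OF s(1)] by (auto simp: annihilator\<^sub>0_def)
  moreover have "inj_on ?h annihilator\<^sub>0"
  proof (rule inj_onI, rule ext)
    fix t t' x assume t: "t \<in> annihilator\<^sub>0" "t' \<in> annihilator\<^sub>0" "?h t = ?h t'"
    show "t x = t' x"
    proof (cases "x \<in> M2")
      case True
      then show ?thesis
        using fun_cong[OF t(3), of x] tgt.torusD(1)[OF annihilatorD(1)[OF s(1)]] by simp
    next
      case False
      then show ?thesis using t(1,2) by (simp add: annihilator\<^sub>0_def)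
    qed
  qed
  ultimately have "bij_betw ?h annihilator\<^sub>0 annihilator\<^sub>0"
    using endo_inj_surj[OF finite_annihilator\<^sub>0] by (auto simp: bij_betw_def)
  then have "(\<Sum>t\<in>annihilator\<^sub>0. ?h t m) = (\<Sum>t\<in>annihilator\<^sub>0. t m)"
    by (rule sum.reindex_bij_betw[of _ _ _ "\<lambda>t. t m"])
  then have "s m * (\<Sum>t\<in>annihilator\<^sub>0. t m) = (\<Sum>t\<in>annihilator\<^sub>0. t m)"
    by (simp add: sum_distrib_left)
  then show ?thesis using s(2) False by simp
qed

text \<open>Orthogonality is applied to each monomial: those over \<open>L\<close> are counted once
  for every group element, the others cancel.\<close>

lemma laurent_eval_average:
  assumes "F \<in> S_ring \<Delta>2 M2"
  shows "of_nat (card annihilator\<^sub>0) * laurent_eval (restr LE F) \<mu>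
      = (\<Sum>t\<in>annihilator\<^sub>0. laurent_eval F (\<lambda>a. t (snd a) * \<mu> a))"
proof -
  let ?K = "Poly_Mapping.keys F" and ?f = "Poly_Mapping.lookup F"
  have "(\<Sum>t\<in>annihilator\<^sub>0. laurent_eval F (\<lambda>a. t (snd a) * \<mu> a))
      = (\<Sum>t\<in>annihilator\<^sub>0. \<Sum>a\<in>?K. ?f a * \<mu> a * t (snd a))"
    by (simp add: laurent_eval_def algebra_simps)
  also have "\<dots> = (\<Sum>a\<in>?K. ?f a * \<mu> a * (\<Sum>t\<in>annihilator\<^sub>0. t (snd a)))"
    by (subst sum.swap) (simp add: sum_distrib_left)
  also have "\<dots> = (\<Sum>a\<in>?K. of_nat (card annihilator\<^sub>0) * (Poly_Mapping.lookup (restr LE F) a * \<mu> a))"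
  proof (rule sum.cong[OF refl])
    fix a assume "a \<in> ?K"
    then have "snd a \<in> M2"
      using assms tgt.snd_exponents unfolding S_ring_def by blast
    then show "?f a * \<mu> a * (\<Sum>t\<in>annihilator\<^sub>0. t (snd a))
        = of_nat (card annihilator\<^sub>0) * (Poly_Mapping.lookup (restr LE F) a * \<mu> a)"
      by (simp add: sum_annihilator\<^sub>0 lookup_restr)
  qed
  also have "\<dots> = of_nat (card annihilator\<^sub>0) * laurent_eval (restr LE F) \<mu>"
    by (subst laurent_eval_superset[of ?K]) (auto simp: keys_restr sum_distrib_left)
  finally show ?thesis by simp
qed

text \<open>The weight of a monomial under the dual group, whose characters are the classes of
  \<open>M2 / L\<close>.\<close>

definition residue :: "nat \<times> 'w \<Rightarrow> 'w set" where
  "residue a = C (snd a)"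

text \<open>Since N b lies in \<open>L\<close> on the lattice side, (N-1) b + x lies over
  \<open>L\<close> exactly when \<open>x\<close> and \<open>b\<close> have the same residue. The
  shift thus makes one isotypic part invariant.\<close>

lemma restr_LE_shift:
  assumes "b \<in> tgt.E"
  shows "restr LE (Poly_Mapping.single (nsum (N - 1) b) 1 * F)
      = Poly_Mapping.single (nsum (N - 1) b) 1 * restr (residue -` {residue b}) F"
proof (rule restr_mult[of _ "{nsum (N - 1) b}"])
  fix a x assume "a \<in> {nsum (N - 1) b}"
  then have "snd (a + x) = nsum N (snd b) + (snd x - snd b)"
    by (simp add: nsum_N snd_nsum)
  then have "a + x \<in> LE \<longleftrightarrow> nsum N (snd b) + (snd x - snd b) \<in> L"
    by (simp del: snd_add)
  also have "\<dots> \<longleftrightarrow> snd x - snd b \<in> L"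
    by (rule add_L_iff[OF N_M2[OF tgt.snd_exponents[OF assms]]])
  finally show "a + x \<in> LE \<longleftrightarrow> x \<in> residue -` {residue b}"
    by (simp add: residue_def coset_eq_iff)
qed simp

lemma single_S_part: "a \<in> tgt.E \<Longrightarrow> Poly_Mapping.single a 1 \<in> S_part \<Delta>2 M2 (fst a)"
  by (simp add: S_part_single)

lemma laurent_eval_single_mult:
  assumes "\<mu> \<in> monomial_points \<Delta>2 M2" "a \<in> tgt.E" "F \<in> S_part \<Delta>2 M2 d"
  shows "laurent_eval (Poly_Mapping.single a 1 * F) \<mu> = \<mu> a * laurent_eval F \<mu>"
  using tgt.monomial_points_S_part_mult[OF assms(1) single_S_part[OF assms(2)] assms(3)] by simp

text \<open>A nonzero value of the sum gives an isotypic part with nonzero value, and this in turn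
  gives one of its monomials with nonzero value. A power of that monomial keeps the value of the
  part nonzero.\<close>

lemma exists_shift_over_L:
  assumes \<mu>: "\<mu> \<in> monomial_points \<Delta>2 M2" and F: "F \<in> S_part \<Delta>2 M2 d" "laurent_eval F \<mu> \<noteq> 0"
  obtains a where "a \<in> tgt.E" "\<mu> a \<noteq> 0"
    "laurent_eval (restr LE (Poly_Mapping.single a 1 * F)) \<mu> \<noteq> 0"
proof -
  have "(\<Sum>c\<in>residue ` Poly_Mapping.keys F. laurent_eval (restr (residue -` {c}) F) \<mu>) \<noteq> 0"
    using F(2) arg_cong[OF sum_restr_fibres[of F residue], of "\<lambda>F. laurent_eval F \<mu>"]
    by (simp add: laurent_eval_sum)
  then obtain c where c: "laurent_eval (restr (residue -` {c}) F) \<mu> \<noteq> 0"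
    by (rule sum.not_neutral_contains_not_neutral)
  then have "(\<Sum>a\<in>Poly_Mapping.keys (restr (residue -` {c}) F).
      Poly_Mapping.lookup (restr (residue -` {c}) F) a * \<mu> a) \<noteq> 0"
    by (simp add: laurent_eval_def)
  then obtain b where b: "b \<in> Poly_Mapping.keys (restr (residue -` {c}) F)"
    "Poly_Mapping.lookup (restr (residue -` {c}) F) b * \<mu> b \<noteq> 0"
    by (rule sum.not_neutral_contains_not_neutral)
  then have b': "b \<in> tgt.E" "residue b = c" "\<mu> b \<noteq> 0"
    using S_partD(2)[OF F(1)] by (auto simp: keys_restr)
  let ?a = "nsum (N - 1) b"
  have a: "?a \<in> tgt.E" "\<mu> ?a \<noteq> 0"
    using b' tgt.nsum_exponents tgt.monomial_points_nsum[OF \<mu>] by auto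
  show ?thesis
    using that[OF a] c b'(2) a laurent_eval_single_mult[OF \<mu> a(1) S_part_restr[OF F(1)]]
    unfolding restr_LE_shift[OF b'(1)] by simp
qed

text \<open>
  The values of the ratio of \<open>\<nu>\<close> and \<open>\<mu>\<close> are \<open>N\<close>-th roots of unity depending only on the class modulo
  \<open>L\<close>, so they define a character on the subgroup generated by the monomials that do not vanish.
\<close>
lemma fibres_annihilator:
  assumes \<mu>: "\<mu> \<in> monomial_points \<Delta>2 M2" and \<nu>: "\<nu> \<in> monomial_points \<Delta>2 M2"
    and eq: "\<And>a. a \<in> src.E \<Longrightarrow> \<nu> (j a) = \<mu> (j a)"
  obtains t where "t \<in> annihilator" "\<And>a. a \<in> tgt.E \<Longrightarrow> \<nu> a = t (snd a) * \<mu> a"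
proof -
  have pow: "\<nu> a ^ N = \<mu> a ^ N" if a: "a \<in> tgt.E" for a
    using nsum_exponents_over_L[OF a] eq tgt.monomial_points_nsum[OF \<mu> a, of N]
      tgt.monomial_points_nsum[OF \<nu> a, of N] by metis
  have nz: "\<nu> a \<noteq> 0 \<longleftrightarrow> \<mu> a \<noteq> 0" if a: "a \<in> tgt.E" for a
    using pow[OF a] N_pos by (metis (no_types) One_nat_def Suc_le_eq power_eq_0_iff)
  \<comment> \<open>Letting \<open>m\<close> run through whole classes modulo \<open>L\<close> makes
    the extended character trivial on \<open>L\<close>.\<close>
  define R where "R = {(m, \<nu> a / \<mu> a) | a m. a \<in> tgt.E \<and> \<mu> a \<noteq> 0 \<and> m - snd a \<in> L}"
  have RI: "(m, u) \<in> R" if "a \<in> tgt.E" "\<mu> a \<noteq> 0" "m - snd a \<in> L" "u = \<nu> a / \<mu> a" for a m u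
    using that unfolding R_def by blast
  have "character_graph R"
    unfolding character_graph_def
  proof (intro conjI allI impI)
    show "(0, 1) \<in> R"
      using tgt.zero_exponents zero_L monomial_pointsD(1)[OF \<mu>] monomial_pointsD(1)[OF \<nu>]
      by (intro RI[of 0]) simp_all
  next
    fix x u y v assume "(x, u) \<in> R" "(y, v) \<in> R"
    then obtain a b where a: "a \<in> tgt.E" "\<mu> a \<noteq> 0" "x - snd a \<in> L" "u = \<nu> a / \<mu> a"
      and b: "b \<in> tgt.E" "\<mu> b \<noteq> 0" "y - snd b \<in> L" "v = \<nu> b / \<mu> b"
      unfolding R_def by blast
    have "x + y - snd (a + b) \<in> L"
      using add_L[OF a(3) b(3)] by (simp add: algebra_simps)
    then show "(x + y, u * v) \<in> R"
      using a b monomial_pointsD(2)[OF \<mu> a(1) b(1)] monomial_pointsD(2)[OF \<nu> a(1) b(1)]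
      by (intro RI[OF tgt.add_exponents[OF a(1) b(1)]]) simp_all
  next
    fix x u assume "(x, u) \<in> R"
    then obtain a where a: "a \<in> tgt.E" "\<mu> a \<noteq> 0" "x - snd a \<in> L" "u = \<nu> a / \<mu> a"
      unfolding R_def by blast
    \<comment> \<open>Exponents have no negatives; the multiple (N-1) a stands in for the negative
      of \<open>a\<close> modulo \<open>L\<close>, and its value is right because \<open>u\<close>
      is an \<open>N\<close>-th root of unity.\<close>
    have "u * u ^ (N - 1) = u ^ N"
      using N_pos by (cases N) simp_all
    also have "u ^ N = 1"
      using pow[OF a(1)] a(2,4) by (simp add: power_divide)
    finally have "inverse u = u ^ (N - 1)"
      by (rule inverse_unique)
    moreover have "- x - snd (nsum (N - 1) a) \<in> L"
    proof -
      have "- (x - snd a) - nsum N (snd a) \<in> L"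
        using diff_L uminus_L a(3) N_M2 tgt.snd_exponents[OF a(1)] by blast
      then show ?thesis by (simp add: nsum_N snd_nsum)
    qed
    ultimately show "(- x, inverse u) \<in> R"
      using a(1,2,4) tgt.monomial_points_nsum[OF \<mu> a(1)] tgt.monomial_points_nsum[OF \<nu> a(1)]
      by (intro RI[OF tgt.nsum_exponents[OF a(1), of "N - 1"]]) (simp_all add: power_divide)
  next
    fix x show "(x, 0) \<notin> R" using nz unfolding R_def by auto
  next
    fix u assume "(0, u) \<in> R"
    then obtain a where a: "a \<in> tgt.E" "\<mu> a \<noteq> 0" "0 - snd a \<in> L" "u = \<nu> a / \<mu> a"
      unfolding R_def by blast
    \<comment> \<open>An exponent over \<open>L\<close> comes from the source, where the two points
      agree.\<close>
    have "snd a \<in> L" using uminus_L[OF a(3)] by simp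
    then obtain b where "b \<in> src.E" "a = j b"
      using exponents_over_L[OF a(1)] by blast
    then show "u = 1" using eq a by simp
  qed
  then obtain \<chi> where \<chi>: "\<And>x y. \<chi> (x + y) = \<chi> x * \<chi> y" "\<And>x. \<chi> x \<noteq> 0" "\<And>x u. (x, u) \<in> R \<Longrightarrow> \<chi> x = u"
    using character_graph_total_extension by blast
  have "\<chi> x = 1" if "x \<in> L" for x
    using that tgt.zero_exponents monomial_pointsD(1)[OF \<mu>] monomial_pointsD(1)[OF \<nu>]
    by (intro \<chi>(3) RI[of 0]) simp_all
  then have "\<chi> \<in> annihilator"
    using \<chi>(1,2) by (auto simp: annihilator_def tgt.torus_iff)
  moreover have "\<nu> a = \<chi> (snd a) * \<mu> a" if a: "a \<in> tgt.E" for a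
  proof (cases "\<mu> a = 0")
    case False
    then have "\<chi> (snd a) = \<nu> a / \<mu> a"
      using a zero_L by (intro \<chi>(3) RI[of a]) simp_all
    then show ?thesis using False by simp
  qed (use nz a in auto)
  ultimately show ?thesis using that by blast
qed

text \<open>Downstairs the point is a character only on its support. Any lift satisfies \<mu>(N a) =
  \<mu>(a)^N, so its support is forced: it consists of the exponents whose N-fold multiple does not
  vanish downstairs. On this support the values of an extended character are taken.\<close>

lemma lift_monomial_points:
  assumes \<nu>: "\<nu> \<in> monomial_points \<Delta>1 M1"
  obtains \<mu> where "\<mu> \<in> monomial_points \<Delta>2 M2" "\<And>a. a \<in> src.E \<Longrightarrow> \<mu> (j a) = \<nu> a"
proof -
  \<comment> \<open>Extension of characters needs a group, so degrees are read as integers.\<close>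
  define emb where "emb a = (int (fst a), snd a)" for a :: "nat \<times> 'w"
  have emb_add: "emb (a + b) = emb a + emb b" for a b by (simp add: emb_def)
  have emb_inj: "a = b" if "emb a = emb b" for a b using that by (simp add: emb_def prod_eq_iff)
  \<comment> \<open>Differences of exponents in the support form the group that they
    generate.\<close>
  define R where "R = {(emb (j a) - emb (j b), \<nu> a / \<nu> b) | a b. a \<in> src.E \<and> b \<in> src.E \<and> \<nu> a \<noteq> 0 \<and> \<nu> b \<noteq> 0}"
  have RI: "(x, u) \<in> R" if "a \<in> src.E" "b \<in> src.E" "\<nu> a \<noteq> 0" "\<nu> b \<noteq> 0"
    "x = emb (j a) - emb (j b)" "u = \<nu> a / \<nu> b" for a b x u
    using that unfolding R_def by blast
  have "character_graph R"
    unfolding character_graph_def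
  proof (intro conjI allI impI)
    show "(0, 1) \<in> R"
      using src.zero_exponents monomial_pointsD(1)[OF \<nu>] by (intro RI[of 0 0]) simp_all
  next
    fix x u y v assume "(x, u) \<in> R" "(y, v) \<in> R"
    then obtain a b a' b' where a: "a \<in> src.E" "b \<in> src.E" "\<nu> a \<noteq> 0" "\<nu> b \<noteq> 0"
      "x = emb (j a) - emb (j b)" "u = \<nu> a / \<nu> b"
      and a': "a' \<in> src.E" "b' \<in> src.E" "\<nu> a' \<noteq> 0" "\<nu> b' \<noteq> 0"
      "y = emb (j a') - emb (j b')" "v = \<nu> a' / \<nu> b'"
      unfolding R_def by blast
    have "x + y = emb (j (a + a')) - emb (j (b + b'))"
      by (simp add: a a' j_add emb_add)
    then show "(x + y, u * v) \<in> R"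
      using a a' monomial_pointsD(2)[OF \<nu> a(1) a'(1)] monomial_pointsD(2)[OF \<nu> a(2) a'(2)]
      by (intro RI[OF src.add_exponents[OF a(1) a'(1)] src.add_exponents[OF a(2) a'(2)]]) simp_all
  next
    fix x u assume "(x, u) \<in> R"
    then obtain a b where "a \<in> src.E" "b \<in> src.E" "\<nu> a \<noteq> 0" "\<nu> b \<noteq> 0"
      "x = emb (j a) - emb (j b)" "u = \<nu> a / \<nu> b"
      unfolding R_def by blast
    then show "(- x, inverse u) \<in> R" by (intro RI[of b a]) simp_all
  next
    fix x show "(x, 0) \<notin> R" unfolding R_def by auto
  next
    fix u assume "(0, u) \<in> R"
    then obtain a b where a: "a \<in> src.E" "b \<in> src.E" "\<nu> a \<noteq> 0" "\<nu> b \<noteq> 0"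
      "0 = emb (j a) - emb (j b)" "u = \<nu> a / \<nu> b"
      unfolding R_def by blast
    have "emb (j a) = emb (j b)" using a(5) by simp
    then have "a = b" using emb_inj inj_j by (metis injD)
    then show "u = 1" using a by simp
  qed
  then obtain \<chi> where \<chi>: "\<And>x y. \<chi> (x + y) = \<chi> x * \<chi> y" "\<And>x. \<chi> x \<noteq> 0" "\<And>x u. (x, u) \<in> R \<Longrightarrow> \<chi> x = u"
    using character_graph_total_extension by blast
  have \<chi>0: "\<chi> 0 = 1" using \<chi>(1)[of 0 0] \<chi>(2)[of 0] by simp
  \<comment> \<open>The N-fold multiple, brought back to the source along \<open>j\<close>.\<close>
  define P where "P a = inv_into UNIV j (nsum N a)" for a
  have P: "j (P a) = nsum N a" "P a \<in> src.E" if a: "a \<in> tgt.E" for a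
  proof -
    obtain b where "b \<in> src.E" "nsum N a = j b"
      using nsum_exponents_over_L[OF a] .
    then show "j (P a) = nsum N a" "P a \<in> src.E"
      by (simp_all add: P_def inj_j)
  qed
  have Pj: "P (j b) = nsum N b" for b
    unfolding P_def j_nsum[symmetric] using inj_j by simp
  have P_add: "P (a + b) = P a + P b" if "a \<in> tgt.E" "b \<in> tgt.E" for a b
  proof (rule injD[OF inj_j])
    show "j (P (a + b)) = j (P a + P b)"
      using that by (simp add: j_add P tgt.add_exponents nsum_plus)
  qed
  \<comment> \<open>The complement of the support behaves like a prime ideal, since \<open>P\<close>
    is additive and \<open>\<nu>\<close> multiplicative; extending by 0 therefore stays
    multiplicative.\<close>
  define \<mu> where "\<mu> a = (if \<nu> (P a) \<noteq> 0 then \<chi> (emb a) else 0)" for a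
  have ext: "\<mu> (j b) = \<nu> b" if b: "b \<in> src.E" for b
  proof -
    have nz: "\<nu> (P (j b)) \<noteq> 0 \<longleftrightarrow> \<nu> b \<noteq> 0"
      using N_pos unfolding Pj src.monomial_points_nsum[OF \<nu> b] by simp
    have "\<chi> (emb (j b)) = \<nu> b" if "\<nu> b \<noteq> 0"
    proof (rule \<chi>(3), rule RI[OF b src.zero_exponents that])
      show "\<nu> 0 \<noteq> 0" "\<nu> b = \<nu> b / \<nu> 0"
        by (simp_all add: monomial_pointsD(1)[OF \<nu>])
      show "emb (j b) = emb (j b) - emb (j 0)"
        unfolding j_zero by (simp add: emb_def prod_eq_iff)
    qed
    then show ?thesis using nz by (auto simp: \<mu>_def)
  qed
  have "\<mu> \<in> monomial_points \<Delta>2 M2"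
    unfolding monomial_points_def
  proof (intro CollectI conjI ballI)
    show "\<mu> 0 = 1"
      using ext[OF src.zero_exponents] monomial_pointsD(1)[OF \<nu>] by simp
    show "\<mu> (a + b) = \<mu> a * \<mu> b" if "a \<in> tgt.E" "b \<in> tgt.E" for a b
      using monomial_pointsD(2)[OF \<nu> P(2)[OF that(1)] P(2)[OF that(2)]]
      by (simp add: \<mu>_def P_add[OF that] emb_add \<chi>(1))
    obtain b where "b \<in> src.E" "1 \<le> fst b" "\<nu> b \<noteq> 0"
      using monomial_pointsD(3)[OF \<nu>] by blast
    then show "\<exists>a\<in>tgt.E. 1 \<le> fst a \<and> \<mu> a \<noteq> 0"
      using ext j_exponents by (intro bexI[of _ "j b"]) auto
  qed
  then show ?thesis using that ext by blast
qed

text \<open>Surjectivity of the homomorphism of tori: \<open>t\<close> is transported to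
  \<open>L\<close>, where injectivity of \<open>\<phi>\<close> makes it single-valued, and extended
  from there.\<close>

lemma lift_torus:
  assumes "t \<in> torus M1"
  obtains s where "s \<in> torus M2" "\<And>m. m \<in> M1 \<Longrightarrow> s (\<phi> m) = t m"
proof -
  note D = src.torusD[OF assms]
  define R where "R = {(\<phi> m, t m) | m. m \<in> M1}"
  have RI: "(x, u) \<in> R" if "m \<in> M1" "x = \<phi> m" "u = t m" for m x u
    using that unfolding R_def by blast
  have inv: "t (- m) = inverse (t m)" if "m \<in> M1" for m
    using D(2)[OF that src.uminus_M[OF that]] D(3) by (metis add.right_inverse inverse_unique)
  have "character_graph R"
    unfolding character_graph_def
  proof (intro conjI allI impI)
    show "(0, 1) \<in> R" by (rule RI[OF src.zero_M]) (simp_all add: D(3))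
  next
    fix x u y v assume "(x, u) \<in> R" "(y, v) \<in> R"
    then obtain a b where "a \<in> M1" "x = \<phi> a" "u = t a" "b \<in> M1" "y = \<phi> b" "v = t b"
      unfolding R_def by blast
    then show "(x + y, u * v) \<in> R"
      by (intro RI[OF src.add_M, of a b]) (simp_all add: \<phi>_add D(2))
  next
    fix x u assume "(x, u) \<in> R"
    then obtain a where "a \<in> M1" "x = \<phi> a" "u = t a"
      unfolding R_def by blast
    then show "(- x, inverse u) \<in> R"
      by (intro RI[OF src.uminus_M, of a]) (simp_all add: \<phi>_uminus inv)
  next
    fix x show "(x, 0) \<notin> R" using D(1) unfolding R_def by auto
  next
    fix u assume "(0, u) \<in> R"
    then obtain a where "\<phi> a = \<phi> 0" "u = t a"
      unfolding R_def by auto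
    then show "u = 1" using D(3) injD[OF inj_\<phi>] by blast
  qed
  then obtain \<chi> where \<chi>: "\<And>x y. \<chi> (x + y) = \<chi> x * \<chi> y" "\<And>x. \<chi> x \<noteq> 0" "\<And>x u. (x, u) \<in> R \<Longrightarrow> \<chi> x = u"
    using character_graph_total_extension by blast
  have "\<chi> \<in> torus M2" using \<chi>(1,2) by (simp add: tgt.torus_iff)
  moreover have "\<chi> (\<phi> m) = t m" if "m \<in> M1" for m
    using that by (intro \<chi>(3)) (auto simp: R_def)
  ultimately show ?thesis using that by blast
qed

lemma pullback_torus: "t \<in> torus M2 \<Longrightarrow> (\<lambda>m. t (\<phi> m)) \<in> torus M1"
  using L_subset by (simp add: src.torus_iff tgt.torus_iff \<phi>_add)

section \<open>Hypersurfaces and quotients\<close>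

abbreviation "\<pi> \<equiv> toric_morphism \<Delta>1 M1 \<phi>"

lemma annihilator_twist:
  "\<mu> \<in> monomial_points \<Delta>2 M2 \<Longrightarrow> t \<in> annihilator \<Longrightarrow>
   (\<lambda>a. t (snd a) * \<mu> a) \<in> monomial_points \<Delta>2 M2"
  using tgt.torus_twist annihilatorD(1) by blast

lemma toric_morphism_annihilator:
  assumes "\<mu> \<in> monomial_points \<Delta>2 M2" "t \<in> annihilator"
  shows "\<pi> (rep_point \<Delta>2 M2 (\<lambda>a. t (snd a) * \<mu> a)) = \<pi> (rep_point \<Delta>2 M2 \<mu>)"
  unfolding toric_morphism_rep_point[OF assms(1)]
    toric_morphism_rep_point[OF annihilator_twist[OF assms]]
  by (rule rep_point_cong) (use annihilatorD(2)[OF assms(2)] src.snd_exponents in auto)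

text \<open>The factor \<open>c\<close> is constant along the group orbit, so the relation can be
  summed over the group and divided by its order.\<close>

lemma descend_relation:
  assumes A: "A \<in> S_ring \<Delta>2 M2" and B: "B \<in> S_ring \<Delta>2 M2"
    and rel: "\<And>t. t \<in> annihilator \<Longrightarrow>
      c * laurent_eval B (\<lambda>a. t (snd a) * \<mu> a) = laurent_eval A (\<lambda>a. t (snd a) * \<mu> a)"
  shows "c * laurent_eval (descend B) (\<lambda>a. \<mu> (j a)) = laurent_eval (descend A) (\<lambda>a. \<mu> (j a))"
proof -
  have "of_nat (card annihilator\<^sub>0) * (c * laurent_eval (restr LE B) \<mu>)
      = c * (\<Sum>t\<in>annihilator\<^sub>0. laurent_eval B (\<lambda>a. t (snd a) * \<mu> a))"
    by (simp add: laurent_eval_average[OF B, symmetric])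
  also have "\<dots> = (\<Sum>t\<in>annihilator\<^sub>0. laurent_eval A (\<lambda>a. t (snd a) * \<mu> a))"
    unfolding sum_distrib_left
    by (rule sum.cong) (use rel in \<open>auto simp: annihilator\<^sub>0_def\<close>)
  also have "\<dots> = of_nat (card annihilator\<^sub>0) * laurent_eval (restr LE A) \<mu>"
    by (rule laurent_eval_average[OF A, symmetric])
  finally show ?thesis
    using card_annihilator\<^sub>0 by (simp add: laurent_eval_descend A B)
qed

text \<open>If \<open>F\<close> vanished on the whole group orbit, its average would vanish too;
  this is \<open>descend_relation\<close> with 0 in place of \<open>B\<close>.\<close>

lemma descend_nonzero:
  assumes "F \<in> S_ring \<Delta>2 M2" "laurent_eval (descend F) (\<lambda>a. \<mu> (j a)) \<noteq> 0"
  obtains t where "t \<in> annihilator" "laurent_eval F (\<lambda>a. t (snd a) * \<mu> a) \<noteq> 0"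
proof -
  have "0 \<in> S_ring \<Delta>2 M2" by (simp add: S_ring_def)
  then show ?thesis
    using descend_relation[OF assms(1), of 0 1 \<mu>] assms(2) that
    by (auto simp: laurent_eval_descend)
qed

lemma shift_S_part:
  assumes "a \<in> tgt.E" "F \<in> S_part \<Delta>2 M2 d"
  shows "Poly_Mapping.single a 1 * F \<in> S_part \<Delta>2 M2 (fst a + d)"
  using tgt.S_part_mult[OF single_S_part[OF assms(1)] assms(2)] .

text \<open>Both memberships are tested on forms. A form downstairs is pulled back; a form upstairs
  is shifted and descended, and the torus point found downstairs is lifted. The equation is
  insensitive to the choice of lift, because its exponents lie in \<open>L\<close>.\<close>

lemma rep_point_hypersurface_iff:
  assumes \<mu>: "\<mu> \<in> monomial_points \<Delta>2 M2" and f: "f \<in> laurent M1"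
  shows "rep_point \<Delta>2 M2 \<mu> \<in> closure_hypersurface \<Delta>2 M2 (monomial_map \<phi> f) \<longleftrightarrow>
     \<pi> (rep_point \<Delta>2 M2 \<mu>) \<in> closure_hypersurface \<Delta>1 M1 f"
  unfolding toric_morphism_rep_point[OF \<mu>] tgt.rep_point_closure_hypersurface[OF \<mu>]
    src.rep_point_closure_hypersurface[OF pullback_monomial_points[OF \<mu>]] laurent_eval_monomial_map
proof safe
  fix d F assume F: "F \<in> S_part \<Delta>1 M1 d" "laurent_eval F (\<lambda>a. \<mu> (j a)) \<noteq> 0"
    and "\<forall>d. \<forall>F\<in>S_part \<Delta>2 M2 d. laurent_eval F \<mu> \<noteq> 0 \<longrightarrow>
      (\<exists>t\<in>torus M2. laurent_eval f (\<lambda>a. t (\<phi> a)) = 0 \<and> laurent_eval F (\<lambda>a. t (snd a)) \<noteq> 0)"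
  moreover have "laurent_eval (monomial_map j F) \<mu> \<noteq> 0"
    using F(2) by (simp add: laurent_eval_monomial_map)
  ultimately obtain t where "t \<in> torus M2" "laurent_eval f (\<lambda>a. t (\<phi> a)) = 0"
    "laurent_eval (monomial_map j F) (\<lambda>a. t (snd a)) \<noteq> 0"
    using monomial_map_S_part[OF F(1)] by blast
  then show "\<exists>t\<in>torus M1. laurent_eval f t = 0 \<and> laurent_eval F (\<lambda>a. t (snd a)) \<noteq> 0"
    using pullback_torus by (intro bexI[of _ "\<lambda>m. t (\<phi> m)"]) (auto simp: laurent_eval_monomial_map)
next
  fix d F assume F: "F \<in> S_part \<Delta>2 M2 d" "laurent_eval F \<mu> \<noteq> 0"
    and dense: "\<forall>d. \<forall>F\<in>S_part \<Delta>1 M1 d. laurent_eval F (\<lambda>a. \<mu> (j a)) \<noteq> 0 \<longrightarrow>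
      (\<exists>t\<in>torus M1. laurent_eval f t = 0 \<and> laurent_eval F (\<lambda>a. t (snd a)) \<noteq> 0)"
  obtain a where a: "a \<in> tgt.E" "laurent_eval (restr LE (Poly_Mapping.single a 1 * F)) \<mu> \<noteq> 0"
    using exists_shift_over_L[OF \<mu> F] .
  let ?F = "Poly_Mapping.single a 1 * F"
  note S = shift_S_part[OF a(1) F(1)]
  have "laurent_eval (descend ?F) (\<lambda>a. \<mu> (j a)) \<noteq> 0"
    using a(2) laurent_eval_descend[OF S_partD(1)[OF S]] by simp
  then obtain t where t: "t \<in> torus M1" "laurent_eval f t = 0" "laurent_eval (descend ?F) (\<lambda>a. t (snd a)) \<noteq> 0"
    using dense descend_S_part[OF S] by blast
  obtain s where s: "s \<in> torus M2" "\<And>m. m \<in> M1 \<Longrightarrow> s (\<phi> m) = t m"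
    using lift_torus[OF t(1)] by metis
  have "laurent_eval (descend ?F) (\<lambda>a. s (snd (j a))) = laurent_eval (descend ?F) (\<lambda>a. t (snd a))"
    by (rule laurent_eval_cong)
      (use S_partD(2)[OF descend_S_part[OF S]] src.snd_exponents s(2) in auto)
  \<comment> \<open>A nonzero average only says that the form is nonzero at some translate of the
    lift, so the lift is corrected by \<open>r\<close>, which is 1 on \<open>L\<close>.\<close>
  then obtain r where r: "r \<in> annihilator" "laurent_eval ?F (\<lambda>a. r (snd a) * s (snd a)) \<noteq> 0"
    using descend_nonzero[OF S_partD(1)[OF S], of "\<lambda>a. s (snd a)"] t(3) by auto
  let ?r = "\<lambda>m. r m * s m"
  have r': "?r \<in> torus M2"
    using s(1) annihilatorD(1)[OF r(1)] by (simp add: tgt.torus_iff)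
  have "laurent_eval f (\<lambda>m. ?r (\<phi> m)) = laurent_eval f t"
    by (rule laurent_eval_cong) (use f s(2) annihilatorD(2)[OF r(1)] in \<open>auto simp: laurent_def\<close>)
  moreover have "laurent_eval F (\<lambda>a. ?r (snd a)) \<noteq> 0"
    using r(2) laurent_eval_single_mult[OF tgt.torus_monomial_points[OF r'] a(1) F(1)] by auto
  ultimately show "\<exists>t\<in>torus M2. laurent_eval f (\<lambda>a. t (\<phi> a)) = 0 \<and> laurent_eval F (\<lambda>a. t (snd a)) \<noteq> 0"
    using r' t(2) by (intro bexI[of _ ?r]) auto
qed

section \<open>The quotient for a fixed equation\<close>

context
  fixes f :: "'v \<Rightarrow>\<^sub>0 complex" and Z1 Z2
  assumes f: "f \<in> laurent M1"
  defines "Z1 \<equiv> closure_hypersurface \<Delta>1 M1 f"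
    and "Z2 \<equiv> closure_hypersurface \<Delta>2 M2 (monomial_map \<phi> f)"
begin

lemma Z1_subset: "Z1 \<subseteq> toric_variety \<Delta>1 M1"
  unfolding Z1_def by (rule src.closure_hypersurface_subset)

lemma Z2_subset: "Z2 \<subseteq> toric_variety \<Delta>2 M2"
  unfolding Z2_def by (rule tgt.closure_hypersurface_subset)

lemma Z2_cases:
  assumes "p \<in> Z2"
  obtains \<mu> where "\<mu> \<in> monomial_points \<Delta>2 M2" "p = rep_point \<Delta>2 M2 \<mu>"
  using assms Z2_subset tgt.toric_variety_eq by blast

lemma mem_Z2_iff: "\<mu> \<in> monomial_points \<Delta>2 M2 \<Longrightarrow> rep_point \<Delta>2 M2 \<mu> \<in> Z2 \<longleftrightarrow> \<pi> (rep_point \<Delta>2 M2 \<mu>) \<in> Z1"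
  unfolding Z1_def Z2_def by (rule rep_point_hypersurface_iff[OF _ f])

lemma lift_Z1:
  assumes "q \<in> Z1"
  obtains \<mu> where "\<mu> \<in> monomial_points \<Delta>2 M2" "rep_point \<Delta>2 M2 \<mu> \<in> Z2" "\<pi> (rep_point \<Delta>2 M2 \<mu>) = q"
proof -
  obtain \<nu> where \<nu>: "\<nu> \<in> monomial_points \<Delta>1 M1" "q = rep_point \<Delta>1 M1 \<nu>"
    using assms Z1_subset src.toric_variety_eq by blast
  obtain \<mu> where \<mu>: "\<mu> \<in> monomial_points \<Delta>2 M2" "\<And>a. a \<in> src.E \<Longrightarrow> \<mu> (j a) = \<nu> a"
    using lift_monomial_points[OF \<nu>(1)] by metis
  have "\<pi> (rep_point \<Delta>2 M2 \<mu>) = q"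
    unfolding toric_morphism_rep_point[OF \<mu>(1)] \<nu>(2) by (rule rep_point_cong) (rule \<mu>(2))
  then show ?thesis
    using that \<mu>(1) mem_Z2_iff assms by blast
qed

lemma dual_act_rep_point:
  assumes "g \<in> carrier (dual_group M2 L)" "\<mu> \<in> monomial_points \<Delta>2 M2"
  shows "dual_act \<Delta>2 M2 L g (rep_point \<Delta>2 M2 \<mu>) = rep_point \<Delta>2 M2 (\<lambda>a. g (C (snd a)) * \<mu> a)"
  unfolding dual_act_def
  using tgt.torus_act_rep_point[OF assms(2) annihilatorD(1)[OF dual_group_annihilator[OF assms(1)]]] .

lemma dual_act_Z2:
  assumes g: "g \<in> carrier (dual_group M2 L)"
  shows "dual_act \<Delta>2 M2 L g ` Z2 = Z2"
proof
  note t = dual_group_annihilator[OF g]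
  show "dual_act \<Delta>2 M2 L g ` Z2 \<subseteq> Z2"
  proof
    fix q assume "q \<in> dual_act \<Delta>2 M2 L g ` Z2"
    then obtain p where p: "p \<in> Z2" "q = dual_act \<Delta>2 M2 L g p" by blast
    obtain \<mu> where \<mu>: "\<mu> \<in> monomial_points \<Delta>2 M2" "p = rep_point \<Delta>2 M2 \<mu>"
      using Z2_cases[OF p(1)] .
    show "q \<in> Z2"
      using p \<mu> mem_Z2_iff[OF \<mu>(1)] mem_Z2_iff[OF annihilator_twist[OF \<mu>(1) t]]
        toric_morphism_annihilator[OF \<mu>(1) t] dual_act_rep_point[OF g \<mu>(1)] by simp
  qed
  show "Z2 \<subseteq> dual_act \<Delta>2 M2 L g ` Z2"
  proof
    fix p assume p: "p \<in> Z2"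
    obtain \<mu> where \<mu>: "\<mu> \<in> monomial_points \<Delta>2 M2" "p = rep_point \<Delta>2 M2 \<mu>"
      using Z2_cases[OF p] .
    let ?\<nu> = "\<lambda>a. inverse (g (C (snd a))) * \<mu> a"
    note t' = annihilator_inverse[OF t]
    have "rep_point \<Delta>2 M2 ?\<nu> \<in> Z2"
      using p \<mu> mem_Z2_iff[OF \<mu>(1)] mem_Z2_iff[OF annihilator_twist[OF \<mu>(1) t']]
        toric_morphism_annihilator[OF \<mu>(1) t'] by simp
    moreover have "dual_act \<Delta>2 M2 L g (rep_point \<Delta>2 M2 ?\<nu>) = p"
      unfolding dual_act_rep_point[OF g annihilator_twist[OF \<mu>(1) t']] \<mu>(2)
      by (rule rep_point_cong)
        (use tgt.torusD(1)[OF annihilatorD(1)[OF t]] tgt.snd_exponents in \<open>simp add: mult.assoc[symmetric]\<close>)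
    ultimately show "p \<in> dual_act \<Delta>2 M2 L g ` Z2"
      by (intro image_eqI[of _ _ "rep_point \<Delta>2 M2 ?\<nu>"]) simp_all
  qed
qed

lemma toric_morphism_fibres:
  assumes "p \<in> Z2" "q \<in> Z2"
  shows "\<pi> p = \<pi> q \<longleftrightarrow> (\<exists>g\<in>carrier (dual_group M2 L). q = dual_act \<Delta>2 M2 L g p)"
proof -
  obtain \<mu> where \<mu>: "\<mu> \<in> monomial_points \<Delta>2 M2" "p = rep_point \<Delta>2 M2 \<mu>"
    using Z2_cases[OF assms(1)] .
  obtain \<nu> where \<nu>: "\<nu> \<in> monomial_points \<Delta>2 M2" "q = rep_point \<Delta>2 M2 \<nu>"
    using Z2_cases[OF assms(2)] .
  show ?thesis
  proof
    assume "\<pi> p = \<pi> q"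
    then obtain z where z: "z \<noteq> 0" "\<And>a. a \<in> src.E \<Longrightarrow> \<nu> (j a) = z ^ fst a * \<mu> (j a)"
      unfolding \<mu>(2) \<nu>(2) toric_morphism_rep_point[OF \<mu>(1)] toric_morphism_rep_point[OF \<nu>(1)]
        src.rep_point_eq_iff[OF pullback_monomial_points[OF \<mu>(1)] pullback_monomial_points[OF \<nu>(1)]]
      by blast
    \<comment> \<open>Equal images determine the values over \<open>L\<close> only up to scaling by
      degree; the scalar is absorbed in the representative of \<open>p\<close>.\<close>
    let ?\<mu> = "\<lambda>a. z ^ fst a * \<mu> a"
    have \<mu>': "?\<mu> \<in> monomial_points \<Delta>2 M2"
      by (rule tgt.monomial_points_scale[OF \<mu>(1) z(1)])
    have p: "p = rep_point \<Delta>2 M2 ?\<mu>"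
      unfolding \<mu>(2) tgt.rep_point_eq_iff[OF \<mu>(1) \<mu>'] using z(1) by blast
    obtain t where t: "t \<in> annihilator" "\<And>a. a \<in> tgt.E \<Longrightarrow> \<nu> a = t (snd a) * ?\<mu> a"
      using fibres_annihilator[OF \<mu>' \<nu>(1)] z(2) by (metis j_simps(1))
    obtain g where g: "g \<in> carrier (dual_group M2 L)" "\<And>m. m \<in> M2 \<Longrightarrow> g (C m) = t m"
      using annihilator_dual_group[OF t(1)] by blast
    have "q = dual_act \<Delta>2 M2 L g p"
      unfolding \<nu>(2) p dual_act_rep_point[OF g(1) \<mu>']
      by (rule rep_point_cong) (simp add: t(2) g(2) tgt.snd_exponents)
    then show "\<exists>g\<in>carrier (dual_group M2 L). q = dual_act \<Delta>2 M2 L g p"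
      using g(1) by blast
  next
    assume "\<exists>g\<in>carrier (dual_group M2 L). q = dual_act \<Delta>2 M2 L g p"
    then obtain g where g: "g \<in> carrier (dual_group M2 L)" "q = dual_act \<Delta>2 M2 L g p" by blast
    show "\<pi> p = \<pi> q"
      using toric_morphism_annihilator[OF \<mu>(1) dual_group_annihilator[OF g(1)]]
      by (simp add: g(2) \<mu>(2) dual_act_rep_point[OF g(1) \<mu>(1)])
  qed
qed

lemma toric_morphism_basic_open:
  assumes "p \<in> toric_variety \<Delta>2 M2" "F \<in> S_part \<Delta>1 M1 d"
  shows "p \<in> basic_open \<Delta>2 M2 (monomial_map j F) \<longleftrightarrow> \<pi> p \<in> basic_open \<Delta>1 M1 F"
proof -
  obtain \<mu> where \<mu>: "\<mu> \<in> monomial_points \<Delta>2 M2" "p = rep_point \<Delta>2 M2 \<mu>"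
    using assms(1) tgt.toric_variety_eq by blast
  show ?thesis
    unfolding \<mu>(2) toric_morphism_rep_point[OF \<mu>(1)]
      tgt.rep_point_basic_open[OF \<mu>(1) monomial_map_S_part[OF assms(2)]]
      src.rep_point_basic_open[OF pullback_monomial_points[OF \<mu>(1)] assms(2)]
      laurent_eval_monomial_map ..
qed

lemma openin_preimage:
  assumes "openin (subtopology (zariski \<Delta>1 M1) Z1) U"
  shows "openin (subtopology (zariski \<Delta>2 M2) Z2) {p \<in> Z2. \<pi> p \<in> U}"
  unfolding tgt.openin_subtopology_zariski_iff[OF Z2_subset]
proof (intro conjI ballI)
  fix p assume p: "p \<in> {p \<in> Z2. \<pi> p \<in> U}"
  then obtain d F where F: "F \<in> S_part \<Delta>1 M1 d" "\<pi> p \<in> basic_open \<Delta>1 M1 F" "basic_open \<Delta>1 M1 F \<inter> Z1 \<subseteq> U"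
    using assms unfolding src.openin_subtopology_zariski_iff[OF Z1_subset] by blast
  have "\<pi> q \<in> Z1" if "q \<in> Z2" for q
    using Z2_cases[OF that] mem_Z2_iff that by metis
  then have "basic_open \<Delta>2 M2 (monomial_map j F) \<inter> Z2 \<subseteq> {p \<in> Z2. \<pi> p \<in> U}"
    using toric_morphism_basic_open[OF _ F(1)] Z2_subset F(3) by blast
  moreover have "p \<in> basic_open \<Delta>2 M2 (monomial_map j F)"
    using toric_morphism_basic_open[OF _ F(1)] Z2_subset F(2) p by blast
  ultimately show "\<exists>d. \<exists>F\<in>S_part \<Delta>2 M2 d. p \<in> basic_open \<Delta>2 M2 F \<and>
      basic_open \<Delta>2 M2 F \<inter> Z2 \<subseteq> {p \<in> Z2. \<pi> p \<in> U}"
    using monomial_map_S_part[OF F(1)] by blast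
qed blast

text \<open>A basic neighbourhood upstairs is cut out by a form, which is shifted and descended.
  Where the descended form is nonzero, the original one is nonzero at some translate of each point
  above; that translate lies in the preimage of \<open>U\<close> and has the same image.\<close>

lemma openin_of_preimage:
  assumes U: "U \<subseteq> Z1" and "openin (subtopology (zariski \<Delta>2 M2) Z2) {p \<in> Z2. \<pi> p \<in> U}"
  shows "openin (subtopology (zariski \<Delta>1 M1) Z1) U"
  unfolding src.openin_subtopology_zariski_iff[OF Z1_subset]
proof (intro conjI ballI U)
  fix q assume q: "q \<in> U"
  then obtain \<mu> where \<mu>: "\<mu> \<in> monomial_points \<Delta>2 M2" "rep_point \<Delta>2 M2 \<mu> \<in> Z2" "\<pi> (rep_point \<Delta>2 M2 \<mu>) = q"
    using lift_Z1 U by blast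
  then have "rep_point \<Delta>2 M2 \<mu> \<in> {p \<in> Z2. \<pi> p \<in> U}" using q by simp
  then obtain d F where F: "F \<in> S_part \<Delta>2 M2 d" "rep_point \<Delta>2 M2 \<mu> \<in> basic_open \<Delta>2 M2 F"
    "basic_open \<Delta>2 M2 F \<inter> Z2 \<subseteq> {p \<in> Z2. \<pi> p \<in> U}"
    using assms(2) unfolding tgt.openin_subtopology_zariski_iff[OF Z2_subset] by blast
  have "laurent_eval F \<mu> \<noteq> 0"
    using tgt.rep_point_basic_open[OF \<mu>(1) F(1)] F(2) by simp
  then obtain a where a: "a \<in> tgt.E" "laurent_eval (restr LE (Poly_Mapping.single a 1 * F)) \<mu> \<noteq> 0"
    using exists_shift_over_L[OF \<mu>(1) F(1)] by metis
  let ?F = "Poly_Mapping.single a 1 * F"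
  note S = shift_S_part[OF a(1) F(1)]
  note SD = descend_S_part[OF S]
  have "q \<in> basic_open \<Delta>1 M1 (descend ?F)"
    unfolding \<mu>(3)[symmetric] toric_morphism_rep_point[OF \<mu>(1)]
      src.rep_point_basic_open[OF pullback_monomial_points[OF \<mu>(1)] SD]
      laurent_eval_descend[OF S_partD(1)[OF S]] by (rule a(2))
  moreover have "basic_open \<Delta>1 M1 (descend ?F) \<inter> Z1 \<subseteq> U"
  proof
    fix r assume r: "r \<in> basic_open \<Delta>1 M1 (descend ?F) \<inter> Z1"
    then obtain \<kappa> where \<kappa>: "\<kappa> \<in> monomial_points \<Delta>2 M2" "rep_point \<Delta>2 M2 \<kappa> \<in> Z2" "\<pi> (rep_point \<Delta>2 M2 \<kappa>) = r"
      using lift_Z1 by blast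
    have "laurent_eval (descend ?F) (\<lambda>a. \<kappa> (j a)) \<noteq> 0"
      using r unfolding \<kappa>(3)[symmetric] toric_morphism_rep_point[OF \<kappa>(1)]
      using src.rep_point_basic_open[OF pullback_monomial_points[OF \<kappa>(1)] SD] by blast
    then obtain t where t: "t \<in> annihilator" "laurent_eval ?F (\<lambda>a. t (snd a) * \<kappa> a) \<noteq> 0"
      using descend_nonzero[OF S_partD(1)[OF S]] by blast
    let ?\<kappa> = "\<lambda>a. t (snd a) * \<kappa> a"
    note \<kappa>' = annihilator_twist[OF \<kappa>(1) t(1)]
    have "rep_point \<Delta>2 M2 ?\<kappa> \<in> basic_open \<Delta>2 M2 F"
      using t(2) laurent_eval_single_mult[OF \<kappa>' a(1) F(1)] tgt.rep_point_basic_open[OF \<kappa>' F(1)]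
      by auto
    moreover have \<pi>: "\<pi> (rep_point \<Delta>2 M2 ?\<kappa>) = r"
      using toric_morphism_annihilator[OF \<kappa>(1) t(1)] \<kappa>(3) by simp
    ultimately show "r \<in> U"
      using F(3) mem_Z2_iff[OF \<kappa>'] r by auto
  qed
  ultimately show "\<exists>d. \<exists>F\<in>S_part \<Delta>1 M1 d. q \<in> basic_open \<Delta>1 M1 F \<and> basic_open \<Delta>1 M1 F \<inter> Z1 \<subseteq> U"
    using SD by blast
qed

lemma quotient_map_toric_morphism:
  "quotient_map (subtopology (zariski \<Delta>2 M2) Z2) (subtopology (zariski \<Delta>1 M1) Z1) \<pi>"
proof -
  have top: "topspace (subtopology (zariski \<Delta>2 M2) Z2) = Z2" "topspace (subtopology (zariski \<Delta>1 M1) Z1) = Z1"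
    using Z1_subset Z2_subset by (auto simp: src.topspace_zariski tgt.topspace_zariski)
  have "\<pi> p \<in> Z1" if "p \<in> Z2" for p
    using Z2_cases[OF that] mem_Z2_iff that by metis
  moreover have "\<exists>p\<in>Z2. \<pi> p = q" if "q \<in> Z1" for q
    using lift_Z1[OF that] by metis
  ultimately show ?thesis
    unfolding quotient_map_def top using openin_preimage openin_of_preimage by blast
qed

lemma regular_on_pullback:
  assumes "regular_on \<Delta>1 M1 Z1 U h"
  shows "regular_on \<Delta>2 M2 Z2 {p \<in> Z2. \<pi> p \<in> U} (h \<circ> \<pi>)"
  unfolding regular_on_def
proof
  fix p assume p: "p \<in> {p \<in> Z2. \<pi> p \<in> U}"
  then have "\<pi> p \<in> U" by simp
  from bspec[OF assms[unfolded regular_on_def] this]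
  obtain W d A B where AB: "A \<in> S_part \<Delta>1 M1 d" "B \<in> S_part \<Delta>1 M1 d"
    and W: "openin (subtopology (zariski \<Delta>1 M1) Z1) W" "\<pi> p \<in> W" "W \<subseteq> U"
    and h: "\<forall>q\<in>W. \<forall>\<xi>\<in>q. \<xi> B \<noteq> 0 \<and> h q = \<xi> A / \<xi> B"
    by (elim exE bexE conjE) (rule that)
  have "\<xi> (monomial_map j B) \<noteq> 0 \<and> (h \<circ> \<pi>) q = \<xi> (monomial_map j A) / \<xi> (monomial_map j B)"
    if "\<pi> q \<in> W" "\<xi> \<in> q" for q \<xi>
  proof -
    \<comment> \<open>Composing a representative of \<open>q\<close> with the ring homomorphism
      gives a representative of \<open>\<pi> q\<close>, to which the fraction downstairs
      applies.\<close>
    let ?\<eta> = "\<lambda>F. if F \<in> S_ring \<Delta>1 M1 then \<xi> (monomial_map j F) else 0"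
    have "?\<eta> \<in> \<pi> q"
      using that(2) unfolding toric_morphism_def j_def by blast
    from bspec[OF bspec[OF h that(1)] this] show ?thesis
      using S_partD(1)[OF AB(1)] S_partD(1)[OF AB(2)] by simp
  qed
  then show "\<exists>W d. \<exists>A\<in>S_part \<Delta>2 M2 d. \<exists>B\<in>S_part \<Delta>2 M2 d.
      openin (subtopology (zariski \<Delta>2 M2) Z2) W \<and> p \<in> W \<and> W \<subseteq> {p \<in> Z2. \<pi> p \<in> U} \<and>
      (\<forall>q\<in>W. \<forall>\<xi>\<in>q. \<xi> B \<noteq> 0 \<and> (h \<circ> \<pi>) q = \<xi> A / \<xi> B)"
    using p W openin_preimage[OF W(1)] monomial_map_S_part[OF AB(1)] monomial_map_S_part[OF AB(2)]
    by (intro exI[of _ "{p \<in> Z2. \<pi> p \<in> W}"] exI[of _ d] bexI[of _ "monomial_map j A"]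
        bexI[of _ "monomial_map j B"] conjI ballI) auto
qed

text \<open>
  Multiplying numerator and denominator with a section vanishing off the neighbourhood makes the
  relation between them global, hence stable under the group, so that it survives averaging.
\<close>
lemma regular_on_descend:
  assumes U: "openin (subtopology (zariski \<Delta>1 M1) Z1) U"
    and reg: "regular_on \<Delta>2 M2 Z2 {p \<in> Z2. \<pi> p \<in> U} (h \<circ> \<pi>)"
  shows "regular_on \<Delta>1 M1 Z1 U h"
  unfolding regular_on_def
proof
  fix p assume p: "p \<in> U"
  have UZ: "U \<subseteq> Z1"
    using U src.openin_subtopology_zariski_iff[OF Z1_subset] by blast
  obtain \<mu> where \<mu>: "\<mu> \<in> monomial_points \<Delta>2 M2" "rep_point \<Delta>2 M2 \<mu> \<in> Z2" "\<pi> (rep_point \<Delta>2 M2 \<mu>) = p"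
    using lift_Z1 p UZ by blast
  then have "rep_point \<Delta>2 M2 \<mu> \<in> {p \<in> Z2. \<pi> p \<in> U}" using p by simp
  from bspec[OF reg[unfolded regular_on_def comp_def] this]
  obtain W d A B where AB: "A \<in> S_part \<Delta>2 M2 d" "B \<in> S_part \<Delta>2 M2 d"
    and W: "openin (subtopology (zariski \<Delta>2 M2) Z2) W" "rep_point \<Delta>2 M2 \<mu> \<in> W"
    and h: "\<forall>q\<in>W. \<forall>\<xi>\<in>q. \<xi> B \<noteq> 0 \<and> h (\<pi> q) = \<xi> A / \<xi> B"
    by (elim exE bexE conjE) (rule that)
  obtain e F where F: "F \<in> S_part \<Delta>2 M2 e" "rep_point \<Delta>2 M2 \<mu> \<in> basic_open \<Delta>2 M2 F"
    "basic_open \<Delta>2 M2 F \<inter> Z2 \<subseteq> W"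
    using W unfolding tgt.openin_subtopology_zariski_iff[OF Z2_subset] by blast
  have h': "laurent_eval B \<kappa> \<noteq> 0 \<and> h (\<pi> (rep_point \<Delta>2 M2 \<kappa>)) = laurent_eval A \<kappa> / laurent_eval B \<kappa>"
    if "\<kappa> \<in> monomial_points \<Delta>2 M2" "rep_point \<Delta>2 M2 \<kappa> \<in> W" for \<kappa>
    using bspec[OF bspec[OF h that(2)] tgt.rep_point_self[OF that(1)]] AB by simp
  note BF = tgt.S_part_mult[OF AB(2) F(1)] and AF = tgt.S_part_mult[OF AB(1) F(1)]
  have "laurent_eval (B * F) \<mu> \<noteq> 0"
    using h'[OF \<mu>(1) W(2)] F(2) tgt.rep_point_basic_open[OF \<mu>(1) F(1)]
      tgt.monomial_points_S_part_mult[OF \<mu>(1) AB(2) F(1)] by simp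
  \<comment> \<open>The shift is chosen for the denominator; the numerator is multiplied with the
    same monomial, so the fraction is unchanged where it was defined.\<close>
  then obtain a where a: "a \<in> tgt.E" "laurent_eval (restr LE (Poly_Mapping.single a 1 * (B * F))) \<mu> \<noteq> 0"
    using exists_shift_over_L[OF \<mu>(1) BF] by metis
  let ?A = "Poly_Mapping.single a 1 * (A * F)" and ?B = "Poly_Mapping.single a 1 * (B * F)"
  note SA = shift_S_part[OF a(1) AF] and SB = shift_S_part[OF a(1) BF]
  note DA = descend_S_part[OF SA] and DB = descend_S_part[OF SB]
  have pB: "p \<in> basic_open \<Delta>1 M1 (descend ?B)"
    unfolding \<mu>(3)[symmetric] toric_morphism_rep_point[OF \<mu>(1)]
      src.rep_point_basic_open[OF pullback_monomial_points[OF \<mu>(1)] DB]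
      laurent_eval_descend[OF S_partD(1)[OF SB]] by (rule a(2))
  have "openin (subtopology (zariski \<Delta>1 M1) Z1) (U \<inter> (basic_open \<Delta>1 M1 (descend ?B) \<inter> Z1))"
    by (intro openin_Int U openin_subtopology_Int src.basic_open_openin[OF DB])
  moreover have "U \<inter> (basic_open \<Delta>1 M1 (descend ?B) \<inter> Z1) = U \<inter> basic_open \<Delta>1 M1 (descend ?B)"
    using UZ by blast
  ultimately have op: "openin (subtopology (zariski \<Delta>1 M1) Z1) (U \<inter> basic_open \<Delta>1 M1 (descend ?B))"
    by simp
  have "\<eta> (descend ?B) \<noteq> 0 \<and> h q = \<eta> (descend ?A) / \<eta> (descend ?B)"
    if q: "q \<in> U" "q \<in> basic_open \<Delta>1 M1 (descend ?B)" and \<eta>: "\<eta> \<in> q" for q \<eta>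
  proof -
    obtain \<kappa> where \<kappa>: "\<kappa> \<in> monomial_points \<Delta>2 M2" "\<pi> (rep_point \<Delta>2 M2 \<kappa>) = q"
      using lift_Z1 q(1) UZ by blast
    note \<kappa>1 = pullback_monomial_points[OF \<kappa>(1)]
    have q': "q = rep_point \<Delta>1 M1 (\<lambda>a. \<kappa> (j a))"
      using \<kappa>(2) toric_morphism_rep_point[OF \<kappa>(1)] by simp
    have nz: "laurent_eval (descend ?B) (\<lambda>a. \<kappa> (j a)) \<noteq> 0"
      using q(2) src.rep_point_basic_open[OF \<kappa>1 DB] unfolding q' by simp
    have "h q * laurent_eval (descend ?B) (\<lambda>a. \<kappa> (j a)) = laurent_eval (descend ?A) (\<lambda>a. \<kappa> (j a))"
    proof (rule descend_relation[OF S_partD(1)[OF SA] S_partD(1)[OF SB]])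
      fix t assume t: "t \<in> annihilator"
      let ?\<kappa> = "\<lambda>a. t (snd a) * \<kappa> a"
      note \<kappa>' = annihilator_twist[OF \<kappa>(1) t]
      have \<pi>: "\<pi> (rep_point \<Delta>2 M2 ?\<kappa>) = q"
        using toric_morphism_annihilator[OF \<kappa>(1) t] \<kappa>(2) by simp
      have "h q * (laurent_eval B ?\<kappa> * laurent_eval F ?\<kappa>) = laurent_eval A ?\<kappa> * laurent_eval F ?\<kappa>"
      \<comment> \<open>Where \<open>F\<close> vanishes both sides are 0; elsewhere the translate
        lies in \<open>W\<close>, where the fraction represents the function.\<close>
      proof (cases "laurent_eval F ?\<kappa> = 0")
        case False
        then have "rep_point \<Delta>2 M2 ?\<kappa> \<in> basic_open \<Delta>2 M2 F \<inter> Z2"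
          using tgt.rep_point_basic_open[OF \<kappa>' F(1)] mem_Z2_iff[OF \<kappa>'] \<pi> q(1) UZ by auto
        then show ?thesis
          using h'[OF \<kappa>'] F(3) \<pi> by auto
      qed simp
      then show "h q * laurent_eval ?B ?\<kappa> = laurent_eval ?A ?\<kappa>"
        unfolding laurent_eval_single_mult[OF \<kappa>' a(1) AF] laurent_eval_single_mult[OF \<kappa>' a(1) BF]
            tgt.monomial_points_S_part_mult[OF \<kappa>' AB(1) F(1)]
            tgt.monomial_points_S_part_mult[OF \<kappa>' AB(2) F(1)]
        by (simp add: mult.left_commute)
    qed
    \<comment> \<open>Numerator and denominator have equal degree, so the scalar relating
      \<open>\<eta>\<close> to the chosen representative cancels.\<close>
    moreover obtain z where z: "z \<noteq> 0" "\<And>d F. F \<in> S_part \<Delta>1 M1 d \<Longrightarrow> \<eta> F = z ^ d * laurent_eval F (\<lambda>a. \<kappa> (j a))"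
      using src.rep_point_eval[OF \<kappa>1] \<eta> q' by metis
    ultimately show ?thesis
      unfolding z(2)[OF DA] z(2)[OF DB] using nz z(1) by (auto simp: field_simps)
  qed
  then show "\<exists>W d. \<exists>A\<in>S_part \<Delta>1 M1 d. \<exists>B\<in>S_part \<Delta>1 M1 d.
      openin (subtopology (zariski \<Delta>1 M1) Z1) W \<and> p \<in> W \<and> W \<subseteq> U \<and>
      (\<forall>q\<in>W. \<forall>\<xi>\<in>q. \<xi> B \<noteq> 0 \<and> h q = \<xi> A / \<xi> B)"
    using op pB p DA DB
    by (intro exI[of _ "U \<inter> basic_open \<Delta>1 M1 (descend ?B)"] exI[of _ "fst a + (d + e)"]
        bexI[of _ "descend ?A"] bexI[of _ "descend ?B"] conjI ballI) auto
qed

lemma quotient_by_hypersurface: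
  "quotient_by \<Delta>2 M2 Z2 \<Delta>1 M1 Z1 (dual_group M2 L) (dual_act \<Delta>2 M2 L) \<pi>"
  unfolding quotient_by_def
proof (intro conjI ballI allI impI)
  show "regular_on \<Delta>1 M1 Z1 U h \<longleftrightarrow> regular_on \<Delta>2 M2 Z2 {p \<in> Z2. \<pi> p \<in> U} (h \<circ> \<pi>)"
    if "openin (subtopology (zariski \<Delta>1 M1) Z1) U" for U h
    using regular_on_pullback regular_on_descend[OF that] by (rule iffI)
qed (fact dual_act_Z2 toric_morphism_fibres quotient_map_toric_morphism)+

end

end

section \<open>Regularity\<close>

lemma laurent_eval_torus_derivation:
  "laurent_eval (torus_derivation \<delta> F) \<mu> = laurent_eval F (\<lambda>a. \<delta> (snd a) * \<mu> a)"
  by (simp add: torus_derivation_def laurent_eval_mapp)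

context lattice_isogeny
begin

lemma pullback_torus_orbit:
  assumes \<mu>: "\<mu> \<in> monomial_points \<Delta>2 M2" and orb: "rep_point \<Delta>2 M2 \<mu> \<in> torus_orbit \<Delta>2 M2 \<Theta>"
  shows "rep_point \<Delta>1 M1 (\<lambda>a. \<mu> (j a)) \<in> torus_orbit \<Delta>1 M1 (\<phi> -` \<Theta>)"
  unfolding src.rep_point_torus_orbit[OF pullback_monomial_points[OF \<mu>]]
proof (intro allI impI)
  fix k :: nat and m assume k: "1 \<le> k" and km: "(k, m) \<in> src.E"
  have "(k, \<phi> m) \<in> tgt.E" using j_exponents[OF km] by simp
  then have "\<mu> (k, \<phi> m) \<noteq> 0 \<longleftrightarrow> inverse (of_nat k) *\<^sub>Q \<phi> m \<in> \<Theta>"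
    using orb k unfolding tgt.rep_point_torus_orbit[OF \<mu>] by blast
  then show "\<mu> (j (k, m)) \<noteq> 0 \<longleftrightarrow> inverse (of_nat k) *\<^sub>Q m \<in> \<phi> -` \<Theta>"
    by (simp add: \<phi>_scale)
qed

lemma face_pullback:
  assumes "face_ofQ \<Theta> \<Delta>2"
  shows "face_ofQ {x \<in> \<Delta>1. \<phi> x \<in> \<Theta>} \<Delta>1"
proof -
  obtain l c where l: "linear_form l" "\<forall>x\<in>\<Delta>2. c \<le> l x" "\<Theta> = {x \<in> \<Delta>2. l x = c}" "\<Theta> \<noteq> {}"
    using assms by (auto simp: face_ofQ_def)
  have "linear_form (l \<circ> \<phi>)"
    using l(1) linear_\<phi> unfolding linear_form_def by (rule Vector_Spaces.linear_compose[rotated])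
  moreover obtain x where "x \<in> \<Theta>" using l(4) by blast
  moreover have "\<forall>x\<in>\<Delta>1. c \<le> (l \<circ> \<phi>) x" using l(2) by simp
  moreover have "{x \<in> \<Delta>1. \<phi> x \<in> \<Theta>} = {x \<in> \<Delta>1. (l \<circ> \<phi>) x = c}" using l(3) by auto
  moreover have "\<exists>y\<in>\<Delta>1. x = \<phi> y" if "x \<in> \<Theta>" for x using that l(3) \<phi>_\<Delta> by blast
  ultimately show ?thesis unfolding face_ofQ_def by blast
qed

text \<open>An orbit sees only the part of its index inside the polytope, which allows passing
  between a face and the full preimage of a face under \<open>\<phi>\<close>.\<close>

lemma torus_orbit_cong:
  assumes "\<And>x. x \<in> \<Delta>1 \<Longrightarrow> x \<in> \<Theta> \<longleftrightarrow> x \<in> \<Theta>'"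
  shows "torus_orbit \<Delta>1 M1 \<Theta> = torus_orbit \<Delta>1 M1 \<Theta>'"
proof -
  have "inverse (of_nat k) *\<^sub>Q m \<in> \<Delta>1" if "1 \<le> k" "(k, m) \<in> src.E" for k m
    using that by (auto simp: exponents_def)
  then show ?thesis using assms unfolding torus_orbit_def by blast
qed

lemma monomial_map_closure_ideal:
  assumes "F \<in> closure_ideal \<Delta>1 M1 f"
  shows "monomial_map j F \<in> closure_ideal \<Delta>2 M2 (monomial_map \<phi> f)"
proof -
  obtain d q where F: "F \<in> S_part \<Delta>1 M1 d" and q: "q \<in> laurent M1" "monomial_map snd F = f * q"
    using assms by (auto simp: closure_ideal_def)
  have "monomial_map snd (monomial_map j F) = monomial_map \<phi> (monomial_map snd F)"
    by (simp add: monomial_map_comp)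
  also have "\<dots> = monomial_map \<phi> f * monomial_map \<phi> q"
    by (simp add: q(2) monomial_map_mult \<phi>_add)
  finally have "monomial_map snd (monomial_map j F) = monomial_map \<phi> f * monomial_map \<phi> q" .
  moreover have "monomial_map \<phi> q \<in> laurent M2"
    using q(1) \<phi>_M keys_monomial_map[of \<phi> q] unfolding laurent_def by blast
  ultimately show ?thesis
    using monomial_map_S_part[OF F] unfolding closure_ideal_def by blast
qed

text \<open>The image of \<open>f\<close> has exponents in \<open>L\<close>, so the projection to
  \<open>L\<close> passes to the cofactor, and an equation over \<open>L\<close> can be divided by
  the injective \<open>\<phi>\<close>.\<close>

lemma descend_closure_ideal:
  assumes f: "f \<in> laurent M1" and a: "a \<in> tgt.E"
    and "F \<in> closure_ideal \<Delta>2 M2 (monomial_map \<phi> f)"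
  shows "descend (Poly_Mapping.single a 1 * F) \<in> closure_ideal \<Delta>1 M1 f"
proof -
  let ?G = "Poly_Mapping.single a 1 * F" and ?f = "monomial_map \<phi> f"
  obtain d q where F: "F \<in> S_part \<Delta>2 M2 d" and q: "monomial_map snd F = ?f * q"
    using assms(3) by (auto simp: closure_ideal_def)
  note S = shift_S_part[OF a F]
  define r where "r = restr L (Poly_Mapping.single (snd a) 1 * q)"
  define p where "p = Poly_Mapping.map_key \<phi> r"
  have p: "p \<in> laurent M1"
    by (auto simp: laurent_def p_def keys_map_key[OF inj_\<phi>] r_def keys_restr inj_eq[OF inj_\<phi>])
  have rp: "monomial_map \<phi> p = r"
    unfolding p_def by (rule monomial_map_map_key[OF inj_\<phi>]) (auto simp: r_def keys_restr)
  have keys_f: "Poly_Mapping.keys ?f \<subseteq> L"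
    using f keys_monomial_map[of \<phi> f] unfolding laurent_def by blast
  have "monomial_map \<phi> (monomial_map snd (descend ?G)) = monomial_map snd (monomial_map j (descend ?G))"
    by (simp add: monomial_map_comp)
  also have "\<dots> = restr L (monomial_map snd ?G)"
    unfolding monomial_map_descend[OF S_partD(1)[OF S]] by (rule monomial_map_restr)
  also have "monomial_map snd ?G = ?f * (Poly_Mapping.single (snd a) 1 * q)"
    by (simp add: monomial_map_mult q mult.left_commute)
  also have "restr L \<dots> = ?f * r"
    unfolding r_def by (rule restr_mult[OF keys_f]) (rule add_L_iff)
  also have "\<dots> = monomial_map \<phi> (f * p)"
    by (simp add: monomial_map_mult \<phi>_add rp)
  finally have "monomial_map snd (descend ?G) = f * p"
    by (metis map_key_monomial_map[OF inj_\<phi>])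
  then show ?thesis
    using p descend_S_part[OF S] unfolding closure_ideal_def by blast
qed

text \<open>The section is treated one isotypic part at a time. A part with a monomial that does not
  vanish at the point is shifted into the smaller ring, where the hypothesis on \<open>G\<close>
  applies; the shifting monomial is then absorbed in the denominator.\<close>

lemma orbit_multiple_transfer:
  assumes f: "f \<in> laurent M1" and \<mu>: "\<mu> \<in> monomial_points \<Delta>2 M2"
    and orb: "rep_point \<Delta>2 M2 \<mu> \<in> torus_orbit \<Delta>2 M2 \<Theta>"
    and G: "G \<in> S_part \<Delta>1 M1 d"
    and mult: "\<And>e F. F \<in> closure_ideal \<Delta>1 M1 f \<Longrightarrow> F \<in> S_part \<Delta>1 M1 e \<Longrightarrow>
      src.orbit_multiple (\<phi> -` \<Theta>) (\<lambda>a. \<mu> (j a)) d G e F"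
    and F: "F \<in> closure_ideal \<Delta>2 M2 (monomial_map \<phi> f)" "F \<in> S_part \<Delta>2 M2 e"
  shows "tgt.orbit_multiple \<Theta> \<mu> d (monomial_map j G) e F"
proof -
  have "tgt.orbit_multiple \<Theta> \<mu> d (monomial_map j G) e (restr (residue -` {c}) F)" (is "tgt.orbit_multiple _ _ _ _ _ ?F")
    for c
  proof (cases "\<exists>b\<in>Poly_Mapping.keys ?F. \<mu> b \<noteq> 0")
    \<comment> \<open>All points of one orbit have the same support, so the part vanishes on the
      whole orbit.\<close>
    case False
    have "laurent_eval ?F \<nu> = 0"
      if \<nu>: "\<nu> \<in> monomial_points \<Delta>2 M2" "rep_point \<Delta>2 M2 \<nu> \<in> torus_orbit \<Delta>2 M2 \<Theta>" for \<nu>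
    proof -
      have "\<nu> b = 0" if "b \<in> Poly_Mapping.keys ?F" for b
        using that False tgt.orbit_monomial_nz[OF \<mu> orb \<nu>, of b] S_partD(2)[OF F(2)]
        by (auto simp: keys_restr)
      then show ?thesis by (simp add: laurent_eval_def)
    qed
    then show ?thesis
      using \<mu> by (rule tgt.orbit_multiple_vanishing)
  next
    case True
    then obtain b where b: "b \<in> tgt.E" "residue b = c" "\<mu> b \<noteq> 0"
      using S_partD(2)[OF F(2)] by (auto simp: keys_restr)
    define a where "a = nsum (N - 1) b"
    have a: "a \<in> tgt.E" "\<mu> a \<noteq> 0"
      using b tgt.nsum_exponents tgt.monomial_points_nsum[OF \<mu>] by (auto simp: a_def)
    let ?XF = "Poly_Mapping.single a 1 * F"
    note S = shift_S_part[OF a(1) F(2)]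
    have "src.orbit_multiple (\<phi> -` \<Theta>) (\<lambda>a. \<mu> (j a)) d G (fst a + e) (descend ?XF)"
      using mult descend_closure_ideal[OF f a(1) F(1)] descend_S_part[OF S] by blast
    then obtain i k H A where H: "H \<in> S_part \<Delta>1 M1 i" and A: "A \<in> S_part \<Delta>1 M1 k"
      and deg: "i + (fst a + e) = k + d" and Hnz: "laurent_eval H (\<lambda>a. \<mu> (j a)) \<noteq> 0"
      and rel: "\<And>\<nu>. \<nu> \<in> monomial_points \<Delta>1 M1 \<Longrightarrow> rep_point \<Delta>1 M1 \<nu> \<in> torus_orbit \<Delta>1 M1 (\<phi> -` \<Theta>) \<Longrightarrow>
        laurent_eval H \<nu> * laurent_eval (descend ?XF) \<nu> = laurent_eval A \<nu> * laurent_eval G \<nu>"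
      unfolding src.orbit_multiple_def by auto
    let ?H = "Poly_Mapping.single a 1 * monomial_map j H"
    note H2 = monomial_map_S_part[OF H]
    show ?thesis
      unfolding tgt.orbit_multiple_def
    proof (rule exI[of _ "fst a + i"], rule exI[of _ k], rule bexI[of _ ?H],
        rule bexI[of _ "monomial_map j A"], intro conjI ballI impI)
      show "?H \<in> S_part \<Delta>2 M2 (fst a + i)" by (rule shift_S_part[OF a(1) H2])
      show "monomial_map j A \<in> S_part \<Delta>2 M2 k" by (rule monomial_map_S_part[OF A])
      show "fst a + i + e = k + d" using deg by simp
      show "laurent_eval ?H \<mu> \<noteq> 0"
        unfolding laurent_eval_single_mult[OF \<mu> a(1) H2] laurent_eval_monomial_map
        using a(2) Hnz by simp
      fix \<nu> assume \<nu>: "\<nu> \<in> monomial_points \<Delta>2 M2" "rep_point \<Delta>2 M2 \<nu> \<in> torus_orbit \<Delta>2 M2 \<Theta>"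
      have "laurent_eval (descend ?XF) (\<lambda>a. \<nu> (j a)) = laurent_eval (restr LE ?XF) \<nu>"
        by (rule laurent_eval_descend[OF S_partD(1)[OF S]])
      also have "\<dots> = \<nu> a * laurent_eval ?F \<nu>"
        using restr_LE_shift[OF b(1)] laurent_eval_single_mult[OF \<nu>(1) a(1) S_part_restr[OF F(2)]]
        unfolding a_def b(2) by simp
      finally have "laurent_eval (descend ?XF) (\<lambda>a. \<nu> (j a)) = \<nu> a * laurent_eval ?F \<nu>" .
      then show "laurent_eval ?H \<nu> * laurent_eval ?F \<nu>
          = laurent_eval (monomial_map j A) \<nu> * laurent_eval (monomial_map j G) \<nu>"
        using rel[OF pullback_monomial_points[OF \<nu>(1)] pullback_torus_orbit[OF \<nu>]]
        unfolding laurent_eval_single_mult[OF \<nu>(1) a(1) H2] laurent_eval_monomial_map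
        by (simp add: mult.assoc mult.left_commute)
    qed
  qed
  then have "tgt.orbit_multiple \<Theta> \<mu> d (monomial_map j G) e
      (\<Sum>c\<in>residue ` Poly_Mapping.keys F. restr (residue -` {c}) F)"
    using \<mu> by (intro tgt.orbit_multiple_sum) simp_all
  then show ?thesis
    using sum_restr_fibres[of F residue] by simp
qed

text \<open>N is invertible in the complex numbers, so the value at \<open>x\<close> is that at N x,
  which comes from \<open>M1\<close>, divided by N. Geometrically, tangent vectors lift along an
  isogeny of tori.\<close>

lemma extend_additive:
  fixes \<delta> :: "'v \<Rightarrow> complex"
  assumes \<delta>: "\<forall>x\<in>M1. \<forall>y\<in>M1. \<delta> (x + y) = \<delta> x + \<delta> y"
  obtains \<delta>' where "\<forall>x\<in>M2. \<forall>y\<in>M2. \<delta>' (x + y) = \<delta>' x + \<delta>' y" "\<And>m. m \<in> M1 \<Longrightarrow> \<delta>' (\<phi> m) = \<delta> m"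
proof -
  define P where "P x = inv_into UNIV \<phi> (nsum N x)" for x
  have P: "P x \<in> M1 \<and> \<phi> (P x) = nsum N x" if x: "x \<in> M2" for x
    using N_M2[OF x] inj_\<phi> by (auto simp: P_def)
  have P_add: "P (x + y) = P x + P y" if "x \<in> M2" "y \<in> M2" for x y
    using P that tgt.add_M by (intro injD[OF inj_\<phi>]) (simp add: \<phi>_add nsum_plus)
  have "\<delta> 0 = 0" using \<delta> src.zero_M by force
  then have \<delta>_nsum: "\<delta> (nsum k m) = of_nat k * \<delta> m" if "m \<in> M1" for k m
    using that \<delta> src.nsum_M by (induction k) (simp_all add: algebra_simps)
  have "\<phi> (nsum k m) = nsum k (\<phi> m)" for k m
    by (induction k) (simp_all add: \<phi>_add)
  then have P\<phi>: "P (\<phi> m) = nsum N m" for m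
    unfolding P_def using inj_\<phi> by (metis inv_into_f_f UNIV_I)
  show ?thesis
  proof (rule that[of "\<lambda>x. \<delta> (P x) / of_nat N"])
    show "\<forall>x\<in>M2. \<forall>y\<in>M2. \<delta> (P (x + y)) / of_nat N = \<delta> (P x) / of_nat N + \<delta> (P y) / of_nat N"
      using P P_add \<delta> by (simp add: add_divide_distrib)
    show "\<delta> (P (\<phi> m)) / of_nat N = \<delta> m" if "m \<in> M1" for m
      using N_pos by (simp add: P\<phi> \<delta>_nsum[OF that])
  qed
qed

text \<open>Injectivity excludes cancellation between exponents, so the support maps onto the
  support, and linear maps commute with convex hulls.\<close>

lemma newton_polyhedron_monomial_map:
  "newton_polyhedron (monomial_map \<phi> f) = \<phi> ` newton_polyhedron f"
proof -
  have sum: "\<phi> (\<Sum>a\<in>A. u a *\<^sub>Q a) = (\<Sum>a\<in>A. u a *\<^sub>Q \<phi> a)" for A and u :: "'v \<Rightarrow> rat"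
    by (induction A rule: infinite_finite_induct) (simp_all add: \<phi>_add \<phi>_scale)
  have "\<phi> ` convex_hullQ S = convex_hullQ (\<phi> ` S)" for S
  proof
    show "\<phi> ` convex_hullQ S \<subseteq> convex_hullQ (\<phi> ` S)"
    proof
      fix y assume "y \<in> \<phi> ` convex_hullQ S"
      then obtain A u where A: "finite A" "A \<subseteq> S" "\<forall>a\<in>A. 0 \<le> u a" "(\<Sum>a\<in>A. u a) = 1"
        "y = (\<Sum>a\<in>A. u a *\<^sub>Q \<phi> a)"
        by (auto simp: convex_hullQ_def sum)
      have "(\<Sum>b\<in>\<phi> ` A. u (inv_into UNIV \<phi> b)) = 1"
        "(\<Sum>b\<in>\<phi> ` A. u (inv_into UNIV \<phi> b) *\<^sub>Q b) = y"
        using A(4,5) inj_\<phi> by (simp_all add: sum.reindex inj_on_subset[OF inj_\<phi>])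
      then show "y \<in> convex_hullQ (\<phi> ` S)"
        unfolding convex_hullQ_def using A inj_\<phi>
        by (intro CollectI exI[of _ "\<phi> ` A"] exI[of _ "\<lambda>b. u (inv_into UNIV \<phi> b)"]) auto
    qed
    show "convex_hullQ (\<phi> ` S) \<subseteq> \<phi> ` convex_hullQ S"
    proof
      fix y assume "y \<in> convex_hullQ (\<phi> ` S)"
      then obtain B u where B: "finite B" "B \<subseteq> \<phi> ` S" "\<forall>b\<in>B. 0 \<le> u b" "(\<Sum>b\<in>B. u b) = 1"
        "y = (\<Sum>b\<in>B. u b *\<^sub>Q b)"
        by (auto simp: convex_hullQ_def)
      define A where "A = \<phi> -` B"
      have AB: "\<phi> ` A = B" "A \<subseteq> S" "finite A"
        using B(1,2) inj_\<phi> by (auto simp: A_def inj_eq finite_vimageI)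
      have "(\<Sum>a\<in>A. u (\<phi> a)) = 1" "y = \<phi> (\<Sum>a\<in>A. u (\<phi> a) *\<^sub>Q a)"
        using B(4,5) unfolding sum AB(1)[symmetric]
        by (simp_all add: sum.reindex inj_on_subset[OF inj_\<phi>])
      then show "y \<in> \<phi> ` convex_hullQ S"
        unfolding convex_hullQ_def using AB B(3)
        by (intro image_eqI[of y \<phi>] CollectI exI[of _ A] exI[of _ "\<lambda>a. u (\<phi> a)"]) (auto simp: A_def)
    qed
  qed
  then show ?thesis
    by (simp add: newton_polyhedron_def keys_monomial_map_inj inj_\<phi>)
qed

text \<open>The local equation on the orbit below is pulled back. It still generates by
  \<open>orbit_multiple_transfer\<close>, and its differential stays nonzero because the derivation
  detecting it extends to \<open>M2\<close>.\<close>

lemma regular_polynomial_monomial_map: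
  assumes reg: "regular_polynomial \<Delta>1 M1 f"
  shows "regular_polynomial \<Delta>2 M2 (monomial_map \<phi> f)"
  unfolding regular_polynomial_def
proof (intro conjI allI impI ballI)
  have f: "f \<in> laurent M1" and newton: "newton_polyhedron f = \<Delta>1"
    using reg by (auto simp: regular_polynomial_def)
  show "monomial_map \<phi> f \<in> laurent M2"
    using f \<phi>_M keys_monomial_map[of \<phi> f] unfolding laurent_def by blast
  show "newton_polyhedron (monomial_map \<phi> f) = \<Delta>2"
    by (simp add: newton_polyhedron_monomial_map newton \<phi>_\<Delta>)
  fix \<Theta> p assume \<Theta>: "face_ofQ \<Theta> \<Delta>2"
    and p: "p \<in> closure_hypersurface \<Delta>2 M2 (monomial_map \<phi> f) \<inter> torus_orbit \<Delta>2 M2 \<Theta>"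
  obtain \<mu> where \<mu>: "\<mu> \<in> monomial_points \<Delta>2 M2" "p = rep_point \<Delta>2 M2 \<mu>"
    using p tgt.closure_hypersurface_subset tgt.toric_variety_eq by blast
  have orb: "rep_point \<Delta>2 M2 \<mu> \<in> torus_orbit \<Delta>2 M2 \<Theta>" using p \<mu>(2) by simp
  let ?\<Theta> = "{x \<in> \<Delta>1. \<phi> x \<in> \<Theta>}" and ?\<mu> = "\<lambda>a. \<mu> (j a)"
  note \<mu>1 = pullback_monomial_points[OF \<mu>(1)]
  have orbits: "torus_orbit \<Delta>1 M1 ?\<Theta> = torus_orbit \<Delta>1 M1 (\<phi> -` \<Theta>)"
    by (rule torus_orbit_cong) simp
  have "rep_point \<Delta>1 M1 ?\<mu> \<in> closure_hypersurface \<Delta>1 M1 f"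
    using rep_point_hypersurface_iff[OF \<mu>(1) f] p toric_morphism_rep_point[OF \<mu>(1)] \<mu>(2) by simp
  then have "smooth_codim1_at \<Delta>1 M1 (closure_ideal \<Delta>1 M1 f) ?\<Theta> (rep_point \<Delta>1 M1 ?\<mu>)"
    using reg face_pullback[OF \<Theta>] pullback_torus_orbit[OF \<mu>(1) orb]
    unfolding regular_polynomial_def orbits[symmetric] by blast
  then have "\<exists>d. \<exists>G \<in> closure_ideal \<Delta>1 M1 f \<inter> S_part \<Delta>1 M1 d.
      (\<forall>e. \<forall>F \<in> closure_ideal \<Delta>1 M1 f \<inter> S_part \<Delta>1 M1 e. src.orbit_multiple ?\<Theta> ?\<mu> d G e F) \<and>
      (\<exists>\<delta>. (\<forall>x\<in>M1. \<forall>y\<in>M1. \<delta> (x + y) = \<delta> x + \<delta> y) \<and> laurent_eval (torus_derivation \<delta> G) ?\<mu> \<noteq> 0)"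
    unfolding src.smooth_codim1_at_iff[OF \<mu>1] .
  then obtain d G \<delta> where G: "G \<in> closure_ideal \<Delta>1 M1 f" "G \<in> S_part \<Delta>1 M1 d"
    and mult: "\<And>e F. F \<in> closure_ideal \<Delta>1 M1 f \<Longrightarrow> F \<in> S_part \<Delta>1 M1 e \<Longrightarrow>
      src.orbit_multiple (\<phi> -` \<Theta>) ?\<mu> d G e F"
    and \<delta>: "\<forall>x\<in>M1. \<forall>y\<in>M1. \<delta> (x + y) = \<delta> x + \<delta> y" "laurent_eval (torus_derivation \<delta> G) ?\<mu> \<noteq> 0"
    unfolding src.orbit_multiple_def orbits by blast
  obtain \<delta>' where \<delta>': "\<forall>x\<in>M2. \<forall>y\<in>M2. \<delta>' (x + y) = \<delta>' x + \<delta>' y" "\<And>m. m \<in> M1 \<Longrightarrow> \<delta>' (\<phi> m) = \<delta> m"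
    using extend_additive[OF \<delta>(1)] by metis
  have "laurent_eval (torus_derivation \<delta>' (monomial_map j G)) \<mu> = laurent_eval (torus_derivation \<delta> G) ?\<mu>"
    unfolding laurent_eval_torus_derivation laurent_eval_monomial_map
    by (rule laurent_eval_cong) (use S_partD(2)[OF G(2)] src.snd_exponents \<delta>'(2) in auto)
  then show "smooth_codim1_at \<Delta>2 M2 (closure_ideal \<Delta>2 M2 (monomial_map \<phi> f)) \<Theta> p"
    unfolding \<mu>(2) tgt.smooth_codim1_at_iff[OF \<mu>(1)]
    using monomial_map_closure_ideal[OF G(1)] monomial_map_S_part[OF G(2)] \<delta>(2) \<delta>'(1)
      orbit_multiple_transfer[OF f \<mu>(1) orb G(2) mult]
    by (intro exI[of _ d] bexI[of _ "monomial_map j G"] conjI exI[of _ \<delta>']) auto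
qed

end

section \<open>Reflexive pairs\<close>

lemma nsum_eq_scaleQ: "nsum k x = of_nat k *\<^sub>Q x"
  by (induction k) (simp_all add: scaleQ_add_left scaleQ_one)

lemma common_multiple_exists:
  assumes "finite B" "\<And>b. b \<in> B \<Longrightarrow> \<exists>n\<ge>1. P b (n::nat)" "\<And>b n k. P b n \<Longrightarrow> P b (k * n)"
  shows "\<exists>n\<ge>1. \<forall>b\<in>B. P b n"
  using assms(1,2)
proof (induction B rule: finite_induct)
  case (insert x B)
  then obtain k n where "k \<ge> 1" "P x k" "n \<ge> 1" "\<forall>b\<in>B. P b n" by (metis insertCI)
  then have "k * n \<ge> 1" "\<forall>b\<in>insert x B. P b (k * n)"
    using assms(3)[of x k n] assms(3)[of _ n k] by (auto simp: mult.commute)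
  then show ?case by blast
qed auto

lemma rat_denominator_exists: "\<exists>n\<ge>1. of_nat n * (r::rat) \<in> \<int>"
proof -
  obtain a b where ab: "quotient_of r = (a, b)" by fastforce
  then have "b > 0" "r = of_int a / of_int b"
    using quotient_of_denom_pos quotient_of_div by blast+
  then have "of_nat (nat b) * r = of_int a" "nat b \<ge> 1"
    by (simp_all add: of_nat_nat)
  then show ?thesis by (metis Ints_of_int)
qed

text \<open>Extending weights by 0 puts all combinations on one index set, so that two of them can
  be added termwise.\<close>

lemma convex_hullQ_finite:
  assumes "finite S"
  shows "convex_hullQ S = {\<Sum>a\<in>S. u a *\<^sub>Q a | u. (\<forall>a\<in>S. 0 \<le> u a) \<and> (\<Sum>a\<in>S. u a) = 1}"
proof
  show "convex_hullQ S \<subseteq> {\<Sum>a\<in>S. u a *\<^sub>Q a | u. (\<forall>a\<in>S. 0 \<le> u a) \<and> (\<Sum>a\<in>S. u a) = 1}"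
  proof
    fix x assume "x \<in> convex_hullQ S"
    then obtain A u where A: "finite A" "A \<subseteq> S" "\<forall>a\<in>A. 0 \<le> u a" "(\<Sum>a\<in>A. u a) = 1"
      "x = (\<Sum>a\<in>A. u a *\<^sub>Q a)"
      by (auto simp: convex_hullQ_def)
    let ?v = "\<lambda>a. if a \<in> A then u a else 0"
    have "(\<Sum>a\<in>S. ?v a) = (\<Sum>a\<in>A. u a)"
      by (rule sum.mono_neutral_cong_right) (use assms A(2) in auto)
    moreover have "(\<Sum>a\<in>S. ?v a *\<^sub>Q a) = (\<Sum>a\<in>A. u a *\<^sub>Q a)"
      by (rule sum.mono_neutral_cong_right) (use assms A(2) in auto)
    ultimately show "x \<in> {\<Sum>a\<in>S. u a *\<^sub>Q a | u. (\<forall>a\<in>S. 0 \<le> u a) \<and> (\<Sum>a\<in>S. u a) = 1}"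
      using A(3,4,5) by (intro CollectI exI[of _ ?v]) auto
  qed
  show "{\<Sum>a\<in>S. u a *\<^sub>Q a | u. (\<forall>a\<in>S. 0 \<le> u a) \<and> (\<Sum>a\<in>S. u a) = 1} \<subseteq> convex_hullQ S"
    using assms by (auto simp: convex_hullQ_def)
qed

lemma convex_polytopeQ:
  assumes "polytopeQ \<Delta>" "x \<in> \<Delta>" "y \<in> \<Delta>" "0 \<le> s" "0 \<le> t" "s + t = 1"
  shows "s *\<^sub>Q x + t *\<^sub>Q y \<in> \<Delta>"
proof -
  obtain S where S: "finite S" "\<Delta> = convex_hullQ S"
    using assms(1) by (auto simp: polytopeQ_def)
  obtain u v where u: "\<forall>a\<in>S. 0 \<le> u a" "(\<Sum>a\<in>S. u a) = 1" "x = (\<Sum>a\<in>S. u a *\<^sub>Q a)"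
    and v: "\<forall>a\<in>S. 0 \<le> v a" "(\<Sum>a\<in>S. v a) = 1" "y = (\<Sum>a\<in>S. v a *\<^sub>Q a)"
    using assms(2,3) unfolding S(2) convex_hullQ_finite[OF S(1)] by blast
  let ?w = "\<lambda>a. s * u a + t * v a"
  have "s *\<^sub>Q x + t *\<^sub>Q y = (\<Sum>a\<in>S. ?w a *\<^sub>Q a)"
    by (simp add: u(3) v(3) ratv.scale_sum_right scaleQ_scaleQ scaleQ_add_left sum.distrib)
  moreover have "\<forall>a\<in>S. 0 \<le> ?w a" using u(1) v(1) assms(4,5) by simp
  moreover have "(\<Sum>a\<in>S. ?w a) = 1"
    using u(2) v(2) assms(6) by (simp add: sum.distrib sum_distrib_left[symmetric])
  ultimately show ?thesis
    unfolding S(2) convex_hullQ_finite[OF S(1)] by (intro CollectI exI[of _ ?w]) simp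
qed

lemma zero_in_interiorQ:
  assumes "0 \<in> interiorQ \<Delta>"
  shows "0 \<in> \<Delta>"
proof -
  obtain B \<epsilon> where "0 < \<epsilon>" and *: "\<forall>c. (\<forall>b\<in>B. \<bar>c b\<bar> < \<epsilon>) \<longrightarrow> (\<Sum>b\<in>B. c b *\<^sub>Q b) \<in> \<Delta>"
    using assms by (auto simp: interiorQ_def)
  with spec[OF *, of "\<lambda>_. 0"] show ?thesis by simp
qed

lemma Q_basis_coordinates:
  assumes "Q_basis B"
  obtains r where "x = (\<Sum>b\<in>B. r b *\<^sub>Q b)"
proof -
  have "finite B" "x \<in> ratv.span B" using assms by (auto simp: Q_basis_def)
  then show ?thesis using ratv.span_finite that by auto
qed

lemma interiorQ_scaling:
  assumes "0 \<in> interiorQ \<Delta>"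
  obtains \<delta> where "0 < \<delta>" "\<delta> *\<^sub>Q x \<in> \<Delta>"
proof -
  obtain B \<epsilon> where B: "Q_basis B" "0 < \<epsilon>"
    and \<epsilon>: "\<And>c. (\<forall>b\<in>B. \<bar>c b\<bar> < \<epsilon>) \<Longrightarrow> (\<Sum>b\<in>B. c b *\<^sub>Q b) \<in> \<Delta>"
    using assms by (auto simp: interiorQ_def)
  obtain r where r: "x = (\<Sum>b\<in>B. r b *\<^sub>Q b)" using Q_basis_coordinates[OF B(1)] .
  have fin: "finite B" using B(1) by (simp add: Q_basis_def)
  \<comment> \<open>Strictly larger than every coordinate of \<open>x\<close>, and positive even
    when all coordinates are 0, so the factor \<epsilon> / s brings all coordinates below
    \<epsilon>.\<close>
  define s where "s = 1 + (\<Sum>b\<in>B. \<bar>r b\<bar>)"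
  have s: "0 < s" unfolding s_def by (simp add: add_pos_nonneg sum_nonneg)
  have bound: "\<bar>r b\<bar> < s" if "b \<in> B" for b
    using member_le_sum[OF that _ fin, of "\<lambda>b. \<bar>r b\<bar>"] unfolding s_def by simp
  have "\<bar>\<epsilon> / s * r b\<bar> < \<epsilon>" if "b \<in> B" for b
  proof -
    have "\<epsilon> * \<bar>r b\<bar> < \<epsilon> * s" using bound[OF that] B(2) by simp
    then show ?thesis using s B(2) by (simp add: abs_mult field_simps)
  qed
  then have "(\<Sum>b\<in>B. (\<epsilon> / s * r b) *\<^sub>Q b) \<in> \<Delta>" by (intro \<epsilon>) blast
  also have "(\<Sum>b\<in>B. (\<epsilon> / s * r b) *\<^sub>Q b) = (\<epsilon> / s) *\<^sub>Q x"
    by (simp add: r ratv.scale_sum_right scaleQ_scaleQ)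
  finally show ?thesis using that[of "\<epsilon> / s"] s B(2) by simp
qed

lemma lattice_of_rank_closed:
  assumes "lattice_of_rank n M"
  shows "0 \<in> M" "x \<in> M \<Longrightarrow> y \<in> M \<Longrightarrow> x + y \<in> M" "x \<in> M \<Longrightarrow> of_int k *\<^sub>Q x \<in> M"
proof -
  obtain B :: "'a set" where M: "M = {\<Sum>b\<in>B. of_int (c b) *\<^sub>Q b | c :: 'a \<Rightarrow> int. True}"
    using assms by (auto simp: lattice_of_rank_def)
  show "0 \<in> M" unfolding M by (intro CollectI exI[of _ "\<lambda>_. 0"]) simp
  show "x + y \<in> M" if "x \<in> M" "y \<in> M"
  proof -
    obtain c d :: "'a \<Rightarrow> int" where "x = (\<Sum>b\<in>B. of_int (c b) *\<^sub>Q b)" "y = (\<Sum>b\<in>B. of_int (d b) *\<^sub>Q b)"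
      using \<open>x \<in> M\<close> \<open>y \<in> M\<close> unfolding M by blast
    then have "x + y = (\<Sum>b\<in>B. of_int (c b + d b) *\<^sub>Q b)"
      by (simp add: scaleQ_add_left sum.distrib)
    then show ?thesis unfolding M by (intro CollectI exI[of _ "\<lambda>b. c b + d b"]) simp
  qed
  show "of_int k *\<^sub>Q x \<in> M" if "x \<in> M"
  proof -
    obtain c :: "'a \<Rightarrow> int" where "x = (\<Sum>b\<in>B. of_int (c b) *\<^sub>Q b)"
      using \<open>x \<in> M\<close> unfolding M by blast
    then have "of_int k *\<^sub>Q x = (\<Sum>b\<in>B. of_int (k * c b) *\<^sub>Q b)"
      by (simp add: ratv.scale_sum_right scaleQ_scaleQ)
    then show ?thesis unfolding M by (intro CollectI exI[of _ "\<lambda>b. k * c b"]) simp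
  qed
qed

lemma lattice_multiple_exists:
  assumes "lattice_of_rank n M"
  shows "\<exists>k\<ge>1. of_nat k *\<^sub>Q x \<in> M"
proof -
  obtain B :: "'a set" where B: "Q_basis B" "M = {\<Sum>b\<in>B. of_int (c b) *\<^sub>Q b | c :: 'a \<Rightarrow> int. True}"
    using assms by (auto simp: lattice_of_rank_def)
  obtain r where r: "x = (\<Sum>b\<in>B. r b *\<^sub>Q b)" using Q_basis_coordinates[OF B(1)] .
  have "\<exists>k\<ge>1. \<forall>b\<in>B. of_nat k * r b \<in> \<int>"
  proof (rule common_multiple_exists)
    show "finite B" using B(1) by (simp add: Q_basis_def)
    show "\<exists>k\<ge>1. of_nat k * r b \<in> \<int>" for b by (rule rat_denominator_exists)
    show "of_nat (l * k) * r b \<in> \<int>" if "of_nat k * r b \<in> \<int>" for b k l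
      using Ints_mult[OF Ints_of_nat that, of l] by (simp add: mult.assoc)
  qed
  then obtain k where k: "k \<ge> 1" "\<forall>b\<in>B. of_nat k * r b \<in> \<int>" by blast
  define c where "c b = \<lfloor>of_nat k * r b\<rfloor>" for b
  have "of_nat k *\<^sub>Q x = (\<Sum>b\<in>B. of_int (c b) *\<^sub>Q b)"
    unfolding r ratv.scale_sum_right scaleQ_scaleQ
    by (rule sum.cong) (use k(2) in \<open>auto simp: c_def floor_of_int elim!: Ints_cases\<close>)
  then show ?thesis unfolding B(2) using k(1) by blast
qed

text \<open>A common multiple \<open>N\<close> moves every basis vector, hence the whole lattice,
  into \<open>L\<close>. Reducing coordinates modulo \<open>N\<close> then leaves finitely many
  classes.\<close>

lemma finite_index_exists:
  fixes L M :: "'a::rat_vector set"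
  assumes M: "lattice_of_rank n M"
    and L: "0 \<in> L" "\<And>x y. x \<in> L \<Longrightarrow> y \<in> L \<Longrightarrow> x + y \<in> L" "\<And>k x. x \<in> L \<Longrightarrow> of_int k *\<^sub>Q x \<in> L"
    and multiple: "\<And>x. \<exists>k\<ge>1. of_nat k *\<^sub>Q x \<in> L"
  obtains N D where "1 \<le> N" "\<forall>m\<in>M. of_nat N *\<^sub>Q m \<in> L"
    "finite D" "\<forall>m\<in>M. \<exists>d\<in>D. m - d \<in> L"
proof -
  obtain B :: "'a set" where B: "finite B" "M = {\<Sum>b\<in>B. of_int (c b) *\<^sub>Q b | c :: 'a \<Rightarrow> int. True}"
    using M by (auto simp: lattice_of_rank_def Q_basis_def)
  have "\<exists>k\<ge>1. \<forall>b\<in>B. of_nat k *\<^sub>Q b \<in> L"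
  proof (rule common_multiple_exists[OF B(1)])
    show "\<exists>k\<ge>1. of_nat k *\<^sub>Q b \<in> L" for b by (rule multiple)
    show "of_nat (l * k) *\<^sub>Q b \<in> L" if "of_nat k *\<^sub>Q b \<in> L" for b k l
      using L(3)[OF that, of "int l"] by (simp add: scaleQ_scaleQ)
  qed
  then obtain N where N: "N \<ge> 1" "\<And>b. b \<in> B \<Longrightarrow> of_nat N *\<^sub>Q b \<in> L" by blast
  have comb: "(\<Sum>b\<in>B. of_int (c b) *\<^sub>Q of_nat N *\<^sub>Q b) \<in> L" for c :: "'a \<Rightarrow> int"
  proof -
    have "(\<Sum>b\<in>A. of_int (c b) *\<^sub>Q of_nat N *\<^sub>Q b) \<in> L" if "finite A" "A \<subseteq> B" for A
      using that
    proof (induction A rule: finite_induct)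
      case (insert b A)
      have "of_int (c b) *\<^sub>Q of_nat N *\<^sub>Q b \<in> L"
        using insert.prems by (intro L(3) N(2)) simp
      then show ?case
        using insert L(2) by (simp del: ratv.scale_scale)
    qed (simp add: L(1))
    then show ?thesis using B(1) by blast
  qed
  \<comment> \<open>The lattice vectors with all coordinates between 0 and N-1.\<close>
  define D where "D = (\<lambda>c. \<Sum>b\<in>B. of_int (c b) *\<^sub>Q b) ` (PiE B (\<lambda>_. {0..<int N}))"
  show ?thesis
  proof (rule that[OF N(1)]; (intro ballI)?)
    show "of_nat N *\<^sub>Q m \<in> L" if "m \<in> M" for m
    proof -
      obtain c :: "'a \<Rightarrow> int" where c: "m = (\<Sum>b\<in>B. of_int (c b) *\<^sub>Q b)"
        using \<open>m \<in> M\<close> unfolding B(2) by blast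
      show ?thesis
        using comb[of c] by (simp add: c ratv.scale_sum_right scaleQ_scaleQ mult.commute)
    qed
    show "finite D" unfolding D_def using B(1) by (intro finite_imageI finite_PiE) auto
    show "\<exists>d\<in>D. m - d \<in> L" if "m \<in> M" for m
    proof -
      obtain c :: "'a \<Rightarrow> int" where c: "m = (\<Sum>b\<in>B. of_int (c b) *\<^sub>Q b)"
        using \<open>m \<in> M\<close> unfolding B(2) by blast
      define c' where "c' = (\<lambda>b\<in>B. c b mod int N)"
      have "(\<Sum>b\<in>B. of_int (c' b) *\<^sub>Q b) \<in> D"
        unfolding D_def c'_def using N(1) by (intro imageI) auto
      moreover have "m - (\<Sum>b\<in>B. of_int (c' b) *\<^sub>Q b) = (\<Sum>b\<in>B. of_int (c b div int N) *\<^sub>Q of_nat N *\<^sub>Q b)"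
        unfolding c sum_subtractf[symmetric]
      proof (rule sum.cong[OF refl])
        fix b assume "b \<in> B"
        then have "c b - c' b = c b div int N * int N"
          by (simp add: c'_def minus_mod_eq_div_mult)
        then have "of_int (c b) - of_int (c' b) = (of_int (c b div int N) * of_nat N :: rat)"
          by (metis of_int_diff of_int_mult of_int_of_nat_eq)
        then show "of_int (c b) *\<^sub>Q b - of_int (c' b) *\<^sub>Q b = of_int (c b div int N) *\<^sub>Q of_nat N *\<^sub>Q b"
          by (simp add: ratv.scale_left_diff_distrib[symmetric] scaleQ_scaleQ)
      qed
      ultimately show ?thesis using comb by metis
    qed
  qed
qed

lemma Q_basis_finite_dimensional:
  "Q_basis B \<Longrightarrow> finite_dimensional_vector_space (scaleQ :: rat \<Rightarrow> 'a::rat_vector \<Rightarrow> 'a) B"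
  by unfold_locales (auto simp: Q_basis_def)

lemma lattice_of_rank_dim:
  assumes "lattice_of_rank n (M :: 'a::rat_vector set)"
  shows "ratv.dim (UNIV :: 'a set) = n"
proof -
  obtain B :: "'a set" where B: "Q_basis B" "card B = n"
    using assms by (auto simp: lattice_of_rank_def)
  have "ratv.dim (UNIV :: 'a set) = card B"
    by (rule ratv.dim_eq_card) (use B(1) in \<open>simp_all add: Q_basis_def\<close>)
  then show ?thesis using B(2) by simp
qed

lemma polarized_lattice_reflexive_pair:
  assumes "reflexive_pair n \<Delta> M"
  shows "polarized_lattice \<Delta> M"
proof
  have M: "lattice_of_rank n M" and \<Delta>: "polytopeQ \<Delta>" "0 \<in> interiorQ \<Delta>"
    using assms by (auto simp: reflexive_pair_def)
  show "- x \<in> M" if "x \<in> M" for x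
    using lattice_of_rank_closed(3)[OF M that, of "- 1"]
    by (simp add: scaleQ_one)
qed (use assms in \<open>auto simp: reflexive_pair_def intro: lattice_of_rank_closed zero_in_interiorQ convex_polytopeQ\<close>)

lemma lattice_isogeny_finite_morphism:
  fixes \<phi> :: "'v::rat_vector \<Rightarrow> 'w::rat_vector"
  assumes "finite_morphism n \<phi> \<Delta>1 M1 \<Delta>2 M2"
  obtains N where "lattice_isogeny \<Delta>1 M1 \<Delta>2 M2 \<phi> N"
proof -
  have rp: "reflexive_pair n \<Delta>1 M1" "reflexive_pair n \<Delta>2 M2"
    and lin: "Vector_Spaces.linear scaleQ scaleQ \<phi>" and \<phi>M: "\<phi> ` M1 \<subseteq> M2" and \<phi>\<Delta>: "\<phi> ` \<Delta>1 = \<Delta>2"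
    using assms by (auto simp: finite_morphism_def)
  have M1: "lattice_of_rank n M1" and M2: "lattice_of_rank n M2" and int: "0 \<in> interiorQ \<Delta>2"
    using rp by (auto simp: reflexive_pair_def)
  have add: "\<phi> (x + y) = \<phi> x + \<phi> y" and scale: "\<phi> (c *\<^sub>Q x) = c *\<^sub>Q \<phi> x" for x y c
    using lin by (simp_all add: module_hom.add module_hom.scale linear_iff_module_hom)
  have zero: "\<phi> 0 = 0" using add[of 0 0] by simp
  have "\<exists>x. y = \<phi> x" for y
  proof -
    \<comment> \<open>Every vector can be scaled into \<open>\<Delta>2\<close>, which is contained
      in the image of \<open>\<phi>\<close>; the scaling is undone by linearity.\<close>
    obtain \<delta> where \<delta>: "0 < \<delta>" "\<delta> *\<^sub>Q y \<in> \<Delta>2" using interiorQ_scaling[OF int] .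
    then obtain x where "\<delta> *\<^sub>Q y = \<phi> x" using \<phi>\<Delta> by blast
    then have "inverse \<delta> *\<^sub>Q \<delta> *\<^sub>Q y = \<phi> (inverse \<delta> *\<^sub>Q x)" using scale by simp
    then have "y = \<phi> (inverse \<delta> *\<^sub>Q x)" using \<delta>(1) by (simp add: scaleQ_scaleQ scaleQ_one)
    then show ?thesis by blast
  qed
  then have surj: "surj \<phi>" by (simp add: surj_def)
  obtain B1 :: "'v set" where B1: "Q_basis B1" using M1 by (auto simp: lattice_of_rank_def)
  obtain B2 :: "'w set" where B2: "Q_basis B2" using M2 by (auto simp: lattice_of_rank_def)
  interpret finite_dimensional_vector_space_pair scaleQ B1 scaleQ B2
    using Q_basis_finite_dimensional[OF B1] Q_basis_finite_dimensional[OF B2]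
    by (simp add: finite_dimensional_vector_space_pair_def)
  have "inj \<phi>"
    using linear_surjective_imp_injective[OF lin surj] lattice_of_rank_dim[OF M1] lattice_of_rank_dim[OF M2]
    by simp
  then have bij: "bij \<phi>" using surj by (simp add: bij_def)
  \<comment> \<open>Denominators are cleared on the preimage, where \<open>M1\<close> spans the
    rational space.\<close>
  have mult: "\<exists>k\<ge>1. of_nat k *\<^sub>Q y \<in> \<phi> ` M1" for y
  proof -
    obtain x where "y = \<phi> x" using surj by blast
    moreover obtain k where "k \<ge> 1" "of_nat k *\<^sub>Q x \<in> M1" using lattice_multiple_exists[OF M1] by blast
    ultimately show ?thesis using scale by (metis imageI)
  qed
  have L: "0 \<in> \<phi> ` M1" "\<And>x y. x \<in> \<phi> ` M1 \<Longrightarrow> y \<in> \<phi> ` M1 \<Longrightarrow> x + y \<in> \<phi> ` M1"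
    "\<And>k x. x \<in> \<phi> ` M1 \<Longrightarrow> of_int k *\<^sub>Q x \<in> \<phi> ` M1"
  proof -
    show "0 \<in> \<phi> ` M1" using lattice_of_rank_closed(1)[OF M1] zero by (metis imageI)
    show "x + y \<in> \<phi> ` M1" if "x \<in> \<phi> ` M1" "y \<in> \<phi> ` M1" for x y
      using that lattice_of_rank_closed(2)[OF M1] by (auto simp: add[symmetric])
    show "of_int k *\<^sub>Q x \<in> \<phi> ` M1" if "x \<in> \<phi> ` M1" for k x
      using that lattice_of_rank_closed(3)[OF M1] by (auto simp: scale[symmetric])
  qed
  obtain N D where N: "1 \<le> N" "\<forall>m\<in>M2. of_nat N *\<^sub>Q m \<in> \<phi> ` M1"
    and D: "finite D" "\<forall>m\<in>M2. \<exists>d\<in>D. m - d \<in> \<phi> ` M1"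
    by (rule finite_index_exists[OF M2 L mult])
  have "lattice_isogeny \<Delta>1 M1 \<Delta>2 M2 \<phi> N"
    unfolding lattice_isogeny_def lattice_isogeny_axioms_def nsum_eq_scaleQ
    using polarized_lattice_reflexive_pair[OF rp(1)] polarized_lattice_reflexive_pair[OF rp(2)]
      lin bij \<phi>M \<phi>\<Delta> N D by blast
  then show ?thesis by (rule that)
qed

theorem theorem5p3p1:
  fixes \<phi> :: "'v::rat_vector \<Rightarrow> 'w::rat_vector"
    and \<Delta>1 M1 :: "'v set" and \<Delta>2 M2 :: "'w set" and n :: nat
  assumes "finite_morphism n \<phi> \<Delta>1 M1 \<Delta>2 M2"
  shows "finite (carrier (dual_group M2 (\<phi> ` M1))) \<and>
    (\<forall>Z1 \<in> calabi_yau_hypersurfaces \<Delta>1 M1. \<exists>Z2 \<in> calabi_yau_hypersurfaces \<Delta>2 M2.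
       quotient_by \<Delta>2 M2 Z2 \<Delta>1 M1 Z1
         (dual_group M2 (\<phi> ` M1)) (dual_act \<Delta>2 M2 (\<phi> ` M1)) (toric_morphism \<Delta>1 M1 \<phi>))"
proof -
  obtain N where "lattice_isogeny \<Delta>1 M1 \<Delta>2 M2 \<phi> N"
    using lattice_isogeny_finite_morphism[OF assms] .
  then interpret lattice_isogeny \<Delta>1 M1 \<Delta>2 M2 \<phi> N .
  show ?thesis
  proof (intro conjI ballI)
    show "finite (carrier (dual_group M2 (\<phi> ` M1)))" by (rule finite_dual_group)
    fix Z1 assume "Z1 \<in> calabi_yau_hypersurfaces \<Delta>1 M1"
    then obtain f where f: "regular_polynomial \<Delta>1 M1 f" "Z1 = closure_hypersurface \<Delta>1 M1 f"
      by (auto simp: calabi_yau_hypersurfaces_def)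
    then have "f \<in> laurent M1" by (simp add: regular_polynomial_def)
    then have "quotient_by \<Delta>2 M2 (closure_hypersurface \<Delta>2 M2 (monomial_map \<phi> f)) \<Delta>1 M1 Z1
        (dual_group M2 (\<phi> ` M1)) (dual_act \<Delta>2 M2 (\<phi> ` M1)) (toric_morphism \<Delta>1 M1 \<phi>)"
      unfolding f(2) by (rule quotient_by_hypersurface)
    moreover have "closure_hypersurface \<Delta>2 M2 (monomial_map \<phi> f) \<in> calabi_yau_hypersurfaces \<Delta>2 M2"
      using regular_polynomial_monomial_map[OF f(1)] by (auto simp: calabi_yau_hypersurfaces_def)
    ultimately show "\<exists>Z2 \<in> calabi_yau_hypersurfaces \<Delta>2 M2. quotient_by \<Delta>2 M2 Z2 \<Delta>1 M1 Z1
         (dual_group M2 (\<phi> ` M1)) (dual_act \<Delta>2 M2 (\<phi> ` M1)) (toric_morphism \<Delta>1 M1 \<phi>)"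
      by blast
  qed
qed

end
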